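(* Let $\Gamma$ be a countable group with $r$ generators $s_1,\dots,s_r$ and arbitrary relations, let $\mathtt{A}$ be a finite alphabet, and let $J:\mathtt{A}^2\to\mathbb{R}$ be symmetric and $h:\mathtt{A}\to\mathbb{R}$. Let $\Sigma=(\sigma_n)_{n\in\mathbb{N}}$ be any sequence of homomorphisms $\sigma_n:\Gamma\to\mathrm{Sym}(V_n)$, with $V_n$ finite sets, $|V_n|\to\infty$ and $\Delta^{\sigma_n}\to 0$. Then every $\mu\in\mathrm{Prob}(\mathtt{A}^\Gamma)$ which minimizes the free energy density $\mathrm{a}_\Sigma$ relative to $\Sigma$ is a Gibbs measure.
   Context: $\Gamma$ is identified with its left Cayley graph: vertex set $\Gamma$ and an $i$-labeled directed edge $(\gamma,s_i\gamma)$ for each $i\in\{1,\dots,r\}$, $\gamma\in\Gamma$; $e$ is the identity. For a homomorphism $\sigma:\Gamma\to\mathrm{Sym}(V)$ ($V$ finite), write $\sigma^\gamma$ for the image of $\gamma$; the graph of $\sigma$ has vertex set $V$ and an $i$-labeled directed edge $(v,\sigma^{s_i}v)$ for each $i,v$. Graph distances ignore directions; $\mathrm{B}^\sigma(v,R)$, $\mathrm{B}^\Gamma(\gamma,R)$ are closed balls. $\mathrm{B}^\sigma(v,R)\cong \mathrm{B}^\Gamma(e,R)$ means the induced subgraphs are isomorphic respecting edge labels and directions. Define $$\delta_R^\sigma=\frac{1}{|V|}\big|\{v\in V: \mathrm{B}^\sigma(v,R)\not\cong \mathrm{B}^\Gamma(e,R)\}\big|,\qquad \Delta^\sigma=\inf_R\big(9(2/3)^R+6\delta_R^\sigma\big).$$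 Empirical distributions: for $\mathbf{x}\in\mathtt{A}^V$, $v\in V$, let $(\Pi_v^\sigma\mathbf{x})(\gamma)=\mathbf{x}(\sigma^\gamma v)$, $P_{\mathbf{x}}^\sigma=\frac{1}{|V|}\sum_{v\in V}\delta_{\Pi_v^\sigma\mathbf{x}}\in\mathrm{Prob}(\mathtt{A}^\Gamma)$; for $\zeta\in\mathrm{Prob}(\mathtt{A}^V)$ let $P_\zeta^\sigma=\int P_{\mathbf{x}}^\sigma\,\zeta(d\mathbf{x})$. For a weak-open set $\mathcal{O}\subset\mathrm{Prob}(\mathtt{A}^\Gamma)$ let $\mathbf{\Omega}(\sigma,\mathcal{O})=\{\zeta\in\mathrm{Prob}(\mathtt{A}^V): P_\zeta^\sigma\in\mathcal{O}\}$. Free energy density: for $\mathbf{x}\in\mathtt{A}^V$ let $U(\mathbf{x})=\sum_{v\in V}h(\mathbf{x}(v))+\sum_{v\in V}\sum_{i=1}^r J(\mathbf{x}(v),\mathbf{x}(\sigma^{s_i}v))$; $\zeta(U)$ is the $\zeta$-mean of $U$ and $\mathrm{H}(\zeta)$ is Shannon entropy (natural log). Define $$\mathrm{a}_\Sigma(\mu)=\sup_{\mathcal{O}\ni\mu}\ \limsup_{n\to\infty}\ \inf_{\zeta\in\mathbf{\Omega}(\sigma_n,\mathcal{O})}\frac{1}{|V_n|}\big[\zeta(U)-\mathrm{H}(\zeta)\big],$$ the supremum over weak-open neighborhoods of $\mu$ (equivalently, the limit as $\mathcal{O}\downarrow\mu$), with $\inf\varnothing=+\infty$. For $\mu$ that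 is not invariant under the shift action $(\beta\mathbf{y})(\gamma)=\mathbf{y}(\gamma\beta)$, this expression equals $+\infty$; the function $\mathrm{a}_\Sigma$ is not identically $+\infty$. Gibbs measures: let $S=\{s_1,\dots,s_r,s_1^{-1},\dots,s_r^{-1}\}$. For $\gamma\in\Gamma$, $\mathbf{x}\in\mathtt{A}^\Gamma$, let $\Phi_\gamma(\mathbf{x})=h(\mathbf{x}(\gamma))+\sum_{s\in S}J(\mathbf{x}(\gamma),\mathbf{x}(s\gamma))$. Let $\mathbf{x}^{\gamma\to\mathtt{a}}$ be $\mathbf{x}$ with its value at $\gamma$ replaced by $\mathtt{a}$, and $c_\gamma(\mathbf{x},\mathtt{a})=\exp\{-\Phi_\gamma(\mathbf{x}^{\gamma\to\mathtt{a}})\}/\sum_{\mathtt{b}\in\mathtt{A}}\exp\{-\Phi_\gamma(\mathbf{x}^{\gamma\to\mathtt{b}})\}$. $\mu\in\mathrm{Prob}(\mathtt{A}^\Gamma)$ is Gibbs if for each $\gamma\in\Gamma$, $\mathtt{a}\in\mathtt{A}$, the function $\mathbf{y}\mapsto c_\gamma(\mathbf{y},\mathtt{a})$ is a version of $\mu(\mathbf{x}(\gamma)=\mathtt{a}\mid\mathscr{T}_\gamma)(\mathbf{y})$, where $\mathscr{T}_\gamma$ is the $\sigma$-algebra generated by all coordinates other than $\gamma$.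
   Formalization: The sum over S in Φ_γ counts the letters s_i and s_i^{-1} with multiplicity (a generator equal to e counted once), not S as a set; with the literal set the claim fails, e.g. for Γ = Z/2 generated by its involution, where U counts each edge twice. *)

theory Defs
  imports "HOL-Probability.Probability" "HOL-Algebra.Generated_Groups" "HOL-Algebra.Bij"
begin

section \<open>Edge-labeled directed graphs\<close>

record 'v labeled_digraph =
  lverts :: "'v set"
  ledges :: "(nat \<times> 'v \<times> 'v) set"

definition adjacency :: "'v labeled_digraph \<Rightarrow> 'v rel" where
  "adjacency D = {(u, w). \<exists>i. (i, u, w) \<in> ledges D \<or> (i, w, u) \<in> ledges D}"

definition graph_dist :: "'v labeled_digraph \<Rightarrow> 'v \<Rightarrow> 'v \<Rightarrow> enat" where
  "graph_dist D u w = (INF k\<in>{k. (u, w) \<in> adjacency D ^^ k}. enat k)"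

definition graph_ball :: "'v labeled_digraph \<Rightarrow> 'v \<Rightarrow> nat \<Rightarrow> 'v set" where
  "graph_ball D v R = {w \<in> lverts D. graph_dist D v w \<le> enat R}"

definition induced :: "'v labeled_digraph \<Rightarrow> 'v set \<Rightarrow> 'v labeled_digraph" where
  "induced D B = \<lparr>lverts = lverts D \<inter> B, ledges = {(i, u, w) \<in> ledges D. u \<in> B \<and> w \<in> B}\<rparr>"

definition labeled_iso :: "'v labeled_digraph \<Rightarrow> 'w labeled_digraph \<Rightarrow> bool" where
  "labeled_iso D D' \<longleftrightarrow> (\<exists>f. bij_betw f (lverts D) (lverts D') \<and>
     (\<forall>i. \<forall>u\<in>lverts D. \<forall>w\<in>lverts D. (i, u, w) \<in> ledges D \<longleftrightarrow> (i, f u, f w) \<in> ledges D'))"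

text \<open>
  The generators of \<open>G\<close> are \<open>s 1, \<dots>, s r\<close>. A homomorphism from \<open>G\<close> to the symmetric group
  of a set \<open>V\<close> is an element \<open>\<sigma>\<close> of \<open>hom G (BijGroup V)\<close>.
\<close>

definition cayley_graph :: "('g, 'm) monoid_scheme \<Rightarrow> nat \<Rightarrow> (nat \<Rightarrow> 'g) \<Rightarrow> 'g labeled_digraph" where
  "cayley_graph G r s = \<lparr>lverts = carrier G,
     ledges = {(i, \<gamma>, s i \<otimes>\<^bsub>G\<^esub> \<gamma>) | i \<gamma>. i \<in> {1..r} \<and> \<gamma> \<in> carrier G}\<rparr>"

definition action_graph ::
    "nat \<Rightarrow> (nat \<Rightarrow> 'g) \<Rightarrow> 'v set \<Rightarrow> ('g \<Rightarrow> 'v \<Rightarrow> 'v) \<Rightarrow> 'v labeled_digraph" where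
  "action_graph r s V \<sigma> = \<lparr>lverts = V,
     ledges = {(i, v, \<sigma> (s i) v) | i v. i \<in> {1..r} \<and> v \<in> V}\<rparr>"

definition defect ::
    "('g, 'm) monoid_scheme \<Rightarrow> nat \<Rightarrow> (nat \<Rightarrow> 'g) \<Rightarrow> 'v set \<Rightarrow> ('g \<Rightarrow> 'v \<Rightarrow> 'v) \<Rightarrow> nat \<Rightarrow> real" where
  "defect G r s V \<sigma> R =
     real (card {v \<in> V. \<not> labeled_iso
        (induced (action_graph r s V \<sigma>) (graph_ball (action_graph r s V \<sigma>) v R))
        (induced (cayley_graph G r s) (graph_ball (cayley_graph G r s) \<one>\<^bsub>G\<^esub> R))}) / real (card V)"

definition total_defect ::
    "('g, 'm) monoid_scheme \<Rightarrow> nat \<Rightarrow> (nat \<Rightarrow> 'g) \<Rightarrow> 'v set \<Rightarrow> ('g \<Rightarrow> 'v \<Rightarrow> 'v) \<Rightarrow> real" where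
  "total_defect G r s V \<sigma> = (INF R. 9 * (2 / 3) ^ R + 6 * defect G r s V \<sigma> R)"


section \<open>Configurations and the weak topology\<close>

text \<open>
  The alphabet is a finite type; elements of \<open>A\<^sup>\<Gamma>\<close> are functions extensional on \<open>carrier G\<close>.
\<close>

definition config_space :: "('g, 'm) monoid_scheme \<Rightarrow> ('g \<Rightarrow> 'a::finite) measure" where
  "config_space G = PiM (carrier G) (\<lambda>_. count_space UNIV)"

definition config_prob :: "('g, 'm) monoid_scheme \<Rightarrow> ('g \<Rightarrow> 'a::finite) measure set" where
  "config_prob G = {\<mu>. prob_space \<mu> \<and> sets \<mu> = sets (config_space G)}"

text \<open>
  Since \<open>A\<^sup>\<Gamma>\<close> is compact, its continuous real functions are the bounded continuous ones.
\<close>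

definition weak_topology :: "('g, 'm) monoid_scheme \<Rightarrow> ('g \<Rightarrow> 'a::finite) measure topology" where
  "weak_topology G = topology_generated_by
     {{\<mu> \<in> config_prob G. (\<integral>x. f x \<partial>\<mu>) \<in> U} | f U.
        continuous_map (product_topology (\<lambda>_. discrete_topology UNIV) (carrier G)) euclideanreal f \<and>
        open U}"


section \<open>Empirical distributions\<close>

definition pullback_name ::
    "('g, 'm) monoid_scheme \<Rightarrow> ('g \<Rightarrow> 'v \<Rightarrow> 'v) \<Rightarrow> ('v \<Rightarrow> 'a) \<Rightarrow> 'v \<Rightarrow> ('g \<Rightarrow> 'a)" where
  "pullback_name G \<sigma> x v = (\<lambda>\<gamma>\<in>carrier G. x (\<sigma> \<gamma> v))"

definition empirical ::
    "('g, 'm) monoid_scheme \<Rightarrow> 'v set \<Rightarrow> ('g \<Rightarrow> 'v \<Rightarrow> 'v) \<Rightarrow> ('v \<Rightarrow> 'a::finite) \<Rightarrow> ('g \<Rightarrow> 'a) measure" where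
  "empirical G V \<sigma> x = distr (uniform_count_measure V) (config_space G) (pullback_name G \<sigma> x)"

definition finite_config_prob :: "'v set \<Rightarrow> ('v \<Rightarrow> 'a::finite) pmf set" where
  "finite_config_prob V = {\<zeta>. set_pmf \<zeta> \<subseteq> V \<rightarrow>\<^sub>E UNIV}"

definition mean_empirical ::
    "('g, 'm) monoid_scheme \<Rightarrow> 'v set \<Rightarrow> ('g \<Rightarrow> 'v \<Rightarrow> 'v) \<Rightarrow> ('v \<Rightarrow> 'a::finite) pmf \<Rightarrow> ('g \<Rightarrow> 'a) measure" where
  "mean_empirical G V \<sigma> \<zeta> = measure_pmf \<zeta> \<bind> empirical G V \<sigma>"

definition good_models ::
    "('g, 'm) monoid_scheme \<Rightarrow> 'v set \<Rightarrow> ('g \<Rightarrow> 'v \<Rightarrow> 'v) \<Rightarrow> ('g \<Rightarrow> 'a::finite) measure set \<Rightarrow>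
      ('v \<Rightarrow> 'a) pmf set" where
  "good_models G V \<sigma> \<O> = {\<zeta> \<in> finite_config_prob V. mean_empirical G V \<sigma> \<zeta> \<in> \<O>}"


section \<open>Free energy density\<close>

definition energy ::
    "nat \<Rightarrow> (nat \<Rightarrow> 'g) \<Rightarrow> ('a \<Rightarrow> real) \<Rightarrow> ('a \<Rightarrow> 'a \<Rightarrow> real) \<Rightarrow>
      'v set \<Rightarrow> ('g \<Rightarrow> 'v \<Rightarrow> 'v) \<Rightarrow> ('v \<Rightarrow> 'a) \<Rightarrow> real" where
  "energy r s h J V \<sigma> x =
     (\<Sum>v\<in>V. h (x v)) + (\<Sum>v\<in>V. \<Sum>i\<in>{1..r}. J (x v) (x (\<sigma> (s i) v)))"

definition shannon_entropy :: "'v set \<Rightarrow> ('v \<Rightarrow> 'a::finite) pmf \<Rightarrow> real" where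
  "shannon_entropy V \<zeta> = - (\<Sum>x\<in>V \<rightarrow>\<^sub>E UNIV. pmf \<zeta> x * ln (pmf \<zeta> x))"

definition free_energy_density ::
    "('g, 'm) monoid_scheme \<Rightarrow> nat \<Rightarrow> (nat \<Rightarrow> 'g) \<Rightarrow> ('a \<Rightarrow> real) \<Rightarrow> ('a \<Rightarrow> 'a \<Rightarrow> real) \<Rightarrow>
      (nat \<Rightarrow> 'v set) \<Rightarrow> (nat \<Rightarrow> 'g \<Rightarrow> 'v \<Rightarrow> 'v) \<Rightarrow> ('g \<Rightarrow> 'a::finite) measure \<Rightarrow> ereal" where
  "free_energy_density G r s h J V \<sigma> \<mu> =
     (SUP \<O>\<in>{\<O>. openin (weak_topology G) \<O> \<and> \<mu> \<in> \<O>}.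
        limsup (\<lambda>n. INF \<zeta>\<in>good_models G (V n) (\<sigma> n) \<O>.
          ereal (1 / real (card (V n)) *
            (measure_pmf.expectation \<zeta> (energy r s h J (V n) (\<sigma> n)) - shannon_entropy (V n) \<zeta>))))"


section \<open>Gibbs measures\<close>

text \<open>
  The sum over \<open>S = {s 1, \<dots>, s r, (s 1)\<inverse>, \<dots>, (s r)\<inverse>}\<close> is indexed by the letters, not by
  the subset of the group: if generators coincide or are involutions, every labeled edge of the
  Cayley graph at \<open>\<gamma>\<close> contributes, exactly as it does in \<open>energy\<close>. A generator that is trivial
  in the group gives a single loop at \<open>\<gamma>\<close>, which \<open>energy\<close> counts once, so it contributes
  only one summand, \<open>s i\<close> and its inverse being the same step.
\<close>

definition local_energy ::
    "('g, 'm) monoid_scheme \<Rightarrow> nat \<Rightarrow> (nat \<Rightarrow> 'g) \<Rightarrow> ('a \<Rightarrow> real) \<Rightarrow> ('a \<Rightarrow> 'a \<Rightarrow> real) \<Rightarrow>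
      'g \<Rightarrow> ('g \<Rightarrow> 'a) \<Rightarrow> real" where
  "local_energy G r s h J \<gamma> x = h (x \<gamma>)
     + (\<Sum>i\<in>{1..r}. J (x \<gamma>) (x (s i \<otimes>\<^bsub>G\<^esub> \<gamma>)))
     + (\<Sum>i\<in>{i\<in>{1..r}. s i \<noteq> \<one>\<^bsub>G\<^esub>}. J (x \<gamma>) (x (inv\<^bsub>G\<^esub> (s i) \<otimes>\<^bsub>G\<^esub> \<gamma>)))"

lemma local_energy_eq_sum_over_set:
  assumes "inj_on s {1..r}" "inj_on (\<lambda>i. inv\<^bsub>G\<^esub> (s i)) {1..r}"
    and "s ` {1..r} \<inter> (\<lambda>i. inv\<^bsub>G\<^esub> (s i)) ` {1..r} = {}" and "group G"
  shows "local_energy G r s h J \<gamma> x = h (x \<gamma>) +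
    (\<Sum>t\<in>s ` {1..r} \<union> (\<lambda>i. inv\<^bsub>G\<^esub> (s i)) ` {1..r}. J (x \<gamma>) (x (t \<otimes>\<^bsub>G\<^esub> \<gamma>)))"
proof -
  interpret group G by fact
  have "s i \<noteq> \<one>\<^bsub>G\<^esub>" if "i \<in> {1..r}" for i
  proof
    assume "s i = \<one>\<^bsub>G\<^esub>"
    then have "s i = inv\<^bsub>G\<^esub> (s i)" by simp
    with that assms(3) show False by blast
  qed
  then have "{i\<in>{1..r}. s i \<noteq> \<one>\<^bsub>G\<^esub>} = {1..r}" by blast
  then show ?thesis
    using assms(1-3)
    by (simp only: local_energy_def sum.union_disjoint[OF _ _ assms(3)] sum.reindex
        finite_imageI finite_atLeastAtMost o_def add.assoc)
qed

definition glauber_rate ::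
    "('g, 'm) monoid_scheme \<Rightarrow> nat \<Rightarrow> (nat \<Rightarrow> 'g) \<Rightarrow> ('a::finite \<Rightarrow> real) \<Rightarrow> ('a \<Rightarrow> 'a \<Rightarrow> real) \<Rightarrow>
      'g \<Rightarrow> ('g \<Rightarrow> 'a) \<Rightarrow> 'a \<Rightarrow> real" where
  "glauber_rate G r s h J \<gamma> x a =
     exp (- local_energy G r s h J \<gamma> (x(\<gamma> := a))) /
     (\<Sum>b\<in>UNIV. exp (- local_energy G r s h J \<gamma> (x(\<gamma> := b))))"

definition other_coords :: "('g, 'm) monoid_scheme \<Rightarrow> 'g \<Rightarrow> ('g \<Rightarrow> 'a::finite) measure" where
  "other_coords G \<gamma> = sigma (space (config_space G))
     (\<Union>\<beta>\<in>carrier G - {\<gamma>}. {{x \<in> space (config_space G). x \<beta> \<in> B} | B. True})"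

definition gibbs_measure ::
    "('g, 'm) monoid_scheme \<Rightarrow> nat \<Rightarrow> (nat \<Rightarrow> 'g) \<Rightarrow> ('a::finite \<Rightarrow> real) \<Rightarrow> ('a \<Rightarrow> 'a \<Rightarrow> real) \<Rightarrow>
      ('g \<Rightarrow> 'a) measure \<Rightarrow> bool" where
  "gibbs_measure G r s h J \<mu> \<longleftrightarrow> \<mu> \<in> config_prob G \<and>
     (\<forall>\<gamma>\<in>carrier G. \<forall>a.
        (\<lambda>y. glauber_rate G r s h J \<gamma> y a) \<in> borel_measurable (other_coords G \<gamma>) \<and>
        (AE y in \<mu>. real_cond_exp \<mu> (other_coords G \<gamma>) (indicator {x \<in> space \<mu>. x \<gamma> = a}) y
           = glauber_rate G r s h J \<gamma> y a))"

end

theory Submission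
  imports Defs
begin

text \<open>
  If \<open>\<mu>\<close> is not Gibbs, some finite pattern \<open>y\<close> around a site \<open>\<gamma>\<close> has the wrong conditional law at \<open>\<gamma>\<close>.
  Select sites at random by isolated coin flips, and at each selected site that sees the pattern \<open>y\<close>
  redraw the letter from the Gibbs conditional law \<open>q\<close> given \<open>y\<close>. Selected sites do not interact, so for
  given coins the free energy on a finite model drops by a relative entropy; by the Gibbs variational
  inequality this is at least the expected sum of \<open>ln (q' / q)\<close> over the redrawn sites, for any trial
  law \<open>q'\<close>. The wrong conditional law of \<open>\<mu>\<close> provides a \<open>q'\<close> for which this is a definite amount per
  site, and averaging over the coins costs nothing because entropy is concave. The same procedure,
  run on the group, turns \<open>\<mu>\<close> into a measure \<open>\<nu>\<close>. It is local and commutes with pulling back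
  along the action, so models near \<open>\<mu>\<close> become models near \<open>\<nu>\<close>, and \<open>\<nu>\<close> has strictly smaller free
  energy density than \<open>\<mu>\<close>.
\<close>

section \<open>Free energy under block resampling\<close>

text \<open>Redrawing one site changes the total free energy by a bounded amount, invisible to the
  density, so a positive fraction of sites must change at once. Updates at adjacent sites interact,
  and a pattern alone cannot keep its occurrences apart; the coins do so by a rule that is local and
  the same at every vertex. The next obstacle is that relative entropy is not a weakly continuous
  function of the empirical law. Its lower bound by a trial law is the mean of a local observable,
  so closeness of the mean empirical law to \<open>\<mu>\<close> controls it. With \<open>I\<close>
  the discrepancy found in \<open>\<mu>\<close>, take \<open>q' = q * (1 + t * \<theta>)\<close>,
  where \<open>\<theta>\<close> has mean zero under \<open>q\<close> and integral
  \<open>\<bar>I\<bar>\<close> over the pattern under \<open>\<mu>\<close>: the gain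
  \<open>t * \<bar>I\<bar>\<close> is of first order, the loss is at most
  \<open>2 * t\<^sup>2\<close>, and \<open>t = \<bar>I\<bar> / 4\<close> balances them best. The
  vanishing defect enters only through the vertices whose orbit map is not injective on a finite
  window; their proportion tends to 0.\<close>

lemma expectation_pmf_cong:
  fixes f g :: "'b \<Rightarrow> real"
  assumes "\<And>x. x \<in> set_pmf p \<Longrightarrow> f x = g x"
  shows "measure_pmf.expectation p f = measure_pmf.expectation p g"
  using assms by (intro integral_cong_AE AE_pmfI) auto

lemma expectation_bind_pmf:
  fixes f :: "'b \<Rightarrow> real"
  assumes "finite (set_pmf p)" "\<And>x. x \<in> set_pmf p \<Longrightarrow> finite (set_pmf (k x))"
  shows "measure_pmf.expectation (p \<bind> k) f =
    measure_pmf.expectation p (\<lambda>x. measure_pmf.expectation (k x) f)"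
  using assms by (subst pmf_expectation_bind[of "set_pmf p"])
    (auto simp: integral_measure_pmf[of "set_pmf p"])

section \<open>Expectations and entropy of laws on a finite configuration space\<close>

lemma finite_configs [simp, intro]: "finite V \<Longrightarrow> finite (V \<rightarrow>\<^sub>E (UNIV :: 'a::finite set))"
  by (intro finite_PiE) auto

lemma finite_support_finite_config_prob:
  "\<zeta> \<in> finite_config_prob V \<Longrightarrow> finite V \<Longrightarrow> finite (set_pmf \<zeta>)"
  unfolding finite_config_prob_def using finite_subset[OF _ finite_configs] by blast

lemma expectation_finite_config:
  fixes f :: "('v \<Rightarrow> 'a::finite) \<Rightarrow> real"
  assumes "\<zeta> \<in> finite_config_prob V" "finite V"
  shows "measure_pmf.expectation \<zeta> f = (\<Sum>x\<in>V \<rightarrow>\<^sub>E UNIV. pmf \<zeta> x * f x)"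
  using assms by (subst integral_measure_pmf[of "V \<rightarrow>\<^sub>E UNIV"]) (auto simp: finite_config_prob_def)

lemma sum_pmf_finite_config:
  assumes "\<zeta> \<in> finite_config_prob V" "finite V"
  shows "(\<Sum>x\<in>V \<rightarrow>\<^sub>E UNIV. pmf \<zeta> x) = 1"
  using assms by (intro sum_pmf_eq_1) (auto simp: finite_config_prob_def)

text \<open>Termwise from \<open>ln u \<le> u - 1\<close> at \<open>u = \<xi> x / p x\<close>. The
  condition \<open>ac\<close> guards against \<open>ln 0 = 0\<close>: where \<open>\<xi>\<close>
  vanished and \<open>p\<close> did not, the left side would lose a term equal to minus
  infinity.\<close>

lemma relative_entropy_nonneg:
  fixes p \<xi> :: "'b \<Rightarrow> real"
  assumes "finite X" and nn: "\<And>x. x \<in> X \<Longrightarrow> 0 \<le> p x" "\<And>x. x \<in> X \<Longrightarrow> 0 \<le> \<xi> x"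
    and ac: "\<And>x. x \<in> X \<Longrightarrow> 0 < p x \<Longrightarrow> 0 < \<xi> x"
    and s: "sum \<xi> X \<le> sum p X"
  shows "(\<Sum>x\<in>X. p x * ln (\<xi> x)) \<le> (\<Sum>x\<in>X. p x * ln (p x))"
proof -
  have "p x * ln (\<xi> x) - p x * ln (p x) \<le> \<xi> x - p x" if x: "x \<in> X" for x
  proof (cases "p x = 0")
    case True
    with nn x show ?thesis by simp
  next
    case False
    with nn(1)[OF x] have p: "0 < p x" by simp
    have "p x * ln (\<xi> x) - p x * ln (p x) = p x * ln (\<xi> x / p x)"
      using p ac[OF x p] by (simp add: ln_div algebra_simps)
    also have "\<dots> \<le> p x * (\<xi> x / p x - 1)"
      using p ac[OF x p] by (intro mult_left_mono ln_le_minus_one) auto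
    also have "\<dots> = \<xi> x - p x"
      using p by (simp add: field_simps)
    finally show ?thesis .
  qed
  then have "(\<Sum>x\<in>X. p x * ln (\<xi> x) - p x * ln (p x)) \<le> (\<Sum>x\<in>X. \<xi> x - p x)"
    by (rule sum_mono)
  with s show ?thesis by (simp add: sum_subtractf)
qed

text \<open>Gibbs' inequality with the uniform law on configurations as reference. It later keeps
  free energy densities away from minus infinity.\<close>

lemma shannon_entropy_le:
  fixes \<zeta> :: "('v \<Rightarrow> 'a::finite) pmf"
  assumes "\<zeta> \<in> finite_config_prob V" "finite V"
  shows "shannon_entropy V \<zeta> \<le> real (card V) * ln (real CARD('a))"
proof -
  let ?X = "V \<rightarrow>\<^sub>E (UNIV :: 'a set)" and ?c = "1 / real CARD('a) ^ card V"
  have card: "real (card ?X) = real CARD('a) ^ card V"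
    using assms(2) by (simp add: card_PiE)
  have "(\<Sum>x\<in>?X. pmf \<zeta> x * ln ?c) \<le> (\<Sum>x\<in>?X. pmf \<zeta> x * ln (pmf \<zeta> x))"
    using assms card by (intro relative_entropy_nonneg) (auto simp: sum_pmf_finite_config)
  moreover have "(\<Sum>x\<in>?X. pmf \<zeta> x * ln ?c) = ln ?c"
    using sum_pmf_finite_config[OF assms] by (simp flip: sum_distrib_right)
  ultimately show ?thesis
    by (simp add: shannon_entropy_def ln_div ln_realpow)
qed

text \<open>Gibbs' inequality compares each \<open>k b\<close> with the mixture
  \<open>p \<bind> k\<close> as reference; the weighted sum of these cross entropies is exactly the
  entropy of the mixture.\<close>

lemma shannon_entropy_bind:
  fixes k :: "'b \<Rightarrow> ('v \<Rightarrow> 'a::finite) pmf"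
  assumes fin: "finite (set_pmf p)" and k: "\<And>b. k b \<in> finite_config_prob V" and V: "finite V"
  shows "measure_pmf.expectation p (\<lambda>b. shannon_entropy V (k b)) \<le> shannon_entropy V (p \<bind> k)"
proof -
  let ?X = "V \<rightarrow>\<^sub>E (UNIV :: 'a set)" and ?m = "\<lambda>x. pmf (p \<bind> k) x"
  have m: "?m x = (\<Sum>b\<in>set_pmf p. pmf p b * pmf (k b) x)" for x
    using fin by (simp add: pmf_bind integral_measure_pmf[of "set_pmf p"])
  have m0: "?m x = 0 \<Longrightarrow> b \<in> set_pmf p \<Longrightarrow> pmf (k b) x = 0" for x b
    using fin unfolding m by (subst (asm) sum_nonneg_eq_0_iff) (auto simp: pmf_eq_0_set_pmf)
  have ineq: "(\<Sum>x\<in>?X. pmf (k b) x * ln (?m x)) \<le> (\<Sum>x\<in>?X. pmf (k b) x * ln (pmf (k b) x))"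
    if "b \<in> set_pmf p" for b
  proof (rule relative_entropy_nonneg)
    have "p \<bind> k \<in> finite_config_prob V"
      using k by (auto simp: finite_config_prob_def)
    then show "sum ?m ?X \<le> sum (pmf (k b)) ?X"
      using sum_pmf_finite_config[OF _ V] k by (metis order_refl)
    show "0 < ?m x" if "0 < pmf (k b) x" for x
      using m0[OF _ \<open>b \<in> set_pmf p\<close>, of x] that pmf_nonneg[of "p \<bind> k" x] by fastforce
  qed (use V in auto)
  have "shannon_entropy V (p \<bind> k) = - (\<Sum>x\<in>?X. \<Sum>b\<in>set_pmf p. pmf p b * (pmf (k b) x * ln (?m x)))"
    by (simp add: shannon_entropy_def m sum_distrib_right mult.assoc)
  also have "\<dots> = - (\<Sum>b\<in>set_pmf p. pmf p b * (\<Sum>x\<in>?X. pmf (k b) x * ln (?m x)))"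
    by (subst sum.swap) (simp add: sum_distrib_left)
  also have "\<dots> \<ge> - (\<Sum>b\<in>set_pmf p. pmf p b * (\<Sum>x\<in>?X. pmf (k b) x * ln (pmf (k b) x)))"
    using ineq by (simp add: sum_mono mult_left_mono)
  finally show ?thesis
    using fin by (simp add: integral_measure_pmf[of "set_pmf p"] shannon_entropy_def sum_negf)
qed

text \<open>\<open>N x\<close> is the set of sites redrawn in state \<open>x\<close>. By
  \<open>N_cong\<close>, redrawing does not alter which sites are redrawn, so agreement off
  \<open>N x\<close> is an equivalence relation and resampling is a Markov kernel that preserves its
  classes, the blocks.\<close>

locale block_resampling =
  fixes V :: "'v set" and N :: "('v \<Rightarrow> 'a::finite) \<Rightarrow> 'v set"
  assumes finite_V: "finite V"
    and N_subset: "N x \<subseteq> V"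
    and N_cong: "\<And>x z. x \<in> V \<rightarrow>\<^sub>E UNIV \<Longrightarrow> z \<in> V \<rightarrow>\<^sub>E UNIV \<Longrightarrow>
      (\<And>v. v \<in> V - N x \<Longrightarrow> z v = x v) \<Longrightarrow> N z = N x"
begin

text \<open>The default \<open>undefined\<close> off \<open>V\<close> makes every draw extensional,
  as \<open>finite_config_prob\<close> demands.\<close>

definition kernel :: "'a pmf \<Rightarrow> ('v \<Rightarrow> 'a) \<Rightarrow> ('v \<Rightarrow> 'a) pmf" where
  "kernel q x = Pi_pmf V undefined (\<lambda>v. if v \<in> N x then q else return_pmf (x v))"

definition block :: "('v \<Rightarrow> 'a) \<Rightarrow> ('v \<Rightarrow> 'a) set" where
  "block x = {z \<in> V \<rightarrow>\<^sub>E UNIV. \<forall>v\<in>V - N x. z v = x v}"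

lemma N_block:
  assumes "x \<in> V \<rightarrow>\<^sub>E UNIV" "z \<in> block x"
  shows "N z = N x"
  using assms by (intro N_cong) (auto simp: block_def)

lemma block_eq:
  assumes "x \<in> V \<rightarrow>\<^sub>E UNIV" "z \<in> block x"
  shows "block z = block x"
  using N_block[OF assms] assms unfolding block_def by auto

lemma self_in_block: "x \<in> V \<rightarrow>\<^sub>E UNIV \<Longrightarrow> x \<in> block x"
  by (simp add: block_def)

lemma pmf_kernel:
  assumes x: "x \<in> V \<rightarrow>\<^sub>E UNIV" and z: "z \<in> V \<rightarrow>\<^sub>E UNIV"
  shows "pmf (kernel q x) z = (if z \<in> block x then \<Prod>v\<in>N x. pmf q (z v) else 0)"
proof -
  have und: "\<forall>v. v \<notin> V \<longrightarrow> z v = undefined"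
    using z by (auto simp: PiE_def extensional_def)
  have "pmf (kernel q x) z = (\<Prod>v\<in>V. pmf (if v \<in> N x then q else return_pmf (x v)) (z v))"
    unfolding kernel_def by (subst pmf_Pi) (use finite_V und in auto)
  also have "\<dots> = (\<Prod>v\<in>N x. pmf q (z v)) * (\<Prod>v\<in>V - N x. indicator {x v} (z v))"
    unfolding prod.subset_diff[OF N_subset finite_V, of _ x] mult.commute[of "\<Prod>v\<in>V - N x. _ v"]
    by (intro arg_cong2[of _ _ _ _ times] prod.cong refl) (auto simp: pmf_return indicator_def)
  also have "(\<Prod>v\<in>V - N x. indicator {x v} (z v) :: real) = (if z \<in> block x then 1 else 0)"
    using finite_V z by (auto simp: block_def prod_zero_iff indicator_def)
  finally show ?thesis by simp
qed

lemma set_kernel: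
  assumes "x \<in> V \<rightarrow>\<^sub>E UNIV"
  shows "set_pmf (kernel q x) \<subseteq> block x"
proof
  fix z assume z: "z \<in> set_pmf (kernel q x)"
  then have "z \<in> V \<rightarrow>\<^sub>E UNIV"
    unfolding kernel_def using set_Pi_pmf_subset[OF finite_V] by fastforce
  then show "z \<in> block x"
    using z pmf_kernel[OF assms, of z q] by (auto simp: set_pmf_iff split: if_splits)
qed

lemma bind_kernel_finite_config_prob:
  assumes "\<zeta> \<in> finite_config_prob V"
  shows "\<zeta> \<bind> kernel q \<in> finite_config_prob V"
proof -
  have "set_pmf (kernel q x) \<subseteq> V \<rightarrow>\<^sub>E UNIV" if "x \<in> set_pmf \<zeta>" for x
    using set_kernel[of x q] assms that unfolding finite_config_prob_def block_def by blast
  then show ?thesis unfolding finite_config_prob_def by auto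
qed

text \<open>Since blocks are classes of an equivalence relation, the states leading to
  \<open>z\<close> are exactly those of \<open>block z\<close>, and the weight of the transition
  depends on \<open>z\<close> alone. So each block keeps its mass, which is spread inside by the
  product of \<open>q\<close>.\<close>

lemma pmf_bind_kernel:
  assumes "\<zeta> \<in> finite_config_prob V" and z: "z \<in> V \<rightarrow>\<^sub>E UNIV"
  shows "pmf (\<zeta> \<bind> kernel q) z = (\<Sum>x\<in>block z. pmf \<zeta> x) * (\<Prod>v\<in>N z. pmf q (z v))"
proof -
  let ?X = "V \<rightarrow>\<^sub>E (UNIV :: 'a set)"
  have "pmf (\<zeta> \<bind> kernel q) z = (\<Sum>x\<in>?X. pmf \<zeta> x * pmf (kernel q x) z)"
    unfolding pmf_bind by (rule expectation_finite_config[OF assms(1) finite_V])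
  also have "\<dots> = (\<Sum>x\<in>?X. if x \<in> block z then pmf \<zeta> x * (\<Prod>v\<in>N z. pmf q (z v)) else 0)"
  proof (intro sum.cong refl)
    fix x assume x: "x \<in> ?X"
    have "z \<in> block x \<longleftrightarrow> x \<in> block z"
      using block_eq[OF x] block_eq[OF z] self_in_block[OF x] self_in_block[OF z] by blast
    with N_block[OF x, of z] show "pmf \<zeta> x * pmf (kernel q x) z =
        (if x \<in> block z then pmf \<zeta> x * (\<Prod>v\<in>N z. pmf q (z v)) else 0)"
      by (simp add: pmf_kernel[OF x z])
  qed
  also have "\<dots> = (\<Sum>x\<in>block z. pmf \<zeta> x) * (\<Prod>v\<in>N z. pmf q (z v))"
    using finite_V by (subst sum.inter_restrict[symmetric])
      (auto simp: sum_distrib_right block_def intro!: sum.cong)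
  finally show ?thesis .
qed

text \<open>The kernel never leaves a block. This lets a mean under the resampled law be rewritten
  as a mean under \<open>\<zeta>\<close> itself.\<close>

lemma expectation_bind_kernel_invariant:
  fixes \<phi> :: "('v \<Rightarrow> 'a) \<Rightarrow> real"
  assumes \<zeta>: "\<zeta> \<in> finite_config_prob V"
    and inv: "\<And>x z. x \<in> V \<rightarrow>\<^sub>E UNIV \<Longrightarrow> z \<in> block x \<Longrightarrow> \<phi> z = \<phi> x"
  shows "measure_pmf.expectation (\<zeta> \<bind> kernel q) \<phi> = measure_pmf.expectation \<zeta> \<phi>"
proof -
  have X: "x \<in> V \<rightarrow>\<^sub>E UNIV" if "x \<in> set_pmf \<zeta>" for x
    using \<zeta> that by (auto simp: finite_config_prob_def)
  have "finite (set_pmf (kernel q x))" if "x \<in> set_pmf \<zeta>" for x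
    by (rule finite_subset[OF set_kernel[OF X[OF that]]]) (use finite_V in \<open>auto simp: block_def\<close>)
  then have "measure_pmf.expectation (\<zeta> \<bind> kernel q) \<phi> =
      measure_pmf.expectation \<zeta> (\<lambda>x. measure_pmf.expectation (kernel q x) \<phi>)"
    by (intro expectation_bind_pmf finite_support_finite_config_prob[OF \<zeta> finite_V])
  also have "\<dots> = measure_pmf.expectation \<zeta> \<phi>"
  proof (rule expectation_pmf_cong)
    fix x assume "x \<in> set_pmf \<zeta>"
    then have "measure_pmf.expectation (kernel q x) \<phi> = measure_pmf.expectation (kernel q x) (\<lambda>_. \<phi> x)"
      using set_kernel[OF X, of x q] inv[OF X, of x] by (intro expectation_pmf_cong) blast
    then show "measure_pmf.expectation (kernel q x) \<phi> = \<phi> x" by simp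
  qed
  finally show ?thesis .
qed

text \<open>
  The free energy drops by the relative entropy of \<open>\<zeta>\<close> with respect to its resampled version;
  resampling with a trial law \<open>q'\<close> instead of the Gibbs law \<open>q\<close> bounds this from below.
\<close>

lemma free_energy_bind_kernel:
  fixes U rest :: "('v \<Rightarrow> 'a) \<Rightarrow> real" and \<Phi> :: "'a \<Rightarrow> real"
  assumes \<zeta>: "\<zeta> \<in> finite_config_prob V"
    and U: "\<And>x. x \<in> V \<rightarrow>\<^sub>E UNIV \<Longrightarrow> U x = (\<Sum>v\<in>N x. \<Phi> (x v)) + rest x"
    and rest: "\<And>x z. x \<in> V \<rightarrow>\<^sub>E UNIV \<Longrightarrow> z \<in> block x \<Longrightarrow> rest z = rest x"
    and q: "\<And>a. pmf q a = exp (- \<Phi> a) / Z" and Z: "0 < Z"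
    and q': "\<And>a. 0 < pmf q' a"
  shows "measure_pmf.expectation (\<zeta> \<bind> kernel q) U - shannon_entropy V (\<zeta> \<bind> kernel q)
      + measure_pmf.expectation \<zeta> (\<lambda>x. \<Sum>v\<in>N x. ln (pmf q' (x v)) - ln (pmf q (x v)))
    \<le> measure_pmf.expectation \<zeta> U - shannon_entropy V \<zeta>"
proof -
  let ?X = "V \<rightarrow>\<^sub>E (UNIV :: 'a set)"
  let ?m = "\<lambda>z. \<Sum>x\<in>block z. pmf \<zeta> x"
  let ?K = "\<zeta> \<bind> kernel q"
  \<comment> \<open>This is \<open>U\<close> plus the logarithm of the resampled mass: since
    \<open>ln (pmf q a) = - \<Phi> a - ln Z\<close>, the letters on \<open>N z\<close> cancel and
    what remains is constant on blocks.\<close>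
  define \<phi> where "\<phi> z = rest z - real (card (N z)) * ln Z + ln (?m z)" for z
  note K = bind_kernel_finite_config_prob[OF \<zeta>]
  have finN: "finite (N x)" for x
    using N_subset finite_V by (rule finite_subset)
  have finb: "finite (block x)" for x
    using finite_V by (simp add: block_def)
  have q_pos: "0 < pmf q a" for a
    using Z by (simp add: q)
  have ln_q: "ln (pmf q a) = - \<Phi> a - ln Z" for a
    using Z by (simp add: q ln_div)
  have \<Phi>: "\<Phi> a = - ln (pmf q a) - ln Z" for a
    by (simp add: ln_q)
  have m_pos: "0 < ?m x" if "x \<in> ?X" "0 < pmf \<zeta> x" for x
    using member_le_sum[OF self_in_block[OF that(1)], of "pmf \<zeta>"] finb that(2) by fastforce
  have "measure_pmf.expectation ?K U - shannon_entropy V ?K = (\<Sum>z\<in>?X. pmf ?K z * (U z + ln (pmf ?K z)))"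
    by (simp add: expectation_finite_config[OF K finite_V] shannon_entropy_def algebra_simps sum.distrib)
  also have "\<dots> = (\<Sum>z\<in>?X. pmf ?K z * \<phi> z)"
  proof (intro sum.cong refl)
    fix z assume z: "z \<in> ?X"
    show "pmf ?K z * (U z + ln (pmf ?K z)) = pmf ?K z * \<phi> z"
    \<comment> \<open>In a block without mass the weight \<open>pmf ?K z\<close> vanishes, so the
      conventional value of \<open>ln 0\<close> is harmless.\<close>
    proof (cases "?m z = 0")
      case True
      then show ?thesis by (simp add: pmf_bind_kernel[OF \<zeta> z])
    next
      case False
      then have "0 < ?m z"
        by (metis less_eq_real_def sum_nonneg pmf_nonneg)
      then have "ln (pmf ?K z) = ln (?m z) + (\<Sum>v\<in>N z. ln (pmf q (z v)))"
        using q_pos finN by (simp add: pmf_bind_kernel[OF \<zeta> z] ln_mult prod_pos ln_prod less_imp_neq[THEN not_sym])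
      then show ?thesis
        by (simp add: U[OF z] \<phi>_def \<Phi> sum_subtractf sum_negf)
    qed
  qed
  also have "\<dots> = measure_pmf.expectation ?K \<phi>"
    by (rule expectation_finite_config[OF K finite_V, symmetric])
  also have "\<dots> = measure_pmf.expectation \<zeta> \<phi>"
    by (rule expectation_bind_kernel_invariant[OF \<zeta>]) (simp add: \<phi>_def rest N_block block_eq)
  also have "\<dots> = (\<Sum>x\<in>?X. pmf \<zeta> x * \<phi> x)"
    by (rule expectation_finite_config[OF \<zeta> finite_V])
  finally have drop: "measure_pmf.expectation ?K U - shannon_entropy V ?K = (\<Sum>x\<in>?X. pmf \<zeta> x * \<phi> x)" .

  \<comment> \<open>The reference law of Gibbs' inequality is \<open>\<zeta>\<close> resampled with
    the trial law; it has the same block masses \<open>?m\<close> as the version resampled with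
    \<open>q\<close>.\<close>
  let ?\<xi> = "pmf (\<zeta> \<bind> kernel q')"
  have "(\<Sum>x\<in>?X. pmf \<zeta> x * ln (?\<xi> x)) \<le> (\<Sum>x\<in>?X. pmf \<zeta> x * ln (pmf \<zeta> x))"
  proof (rule relative_entropy_nonneg)
    show "0 < ?\<xi> x" if "x \<in> ?X" "0 < pmf \<zeta> x" for x
      using m_pos[OF that] q' by (simp add: pmf_bind_kernel[OF \<zeta> that(1)] prod_pos)
    show "sum ?\<xi> ?X \<le> sum (pmf \<zeta>) ?X"
      by (simp add: sum_pmf_finite_config \<zeta> finite_V bind_kernel_finite_config_prob)
  qed (use finite_V in auto)
  also have "(\<Sum>x\<in>?X. pmf \<zeta> x * ln (?\<xi> x)) =
      (\<Sum>x\<in>?X. pmf \<zeta> x * (ln (?m x) + (\<Sum>v\<in>N x. ln (pmf q' (x v)))))"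
  proof (intro sum.cong refl)
    fix x assume x: "x \<in> ?X"
    show "pmf \<zeta> x * ln (?\<xi> x) = pmf \<zeta> x * (ln (?m x) + (\<Sum>v\<in>N x. ln (pmf q' (x v))))"
    proof (cases "pmf \<zeta> x = 0")
      case False
      then have "0 < pmf \<zeta> x" using pmf_nonneg[of \<zeta> x] by linarith
      then have "ln (?\<xi> x) = ln (?m x) + (\<Sum>v\<in>N x. ln (pmf q' (x v)))"
        using m_pos[OF x] q' finN
        by (simp add: pmf_bind_kernel[OF \<zeta> x] ln_mult prod_pos ln_prod less_imp_neq[THEN not_sym])
      then show ?thesis by simp
    qed simp
  qed
  finally have "(\<Sum>x\<in>?X. pmf \<zeta> x * (ln (?m x) + (\<Sum>v\<in>N x. ln (pmf q' (x v)))))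
      + (\<Sum>x\<in>?X. pmf \<zeta> x * U x) \<le> (\<Sum>x\<in>?X. pmf \<zeta> x * ln (pmf \<zeta> x)) + (\<Sum>x\<in>?X. pmf \<zeta> x * U x)"
    by simp
  \<comment> \<open>Here \<open>U\<close> is written as \<open>rest\<close> minus the sum over
    \<open>N x\<close> of \<open>ln (pmf q (x v)) + ln Z\<close>; adding \<open>ln (?m x)\<close>
    completes \<open>\<phi>\<close> and leaves the log ratio of \<open>q'\<close> to
    \<open>q\<close>.\<close>
  moreover have "(\<Sum>x\<in>?X. pmf \<zeta> x * (ln (?m x) + (\<Sum>v\<in>N x. ln (pmf q' (x v)))))
      + (\<Sum>x\<in>?X. pmf \<zeta> x * U x) =
    (\<Sum>x\<in>?X. pmf \<zeta> x * \<phi> x) + (\<Sum>x\<in>?X. pmf \<zeta> x * (\<Sum>v\<in>N x. ln (pmf q' (x v)) - ln (pmf q (x v))))"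
    unfolding sum.distrib[symmetric]
    by (intro sum.cong refl) (simp add: U \<phi>_def \<Phi> sum_subtractf sum_negf algebra_simps)
  ultimately show ?thesis
    unfolding drop by (simp add: expectation_finite_config[OF \<zeta> finite_V] shannon_entropy_def)
qed

end

section \<open>Sofic approximation\<close>

text \<open>
  A labeled isomorphism of balls need not preserve the centers, but it carries the path of a word
  based at the center to the path of the same word; so a word closes up in the model only if it is
  trivial in the group.
\<close>

inductive word_length :: "('g, 'm) monoid_scheme \<Rightarrow> nat \<Rightarrow> (nat \<Rightarrow> 'g) \<Rightarrow> nat \<Rightarrow> 'g \<Rightarrow> bool"
  for G r s where
  one: "word_length G r s 0 \<one>\<^bsub>G\<^esub>"
| gen: "word_length G r s k \<beta> \<Longrightarrow> i \<in> {1..r} \<Longrightarrow> word_length G r s (Suc k) (s i \<otimes>\<^bsub>G\<^esub> \<beta>)"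
| inv: "word_length G r s k \<beta> \<Longrightarrow> i \<in> {1..r} \<Longrightarrow> word_length G r s (Suc k) (inv\<^bsub>G\<^esub> (s i) \<otimes>\<^bsub>G\<^esub> \<beta>)"

section \<open>Word lengths in the group and orbits in a finite model\<close>

locale marked_group = group G for G :: "('g, 'm) monoid_scheme" (structure) +
  fixes r :: nat and s :: "nat \<Rightarrow> 'g"
  assumes s_closed: "i \<in> {1..r} \<Longrightarrow> s i \<in> carrier G"
    and generate_eq: "generate G (s ` {1..r}) = carrier G"
begin

lemma word_length_closed: "word_length G r s k \<beta> \<Longrightarrow> \<beta> \<in> carrier G"
  by (induction rule: word_length.induct) (use s_closed in auto)

lemma word_length_mult:
  assumes "word_length G r s k \<beta>" "word_length G r s l \<beta>'"
  shows "word_length G r s (k + l) (\<beta> \<otimes> \<beta>')"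
  using assms
proof (induction rule: word_length.induct)
  case one
  then show ?case using word_length_closed by simp
next
  case (gen k \<beta> i)
  then show ?case
    using word_length.gen[of G r s "k + l" "\<beta> \<otimes> \<beta>'" i] word_length_closed s_closed
    by (simp add: m_assoc)
next
  case (inv k \<beta> i)
  then show ?case
    using word_length.inv[of G r s "k + l" "\<beta> \<otimes> \<beta>'" i] word_length_closed s_closed
    by (simp add: m_assoc)
qed

lemma ex_word_length:
  assumes "\<beta> \<in> carrier G"
  shows "\<exists>k. word_length G r s k \<beta>"
proof -
  have "\<beta> \<in> generate G (s ` {1..r})" using assms generate_eq by simp
  then show ?thesis
  proof (induction rule: generate.induct)
    case one
    then show ?case using word_length.one by blast
  next
    case (incl g)
    then obtain i where "i \<in> {1..r}" "g = s i" by blast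
    with word_length.gen[OF word_length.one, of i r G s] s_closed show ?case by auto
  next
    case (inv g)
    then obtain i where "i \<in> {1..r}" "g = s i" by blast
    with word_length.inv[OF word_length.one, of i r G s] s_closed show ?case by auto
  next
    case (eng g g')
    then show ?case using word_length_mult by blast
  qed
qed

end

locale finite_action = marked_group G r s
  for G :: "('g, 'm) monoid_scheme" (structure) and r s +
  fixes V :: "'v set" and \<sigma> :: "'g \<Rightarrow> 'v \<Rightarrow> 'v"
  assumes finite_V: "finite V" and hom: "\<sigma> \<in> hom G (BijGroup V)"
begin

lemma action_bij: "\<gamma> \<in> carrier G \<Longrightarrow> bij_betw (\<sigma> \<gamma>) V V"
  using hom_in_carrier[OF hom] by (auto simp: BijGroup_def Bij_def)

lemma action_closed: "\<gamma> \<in> carrier G \<Longrightarrow> v \<in> V \<Longrightarrow> \<sigma> \<gamma> v \<in> V"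
  using action_bij bij_betwE by blast

lemma action_mult:
  assumes "\<beta> \<in> carrier G" "\<gamma> \<in> carrier G" "v \<in> V"
  shows "\<sigma> (\<beta> \<otimes> \<gamma>) v = \<sigma> \<beta> (\<sigma> \<gamma> v)"
proof -
  have "\<sigma> (\<beta> \<otimes> \<gamma>) = \<sigma> \<beta> \<otimes>\<^bsub>BijGroup V\<^esub> \<sigma> \<gamma>"
    using hom_mult[OF hom] assms by simp
  also have "\<dots> = compose V (\<sigma> \<beta>) (\<sigma> \<gamma>)"
    using hom_in_carrier[OF hom] assms by (simp add: BijGroup_def)
  finally show ?thesis using assms by (simp add: compose_def)
qed

lemma action_one: "v \<in> V \<Longrightarrow> \<sigma> \<one> v = v"
  using action_mult[of \<one> \<one> v] action_bij[of \<one>] action_closed[of \<one> v]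
  by (auto simp: bij_betw_def inj_on_def)

lemma action_inv_cancel: "\<gamma> \<in> carrier G \<Longrightarrow> v \<in> V \<Longrightarrow> \<sigma> (inv \<gamma>) (\<sigma> \<gamma> v) = v"
  using action_mult[of "inv \<gamma>" \<gamma> v] by (simp add: action_one)

lemma action_cancel_inv: "\<gamma> \<in> carrier G \<Longrightarrow> v \<in> V \<Longrightarrow> \<sigma> \<gamma> (\<sigma> (inv \<gamma>) v) = v"
  using action_mult[of \<gamma> "inv \<gamma>" v] by (simp add: action_one)

abbreviation model_graph where "model_graph \<equiv> action_graph r s V \<sigma>"

lemma word_in_adjacency:
  assumes "word_length G r s k \<beta>" "v \<in> V"
  shows "(v, \<sigma> \<beta> v) \<in> adjacency model_graph ^^ k"
  using assms
proof (induction rule: word_length.induct)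
  case one
  then show ?case by (simp add: action_one)
next
  case (gen k \<beta> i)
  then have "(\<sigma> \<beta> v, \<sigma> (s i \<otimes> \<beta>) v) \<in> adjacency model_graph"
    using word_length_closed s_closed
    by (auto simp: adjacency_def action_graph_def action_mult action_closed)
  with gen show ?case by auto
next
  case (inv k \<beta> i)
  have \<beta>: "\<beta> \<in> carrier G" and si: "s i \<in> carrier G"
    using inv word_length_closed s_closed by auto
  \<comment> \<open>An inverse letter runs an edge backwards, which \<open>adjacency\<close>
    permits.\<close>
  then have "(i, \<sigma> (inv (s i) \<otimes> \<beta>) v, \<sigma> \<beta> v) \<in> ledges model_graph"
    using inv by (auto simp: action_graph_def action_mult action_closed action_cancel_inv)
  then have "(\<sigma> \<beta> v, \<sigma> (inv (s i) \<otimes> \<beta>) v) \<in> adjacency model_graph"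
    by (auto simp: adjacency_def)
  with inv show ?case by auto
qed

lemma word_in_ball:
  assumes "word_length G r s k \<beta>" "v \<in> V" "k \<le> R"
  shows "\<sigma> \<beta> v \<in> graph_ball model_graph v R"
proof -
  have "graph_dist model_graph v (\<sigma> \<beta> v) \<le> enat k"
    unfolding graph_dist_def by (rule INF_lower) (simp add: word_in_adjacency assms)
  with assms(3) have "graph_dist model_graph v (\<sigma> \<beta> v) \<le> enat R"
    by (meson enat_ord_simps(1) order_trans)
  with assms show ?thesis
    using word_length_closed action_closed by (simp add: graph_ball_def action_graph_def)
qed

lemma no_short_fixing_word:
  assumes iso: "labeled_iso (induced model_graph (graph_ball model_graph v R))
      (induced (cayley_graph G r s) (graph_ball (cayley_graph G r s) \<one> R))"
    and v: "v \<in> V" and \<beta>: "word_length G r s k \<beta>" "k \<le> R" and fixed: "\<sigma> \<beta> v = v"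
  shows "\<beta> = \<one>"
proof -
  let ?B = "graph_ball model_graph v R"
  let ?D = "induced model_graph ?B"
  let ?C = "induced (cayley_graph G r s) (graph_ball (cayley_graph G r s) \<one> R)"
  obtain f where f: "bij_betw f (lverts ?D) (lverts ?C)"
    and edge: "\<And>i u w. u \<in> lverts ?D \<Longrightarrow> w \<in> lverts ?D \<Longrightarrow>
      (i, u, w) \<in> ledges ?D \<longleftrightarrow> (i, f u, f w) \<in> ledges ?C"
    using iso unfolding labeled_iso_def by blast
  have D: "lverts ?D = ?B"
    by (auto simp: induced_def graph_ball_def)
  have ball: "\<sigma> \<beta> v \<in> ?B" if "word_length G r s k \<beta>" "k \<le> R" for k \<beta>
    using word_in_ball[OF that(1) v that(2)] .
  have f_closed: "f u \<in> carrier G" if "u \<in> ?B" for u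
    using bij_betwE[OF f] that unfolding D by (auto simp: induced_def cayley_graph_def)
  have v_ball: "v \<in> ?B"
    using ball[OF word_length.one] action_one[OF v] by simp
  have f_edge: "f (\<sigma> (s i) u) = s i \<otimes> f u"
    if "i \<in> {1..r}" "u \<in> ?B" "\<sigma> (s i) u \<in> ?B" for i u
  proof -
    have "u \<in> V" using that by (simp add: graph_ball_def action_graph_def)
    then have "(i, u, \<sigma> (s i) u) \<in> ledges ?D"
      using that by (auto simp: induced_def action_graph_def)
    then have "(i, f u, f (\<sigma> (s i) u)) \<in> ledges ?C"
      using edge that unfolding D by blast
    then show ?thesis by (auto simp: induced_def cayley_graph_def)
  qed
  \<comment> \<open>Induction along the word: every intermediate word is no longer than
    \<open>R\<close>, so the whole path stays in the ball, where \<open>f\<close> respects labeled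
    edges.\<close>
  have "f (\<sigma> \<beta> v) = \<beta> \<otimes> f v"
    using \<beta>
  proof (induction rule: word_length.induct)
    case one
    then show ?case using f_closed[OF v_ball] by (simp add: action_one v)
  next
    case (gen k \<beta> i)
    have c: "\<beta> \<in> carrier G" "s i \<in> carrier G"
      using gen word_length_closed s_closed by auto
    have "\<sigma> (s i) (\<sigma> \<beta> v) \<in> ?B"
      using ball[OF word_length.gen[OF gen.hyps] gen.prems] c v by (simp add: action_mult)
    then have "f (\<sigma> (s i) (\<sigma> \<beta> v)) = s i \<otimes> (\<beta> \<otimes> f v)"
      using gen ball by (simp add: f_edge)
    then show ?case
      using c v f_closed[OF v_ball] by (simp add: action_mult m_assoc)
  next
    case (inv k \<beta> i)
    have c: "\<beta> \<in> carrier G" "s i \<in> carrier G"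
      using inv word_length_closed s_closed by auto
    let ?w = "\<sigma> (inv (s i)) (\<sigma> \<beta> v)"
    have w: "?w \<in> ?B"
      using ball[OF word_length.inv[OF inv.hyps] inv.prems] c v by (simp add: action_mult)
    have "\<sigma> (s i) ?w = \<sigma> \<beta> v"
      using c v by (simp add: action_cancel_inv action_closed)
    then have "s i \<otimes> f ?w = \<beta> \<otimes> f v"
      using f_edge[OF inv.hyps(2) w] inv.IH ball[OF inv.hyps(1)] inv.prems by simp
    then have "f ?w = inv (s i) \<otimes> (\<beta> \<otimes> f v)"
      using c f_closed[OF w] f_closed[OF v_ball] by (metis inv_solve_left m_closed)
    then show ?case
      using c v f_closed[OF v_ball] by (simp add: action_mult m_assoc)
  qed
  \<comment> \<open>With \<open>\<sigma> \<beta> v = v\<close> the identity reads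
    \<open>f v = \<beta> \<otimes> f v\<close>; cancelling \<open>f v\<close> works wherever
    \<open>f\<close> sends the center.\<close>
  then show ?thesis
    using fixed f_closed[OF v_ball] word_length_closed[OF \<beta>(1)] by (metis r_cancel_one')
qed

text \<open>Off this set, independent labels on \<open>V\<close> read along the orbit of
  \<open>v\<close> over \<open>M\<close> are again independent.\<close>

definition collisions :: "'g set \<Rightarrow> 'v set" where
  "collisions M = {v \<in> V. \<not> inj_on (\<lambda>\<gamma>. \<sigma> \<gamma> v) M}"

lemma collisions_subset: "collisions M \<subseteq> V"
  by (auto simp: collisions_def)

text \<open>If \<open>\<gamma>\<close> and \<open>\<gamma>'\<close> send \<open>v\<close> to the
  same vertex, then \<open>inv \<gamma> \<otimes> \<gamma>'\<close> is a nontrivial word of length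
  at most \<open>R\<close> fixing \<open>v\<close>, which \<open>no_short_fixing_word\<close>
  excludes in a good ball.\<close>

lemma collisions_le_defect:
  assumes "M \<subseteq> carrier G"
    and R: "\<And>\<gamma> \<gamma>'. \<gamma> \<in> M \<Longrightarrow> \<gamma>' \<in> M \<Longrightarrow> \<exists>k\<le>R. word_length G r s k (inv \<gamma> \<otimes> \<gamma>')"
  shows "real (card (collisions M)) / real (card V) \<le> defect G r s V \<sigma> R"
  unfolding defect_def
proof (intro divide_right_mono of_nat_mono card_mono)
  show "collisions M \<subseteq> {v \<in> V. \<not> labeled_iso
        (induced (action_graph r s V \<sigma>) (graph_ball (action_graph r s V \<sigma>) v R))
        (induced (cayley_graph G r s) (graph_ball (cayley_graph G r s) \<one> R))}"
  proof clarify
    fix v assume "v \<in> collisions M"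
    then obtain \<gamma> \<gamma>' where v: "v \<in> V" and \<gamma>: "\<gamma> \<in> M" "\<gamma>' \<in> M" "\<sigma> \<gamma> v = \<sigma> \<gamma>' v" "\<gamma> \<noteq> \<gamma>'"
      by (auto simp: collisions_def inj_on_def)
    then have c: "\<gamma> \<in> carrier G" "\<gamma>' \<in> carrier G" using assms(1) by auto
    have fixed: "\<sigma> (inv \<gamma> \<otimes> \<gamma>') v = v"
      using c v \<gamma>(3) by (simp add: action_mult action_inv_cancel flip: \<gamma>(3))
    have "inv \<gamma> \<otimes> \<gamma>' \<noteq> \<one>"
      using c \<gamma>(4) by (metis inv_closed inv_equality inv_inv)
    with no_short_fixing_word[OF _ v _ _ fixed] R[OF \<gamma>(1,2)] v
    show "v \<in> V \<and> \<not> labeled_iso (induced model_graph (graph_ball model_graph v R))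
        (induced (cayley_graph G r s) (graph_ball (cayley_graph G r s) \<one> R))"
      by blast
  qed
qed (use finite_V in auto)

text \<open>Some radius \<open>R'\<close> nearly attains the infimum. Being below
  \<open>9 * (2 / 3) ^ R\<close>, its first summand forces \<open>R \<le> R'\<close>, so balls of
  radius \<open>R'\<close> see all the words in question; being below \<open>e\<close>, its second
  summand bounds the defect at \<open>R'\<close>.\<close>

lemma collisions_lt:
  assumes "M \<subseteq> carrier G"
    and R: "\<And>\<gamma> \<gamma>'. \<gamma> \<in> M \<Longrightarrow> \<gamma>' \<in> M \<Longrightarrow> \<exists>k\<le>R. word_length G r s k (inv \<gamma> \<otimes> \<gamma>')"
    and small: "total_defect G r s V \<sigma> < min (9 * (2 / 3) ^ R) e"
  shows "real (card (collisions M)) / real (card V) < e"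
proof -
  have nonneg: "0 \<le> defect G r s V \<sigma> R'" for R'
    by (simp add: defect_def)
  have "bdd_below (range (\<lambda>R. 9 * (2 / 3) ^ R + 6 * defect G r s V \<sigma> R))"
    using nonneg by (intro bdd_belowI[of _ 0]) auto
  with small obtain R' where R': "9 * (2 / 3) ^ R' + 6 * defect G r s V \<sigma> R' < min (9 * (2 / 3) ^ R) e"
    unfolding total_defect_def by (subst (asm) cINF_less_iff) auto
  have "(2 / 3 :: real) ^ R' < (2 / 3) ^ R"
    using R'[unfolded min_less_iff_conj] nonneg[of R'] by linarith
  moreover have "(2 / 3 :: real) ^ R \<le> (2 / 3) ^ R'" if "R' \<le> R"
    using that by (rule power_decreasing) auto
  ultimately have "R \<le> R'"
    by (meson linorder_le_cases linorder_not_le)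
  have "real (card (collisions M)) / real (card V) \<le> defect G r s V \<sigma> R'"
  proof (rule collisions_le_defect[OF assms(1)])
    fix \<gamma> \<gamma>' assume "\<gamma> \<in> M" "\<gamma>' \<in> M"
    then obtain k where "k \<le> R" "word_length G r s k (inv \<gamma> \<otimes> \<gamma>')"
      using R by blast
    with \<open>R \<le> R'\<close> show "\<exists>k\<le>R'. word_length G r s k (inv \<gamma> \<otimes> \<gamma>')"
      by (intro exI[of _ k]) simp
  qed
  also have "\<dots> < e"
  proof -
    have "0 < (2 / 3 :: real) ^ R'" by simp
    with R' nonneg[of R'] show ?thesis by linarith
  qed
  finally show ?thesis .
qed

end

section \<open>Local functions and the weak topology\<close>

text \<open>Agreement on \<open>M\<close> is tested for all functions, extensional or not, so that
  local functions may be evaluated at configurations read along an orbit without restricting them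
  first.\<close>

definition local_on :: "'g set \<Rightarrow> (('g \<Rightarrow> 'c) \<Rightarrow> 'b) \<Rightarrow> bool" where
  "local_on M f \<longleftrightarrow> (\<forall>x x'. (\<forall>\<gamma>\<in>M. x \<gamma> = x' \<gamma>) \<longrightarrow> f x = f x')"

lemma local_onI: "(\<And>x x'. (\<And>\<gamma>. \<gamma> \<in> M \<Longrightarrow> x \<gamma> = x' \<gamma>) \<Longrightarrow> f x = f x') \<Longrightarrow> local_on M f"
  unfolding local_on_def by blast

lemma local_onD: "local_on M f \<Longrightarrow> (\<And>\<gamma>. \<gamma> \<in> M \<Longrightarrow> x \<gamma> = x' \<gamma>) \<Longrightarrow> f x = f x'"
  unfolding local_on_def by blast

lemma local_on_restrict: "local_on M f \<Longrightarrow> f (restrict x M) = f x"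
  by (rule local_onD) auto

lemma local_on_bounded:
  fixes f :: "('g \<Rightarrow> 'c::finite) \<Rightarrow> real"
  assumes "finite M" "local_on M f"
  obtains B where "0 \<le> B" "\<And>x. \<bar>f x\<bar> \<le> B"
proof
  let ?B = "\<Sum>w\<in>M \<rightarrow>\<^sub>E UNIV. \<bar>f w\<bar>"
  show "0 \<le> ?B" by (simp add: sum_nonneg)
  show "\<bar>f x\<bar> \<le> ?B" for x
  proof -
    have "\<bar>f (restrict x M)\<bar> \<le> ?B"
      using assms(1) by (intro member_le_sum) (auto intro: finite_PiE)
    then show ?thesis using local_on_restrict[OF assms(2)] by simp
  qed
qed

section \<open>Measurability and continuity of local functions\<close>

lemma space_config_space: "space (config_space G) = carrier G \<rightarrow>\<^sub>E UNIV"
  by (simp add: config_space_def space_PiM)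

lemma measurable_coordinate:
  assumes "\<gamma> \<in> carrier G"
  shows "(\<lambda>x. x \<gamma>) \<in> measurable (config_space G) (count_space UNIV)"
  unfolding config_space_def by (rule measurable_component_singleton[OF assms])

text \<open>Writes a local function as a finite combination of cylinder indicators, which reduces
  its integrals to cylinder probabilities, both on the group and on a model.\<close>

lemma local_on_expand:
  fixes f :: "('g \<Rightarrow> 'c::finite) \<Rightarrow> real"
  assumes "finite M" "local_on M f"
  shows "f z = (\<Sum>w\<in>M \<rightarrow>\<^sub>E UNIV. f w * of_bool (\<forall>\<gamma>\<in>M. z \<gamma> = w \<gamma>))"
proof -
  have *: "(\<forall>\<gamma>\<in>M. z \<gamma> = w \<gamma>) \<longleftrightarrow> w = restrict z M" if "w \<in> M \<rightarrow>\<^sub>E UNIV" for w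
    using that by (auto simp: PiE_iff extensional_def fun_eq_iff)
  have "(\<Sum>w\<in>M \<rightarrow>\<^sub>E UNIV. f w * of_bool (\<forall>\<gamma>\<in>M. z \<gamma> = w \<gamma>)) =
      (\<Sum>w\<in>M \<rightarrow>\<^sub>E UNIV. if w = restrict z M then f w else 0)"
    by (intro sum.cong refl, subst *) auto
  also have "\<dots> = f (restrict z M)"
    using assms(1) by (subst sum.delta) (auto intro: finite_PiE)
  finally show ?thesis using local_on_restrict[OF assms(2)] by simp
qed

text \<open>Preimages are finite unions of cylinders. The space \<open>N\<close> is left general
  because both the full product and the sigma-algebra of the coordinates other than one site are
  needed.\<close>

lemma measurable_count_space_local:
  fixes f :: "('g \<Rightarrow> 'c::finite) \<Rightarrow> 'b"
  assumes "finite M" "local_on M f"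
    and coord: "\<And>\<gamma>. \<gamma> \<in> M \<Longrightarrow> (\<lambda>x. x \<gamma>) \<in> measurable N (count_space UNIV)"
  shows "f \<in> measurable N (count_space UNIV)"
proof (rule measurableI)
  fix A
  have "f -` A \<inter> space N = (\<Union>w\<in>{w \<in> M \<rightarrow>\<^sub>E UNIV. f w \<in> A}. {x \<in> space N. \<forall>\<gamma>\<in>M. x \<gamma> = w \<gamma>})"
  proof (intro equalityI subsetI)
    fix x assume "x \<in> f -` A \<inter> space N"
    then have "restrict x M \<in> {w \<in> M \<rightarrow>\<^sub>E UNIV. f w \<in> A}"
      "x \<in> {x \<in> space N. \<forall>\<gamma>\<in>M. x \<gamma> = restrict x M \<gamma>}"
      using local_on_restrict[OF assms(2)] by auto
    then show "x \<in> (\<Union>w\<in>{w \<in> M \<rightarrow>\<^sub>E UNIV. f w \<in> A}. {x \<in> space N. \<forall>\<gamma>\<in>M. x \<gamma> = w \<gamma>})"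
      by blast
  next
    fix x assume "x \<in> (\<Union>w\<in>{w \<in> M \<rightarrow>\<^sub>E UNIV. f w \<in> A}. {x \<in> space N. \<forall>\<gamma>\<in>M. x \<gamma> = w \<gamma>})"
    then show "x \<in> f -` A \<inter> space N"
      using local_onD[OF assms(2), of x] by fastforce
  qed
  also have "\<dots> \<in> sets N"
  proof (rule sets.finite_UN)
    show "finite {w \<in> M \<rightarrow>\<^sub>E (UNIV :: 'c set). f w \<in> A}"
      using assms(1) by (simp add: finite_PiE)
    fix w
    have "{x \<in> space N. x \<gamma> = w \<gamma>} \<in> sets N" if "\<gamma> \<in> M" for \<gamma>
      using measurable_sets[OF coord[OF that], of "{w \<gamma>}"] by (simp add: vimage_def Int_def conj_commute)
    then show "{x \<in> space N. \<forall>\<gamma>\<in>M. x \<gamma> = w \<gamma>} \<in> sets N"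
      using assms(1) by (intro sets.sets_Collect_finite_All) auto
  qed
  finally show "f -` A \<inter> space N \<in> sets N" .
qed auto

lemma measurable_local:
  fixes f :: "('g \<Rightarrow> 'a::finite) \<Rightarrow> 'b"
  assumes "finite M" "M \<subseteq> carrier G" "local_on M f"
  shows "f \<in> measurable (config_space G) (count_space UNIV)"
  using assms(2) by (intro measurable_count_space_local[OF assms(1,3)] measurable_coordinate) auto

lemma borel_measurable_local:
  fixes f :: "('g \<Rightarrow> 'a::finite) \<Rightarrow> real"
  assumes "finite M" "M \<subseteq> carrier G" "local_on M f"
  shows "f \<in> borel_measurable (config_space G)"
  using measurable_compose[OF measurable_local[OF assms], of "\<lambda>x. x"] by simp

lemma openin_cylinder:
  assumes "finite M" "M \<subseteq> I"
  shows "openin (product_topology (\<lambda>_. discrete_topology UNIV) I)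
    {z \<in> I \<rightarrow>\<^sub>E UNIV. \<forall>\<gamma>\<in>M. z \<gamma> = x \<gamma>}"
proof -
  have "openin (product_topology (\<lambda>_. discrete_topology UNIV) I)
      (Pi\<^sub>E I (\<lambda>\<gamma>. if \<gamma> \<in> M then {x \<gamma>} else UNIV))"
  proof (rule product_topology_basis)
    show "finite {\<gamma>. (if \<gamma> \<in> M then {x \<gamma>} else UNIV) \<noteq> topspace (discrete_topology UNIV)}"
      by (rule finite_subset[OF _ assms(1)]) auto
  qed auto
  also have "Pi\<^sub>E I (\<lambda>\<gamma>. if \<gamma> \<in> M then {x \<gamma>} else UNIV) = {z \<in> I \<rightarrow>\<^sub>E UNIV. \<forall>\<gamma>\<in>M. z \<gamma> = x \<gamma>}"
  proof (intro equalityI subsetI)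
    fix z assume z: "z \<in> Pi\<^sub>E I (\<lambda>\<gamma>. if \<gamma> \<in> M then {x \<gamma>} else UNIV)"
    have "z \<gamma> = x \<gamma>" if "\<gamma> \<in> M" for \<gamma>
      using PiE_mem[OF z, of \<gamma>] that assms(2) by auto
    with z show "z \<in> {z \<in> I \<rightarrow>\<^sub>E UNIV. \<forall>\<gamma>\<in>M. z \<gamma> = x \<gamma>}"
      by (simp add: PiE_iff)
  qed (simp add: PiE_iff)
  finally show ?thesis .
qed

lemma continuous_map_local:
  fixes f :: "('g \<Rightarrow> 'c) \<Rightarrow> real"
  assumes "finite M" "M \<subseteq> I" "local_on M f"
  shows "continuous_map (product_topology (\<lambda>_. discrete_topology UNIV) I) euclideanreal f"
  unfolding continuous_map_def
proof (intro conjI allI impI)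
  fix U :: "real set"
  let ?X = "product_topology (\<lambda>_. discrete_topology (UNIV :: 'c set)) I"
  show "openin ?X {x \<in> topspace ?X. f x \<in> U}"
  proof (subst openin_subopen, intro ballI)
    fix x assume x: "x \<in> {x \<in> topspace ?X. f x \<in> U}"
    have "{z \<in> I \<rightarrow>\<^sub>E UNIV. \<forall>\<gamma>\<in>M. z \<gamma> = x \<gamma>} \<subseteq> {x \<in> topspace ?X. f x \<in> U}"
    proof
      fix z assume z: "z \<in> {z \<in> I \<rightarrow>\<^sub>E UNIV. \<forall>\<gamma>\<in>M. z \<gamma> = x \<gamma>}"
      then have "f z = f x" by (intro local_onD[OF assms(3)]) blast
      with x z show "z \<in> {x \<in> topspace ?X. f x \<in> U}" by simp
    qed
    then show "\<exists>T. openin ?X T \<and> x \<in> T \<and> T \<subseteq> {x \<in> topspace ?X. f x \<in> U}"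
      using openin_cylinder[OF assms(1,2), of x] x
      by (intro exI[of _ "{z \<in> I \<rightarrow>\<^sub>E UNIV. \<forall>\<gamma>\<in>M. z \<gamma> = x \<gamma>}"]) auto
  qed
qed auto

text \<open>Compactness of a product of finite discrete spaces: finitely many cylinders on which
  \<open>f\<close> varies little cover the space, and \<open>M\<close> collects the coordinates
  fixing them.\<close>

lemma continuous_map_uniformly_local:
  fixes f :: "('g \<Rightarrow> 'c::finite) \<Rightarrow> real"
  assumes f: "continuous_map (product_topology (\<lambda>_. discrete_topology UNIV) I) euclideanreal f"
    and e: "0 < e"
  obtains M where "finite M" "M \<subseteq> I"
    "\<And>x x'. x \<in> I \<rightarrow>\<^sub>E UNIV \<Longrightarrow> x' \<in> I \<rightarrow>\<^sub>E UNIV \<Longrightarrow> (\<And>\<gamma>. \<gamma> \<in> M \<Longrightarrow> x \<gamma> = x' \<gamma>) \<Longrightarrow> \<bar>f x - f x'\<bar> < e"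
proof -
  let ?X = "product_topology (\<lambda>_. discrete_topology (UNIV :: 'c set)) I"
  let ?C = "\<lambda>M x. {z \<in> I \<rightarrow>\<^sub>E UNIV. \<forall>\<gamma>\<in>M. z \<gamma> = x \<gamma>}"
  have top: "topspace ?X = I \<rightarrow>\<^sub>E UNIV" by simp
  \<comment> \<open>Half of \<open>e\<close>, since both points are later compared with the base
    point of a common cylinder.\<close>
  have "\<forall>x\<in>I \<rightarrow>\<^sub>E UNIV. \<exists>M. finite M \<and> M \<subseteq> I \<and> (\<forall>z\<in>?C M x. \<bar>f z - f x\<bar> < e / 2)"
  proof
    fix x :: "'g \<Rightarrow> 'c" assume x: "x \<in> I \<rightarrow>\<^sub>E UNIV"
    have "openin ?X {z \<in> topspace ?X. f z \<in> ball (f x) (e / 2)}"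
      using f by (rule openin_continuous_map_preimage) simp
    moreover have "x \<in> {z \<in> topspace ?X. f z \<in> ball (f x) (e / 2)}"
      using x e by simp
    ultimately obtain U where U: "finite {i \<in> I. U i \<noteq> topspace (discrete_topology (UNIV :: 'c set))}"
      "x \<in> Pi\<^sub>E I U" "Pi\<^sub>E I U \<subseteq> {z \<in> topspace ?X. f z \<in> ball (f x) (e / 2)}"
      unfolding openin_product_topology_alt by meson
    let ?M = "{i \<in> I. U i \<noteq> topspace (discrete_topology (UNIV :: 'c set))}"
    have "\<bar>f z - f x\<bar> < e / 2" if z: "z \<in> ?C ?M x" for z
    proof -
      have "z \<gamma> \<in> U \<gamma>" if "\<gamma> \<in> I" for \<gamma>
        using z that PiE_mem[OF U(2) that] by (cases "U \<gamma> = UNIV") auto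
      then have "z \<in> Pi\<^sub>E I U"
        using z by (simp add: PiE_iff)
      with U(3) have "f z \<in> ball (f x) (e / 2)" by blast
      then show ?thesis by (simp add: dist_real_def abs_minus_commute)
    qed
    then have "\<forall>z\<in>?C ?M x. \<bar>f z - f x\<bar> < e / 2" by blast
    with U(1) show "\<exists>M. finite M \<and> M \<subseteq> I \<and> (\<forall>z\<in>?C M x. \<bar>f z - f x\<bar> < e / 2)"
      by (intro exI[of _ ?M]) simp
  qed
  from bchoice[OF this] obtain m where mm: "\<forall>x\<in>I \<rightarrow>\<^sub>E UNIV. finite (m x) \<and> m x \<subseteq> I \<and>
      (\<forall>z\<in>?C (m x) x. \<bar>f z - f x\<bar> < e / 2)"
    by (rule exE)
  have m: "finite (m x)" "m x \<subseteq> I" if "x \<in> I \<rightarrow>\<^sub>E UNIV" for x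
    using bspec[OF mm that] by (rule conjunct1, rule conjunct1[OF conjunct2])
  have close: "\<bar>f z - f x\<bar> < e / 2" if "x \<in> I \<rightarrow>\<^sub>E UNIV" "z \<in> ?C (m x) x" for x z
    by (rule bspec[OF conjunct2[OF conjunct2[OF bspec[OF mm that(1)]]] that(2)])
  define c where "c x = ?C (m x) x" for x
  have cpt: "compact_space ?X"
    by (simp add: compact_space_product_topology compact_space_discrete_topology)
  have op: "\<forall>U\<in>c ` (I \<rightarrow>\<^sub>E UNIV). openin ?X U"
    using m unfolding c_def by (intro ballI, elim imageE) (simp only: openin_cylinder)
  have cov: "topspace ?X \<subseteq> \<Union>(c ` (I \<rightarrow>\<^sub>E UNIV))"
    unfolding top by (auto simp: c_def)
  obtain \<F> where \<F>: "finite \<F>" "\<F> \<subseteq> c ` (I \<rightarrow>\<^sub>E UNIV)" "topspace ?X \<subseteq> \<Union>\<F>"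
    using cpt op cov unfolding compact_space_alt by meson
  from finite_subset_image[OF \<F>(1,2)] obtain K where
    K: "K \<subseteq> I \<rightarrow>\<^sub>E UNIV" "finite K" "\<F> = c ` K"
    by (elim exE conjE)
  show ?thesis
  proof (rule that[of "\<Union>x\<in>K. m x"])
    fix x x' :: "'g \<Rightarrow> 'c"
    assume x: "x \<in> I \<rightarrow>\<^sub>E UNIV" "x' \<in> I \<rightarrow>\<^sub>E UNIV" "\<And>\<gamma>. \<gamma> \<in> (\<Union>x\<in>K. m x) \<Longrightarrow> x \<gamma> = x' \<gamma>"
    have "x \<in> \<Union>(c ` K)" using x(1) \<F>(3) unfolding K(3) top by (rule rev_subsetD)
    then obtain k where k: "k \<in> K" "x \<in> c k" by (elim UN_E)
    have k': "k \<in> I \<rightarrow>\<^sub>E UNIV" using K(1) k(1) by (rule subsetD)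
    have "x' \<gamma> = k \<gamma>" if "\<gamma> \<in> m k" for \<gamma>
      using x(3)[of \<gamma>] k that by (simp add: c_def) metis
    then have "x' \<in> ?C (m k) k" using x(2) by simp
    then have "\<bar>f x - f k\<bar> < e / 2" "\<bar>f x' - f k\<bar> < e / 2"
      using close[OF k'] k(2) by (simp_all add: c_def)
    then show "\<bar>f x - f x'\<bar> < e" by linarith
  next
    show "finite (\<Union>x\<in>K. m x)"
      using m(1) K(1,2) by (intro finite_UN_I) (auto dest: subsetD)
    show "(\<Union>x\<in>K. m x) \<subseteq> I"
      using m(2) K(1) by (intro UN_least) (auto dest: subsetD)
  qed
qed

section \<open>Integrals of local functions and weak neighborhoods\<close>

lemma config_prob_prob_space: "\<mu> \<in> config_prob G \<Longrightarrow> prob_space \<mu>"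
  and config_prob_sets: "\<mu> \<in> config_prob G \<Longrightarrow> sets \<mu> = sets (config_space G)"
  by (auto simp: config_prob_def)

lemma config_prob_space: "\<mu> \<in> config_prob G \<Longrightarrow> space \<mu> = carrier G \<rightarrow>\<^sub>E UNIV"
  using sets_eq_imp_space_eq[OF config_prob_sets] by (simp add: space_config_space)

lemma config_prob_measurable: "\<mu> \<in> config_prob G \<Longrightarrow> measurable \<mu> N = measurable (config_space G) N"
  by (intro measurable_cong_sets config_prob_sets refl)

lemma integrable_local:
  fixes f :: "('g \<Rightarrow> 'a::finite) \<Rightarrow> real"
  assumes \<mu>: "\<mu> \<in> config_prob G" and f: "finite M" "M \<subseteq> carrier G" "local_on M f"
  shows "integrable \<mu> f"
proof -
  interpret prob_space \<mu> by (rule config_prob_prob_space[OF \<mu>])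
  obtain B where "\<And>x. \<bar>f x\<bar> \<le> B" using local_on_bounded[OF f(1,3)] by metis
  then show ?thesis
    using borel_measurable_local[OF f] config_prob_measurable[OF \<mu>]
    by (intro integrable_const_bound[of _ B]) auto
qed

lemma openin_weak_topology_local:
  fixes f :: "('g \<Rightarrow> 'a::finite) \<Rightarrow> real"
  assumes "finite M" "M \<subseteq> carrier G" "local_on M f" "open U"
  shows "openin (weak_topology G) {\<mu> \<in> config_prob G. (\<integral>x. f x \<partial>\<mu>) \<in> U}"
  unfolding weak_topology_def
  by (rule topology_generated_by_Basis) (use assms continuous_map_local[OF assms(1-3)] in blast)

lemma openin_config_prob: "openin (weak_topology G) (config_prob G :: ('g \<Rightarrow> 'a::finite) measure set)"
  using openin_weak_topology_local[of "{}" G "\<lambda>_. 0" UNIV] by (simp add: local_on_def)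

lemma continuous_map_local_approximation:
  fixes f :: "('g \<Rightarrow> 'c::finite) \<Rightarrow> real"
  assumes f: "continuous_map (product_topology (\<lambda>_. discrete_topology UNIV) I) euclideanreal f"
    and e: "0 < e"
  obtains M f' where "finite M" "M \<subseteq> I" "local_on M f'"
    "\<And>x. x \<in> I \<rightarrow>\<^sub>E UNIV \<Longrightarrow> \<bar>f' x - f x\<bar> < e"
proof -
  obtain M where M: "finite M" "M \<subseteq> I"
    "\<And>x x'. x \<in> I \<rightarrow>\<^sub>E UNIV \<Longrightarrow> x' \<in> I \<rightarrow>\<^sub>E UNIV \<Longrightarrow> (\<And>\<gamma>. \<gamma> \<in> M \<Longrightarrow> x \<gamma> = x' \<gamma>) \<Longrightarrow> \<bar>f x - f x'\<bar> < e"
    using continuous_map_uniformly_local[OF f e] by metis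
  \<comment> \<open>Coordinates off \<open>M\<close> are frozen at \<open>undefined\<close>; the
    outer restriction to \<open>I\<close> keeps the argument in the space where \<open>f\<close> is
    controlled.\<close>
  let ?f' = "\<lambda>x. f (\<lambda>\<gamma>\<in>I. if \<gamma> \<in> M then x \<gamma> else undefined)"
  show ?thesis
  proof (rule that[OF M(1,2), of ?f'])
    show "local_on M ?f'"
      by (intro local_onI arg_cong[of _ _ f] restrict_ext) simp
    show "\<bar>?f' x - f x\<bar> < e" if "x \<in> I \<rightarrow>\<^sub>E UNIV" for x
      using M(2) that by (intro M(3)) auto
  qed
qed

text \<open>A continuous function is a uniform limit of local ones, and these are measurable for the
  product sigma-algebra.\<close>

lemma borel_measurable_continuous_map:
  fixes f :: "('g \<Rightarrow> 'a::finite) \<Rightarrow> real"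
  assumes f: "continuous_map (product_topology (\<lambda>_. discrete_topology UNIV) (carrier G)) euclideanreal f"
  shows "f \<in> borel_measurable (config_space G)"
proof -
  have "\<exists>f'. f' \<in> borel_measurable (config_space G) \<and>
      (\<forall>x\<in>space (config_space G). \<bar>f' x - f x\<bar> < 1 / real (Suc n))" for n
  proof -
    have "0 < 1 / real (Suc n)" by simp
    from continuous_map_local_approximation[OF f this] show ?thesis
      by (metis borel_measurable_local space_config_space)
  qed
  then obtain F where F: "\<And>n. F n \<in> borel_measurable (config_space G)"
    "\<And>n x. x \<in> space (config_space G) \<Longrightarrow> \<bar>F n x - f x\<bar> < 1 / real (Suc n)"
    by metis
  have "(\<lambda>n. F n x) \<longlonglongrightarrow> f x" if "x \<in> space (config_space G)" for x
  proof (rule LIM_zero_cancel, rule Lim_null_comparison)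
    show "\<forall>\<^sub>F n in sequentially. norm (F n x - f x) \<le> inverse (real (Suc n))"
      using F(2)[OF that] by (intro always_eventually allI) (simp add: less_imp_le inverse_eq_divide)
  qed (rule LIMSEQ_inverse_real_of_nat)
  then show ?thesis
    by (rule borel_measurable_LIMSEQ_real) (use F(1) in auto)
qed

text \<open>The approximation is uniform on the space, so one local function serves all probability
  measures at once.\<close>

lemma weak_topology_approximation:
  fixes f :: "('g \<Rightarrow> 'a::finite) \<Rightarrow> real"
  assumes f: "continuous_map (product_topology (\<lambda>_. discrete_topology UNIV) (carrier G)) euclideanreal f"
    and e: "0 < e"
  obtains M f' where "finite M" "M \<subseteq> carrier G" "local_on M f'"
    "\<And>\<nu>. \<nu> \<in> config_prob G \<Longrightarrow> \<bar>(\<integral>x. f x \<partial>\<nu>) - (\<integral>x. f' x \<partial>\<nu>)\<bar> \<le> e"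
proof -
  obtain M f' where M: "finite M" "M \<subseteq> carrier G" "local_on M f'"
    "\<And>x. x \<in> carrier G \<rightarrow>\<^sub>E UNIV \<Longrightarrow> \<bar>f' x - f x\<bar> < e"
    using continuous_map_local_approximation[OF f e] by metis
  show ?thesis
  proof (rule that[OF M(1-3)])
    fix \<nu> :: "('g \<Rightarrow> 'a) measure" assume \<nu>: "\<nu> \<in> config_prob G"
    interpret prob_space \<nu> by (rule config_prob_prob_space[OF \<nu>])
    obtain B where B: "\<And>x. \<bar>f' x\<bar> \<le> B" using local_on_bounded[OF M(1,3)] by metis
    have close: "\<bar>f' x - f x\<bar> < e" if "x \<in> space \<nu>" for x
      using M(4) that unfolding config_prob_space[OF \<nu>] by blast
    have meas: "f \<in> borel_measurable \<nu>"
      using borel_measurable_continuous_map[OF f] config_prob_measurable[OF \<nu>] by blast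
    have int': "integrable \<nu> f'" by (rule integrable_local[OF \<nu> M(1-3)])
    have int: "integrable \<nu> f"
    proof (rule integrable_const_bound)
      show "AE x in \<nu>. norm (f x) \<le> B + e"
      proof (rule AE_I2)
        fix x assume "x \<in> space \<nu>"
        from close[OF this] B[of x] show "norm (f x) \<le> B + e"
          unfolding real_norm_def by linarith
      qed
    qed (rule meas)
    have "\<bar>(\<integral>x. f x \<partial>\<nu>) - (\<integral>x. f' x \<partial>\<nu>)\<bar> = \<bar>\<integral>x. f x - f' x \<partial>\<nu>\<bar>"
      using int int' by simp
    also have "\<dots> \<le> (\<integral>x. \<bar>f x - f' x\<bar> \<partial>\<nu>)" by (rule integral_abs_bound)
    also have "\<dots> \<le> (\<integral>x. e \<partial>\<nu>)"
      using int int' close by (intro integral_mono) (auto simp: abs_minus_commute intro: less_imp_le)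
    finally show "\<bar>(\<integral>x. f x \<partial>\<nu>) - (\<integral>x. f' x \<partial>\<nu>)\<bar> \<le> e"
      by (simp add: prob_space)
  qed
qed

text \<open>Containing a neighborhood of \<open>\<nu>\<close> given by finitely many local functions
  passes to finite intersections and to unions, so induction over the generated topology leaves only
  subbasic sets, where a continuous function is replaced by a local one.\<close>

lemma weak_neighborhood:
  fixes \<nu> :: "('g \<Rightarrow> 'a::finite) measure"
  assumes "openin (weak_topology G) \<O>" and \<nu>: "\<nu> \<in> \<O>" "\<nu> \<in> config_prob G"
  obtains \<F> :: "(('g \<Rightarrow> 'a) \<Rightarrow> real) set" and e :: real where "finite \<F>" "0 < e"
    "\<And>f. f \<in> \<F> \<Longrightarrow> \<exists>M. finite M \<and> M \<subseteq> carrier G \<and> local_on M f"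
    "\<And>\<nu>'. \<nu>' \<in> config_prob G \<Longrightarrow> (\<And>f. f \<in> \<F> \<Longrightarrow> \<bar>(\<integral>x. f x \<partial>\<nu>') - (\<integral>x. f x \<partial>\<nu>)\<bar> < e) \<Longrightarrow> \<nu>' \<in> \<O>"
proof -
  define nbhd where "nbhd \<O> \<F> e \<longleftrightarrow> finite \<F> \<and> 0 < e \<and>
      (\<forall>f\<in>\<F>. \<exists>M. finite M \<and> M \<subseteq> carrier G \<and> local_on M f) \<and>
      (\<forall>\<nu>'\<in>config_prob G. (\<forall>f\<in>\<F>. \<bar>(\<integral>x. f x \<partial>\<nu>') - (\<integral>x. f x \<partial>\<nu>)\<bar> < e) \<longrightarrow> \<nu>' \<in> \<O>)"
    for \<O> :: "('g \<Rightarrow> 'a) measure set" and \<F> :: "(('g \<Rightarrow> 'a) \<Rightarrow> real) set" and e :: real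
  let ?S = "{{\<mu> \<in> config_prob G. (\<integral>x. f x \<partial>\<mu>) \<in> U} | (f :: ('g \<Rightarrow> 'a) \<Rightarrow> real) U.
        continuous_map (product_topology (\<lambda>_. discrete_topology UNIV) (carrier G)) euclideanreal f \<and>
        open U}"
  have "generate_topology_on ?S \<O>"
    using assms(1) unfolding weak_topology_def by (rule openin_topology_generated_by)
  then have "\<nu> \<in> \<O> \<longrightarrow> (\<exists>\<F> e. nbhd \<O> \<F> e)"
  proof induction
    case Empty
    then show ?case by simp
  next
    case (Int \<O>1 \<O>2)
    show ?case
    proof
      assume "\<nu> \<in> \<O>1 \<inter> \<O>2"
      with Int.IH obtain \<F>1 e1 \<F>2 e2 where n: "nbhd \<O>1 \<F>1 e1" "nbhd \<O>2 \<F>2 e2" by blast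
      have "nbhd (\<O>1 \<inter> \<O>2) (\<F>1 \<union> \<F>2) (min e1 e2)"
        using n unfolding nbhd_def by (simp add: ball_Un)
      then show "\<exists>\<F> e. nbhd (\<O>1 \<inter> \<O>2) \<F> e" by blast
    qed
  next
    case (UN K)
    show ?case
    proof
      assume "\<nu> \<in> \<Union>K"
      then obtain k where k: "k \<in> K" "\<nu> \<in> k" by blast
      with UN obtain \<F> e where "nbhd k \<F> e" by blast
      then have "nbhd (\<Union>K) \<F> e"
        using k(1) unfolding nbhd_def by blast
      then show "\<exists>\<F> e. nbhd (\<Union>K) \<F> e" by blast
    qed
  next
    case (Basis k)
    then obtain f :: "('g \<Rightarrow> 'a) \<Rightarrow> real" and U where k: "k = {\<mu> \<in> config_prob G. (\<integral>x. f x \<partial>\<mu>) \<in> U}" and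
      f: "continuous_map (product_topology (\<lambda>_. discrete_topology UNIV) (carrier G)) euclideanreal f" and
      U: "open U"
      by blast
    show ?case
    proof
      assume "\<nu> \<in> k"
      then have "(\<integral>x. f x \<partial>\<nu>) \<in> U" unfolding k by simp
      then obtain e where e: "0 < e" "\<And>t. \<bar>t - (\<integral>x. f x \<partial>\<nu>)\<bar> < e \<Longrightarrow> t \<in> U"
        using U unfolding open_dist by (auto simp: dist_real_def)
      \<comment> \<open>One third for the replacement under each of the two measures, one third for
        the deviation between the local integrals.\<close>
      have "0 < e / 3" using e by simp
      then obtain M f' where M: "finite M" "M \<subseteq> carrier G" "local_on M f'"
        "\<And>\<nu>. \<nu> \<in> config_prob G \<Longrightarrow> \<bar>(\<integral>x. f x \<partial>\<nu>) - (\<integral>x. f' x \<partial>\<nu>)\<bar> \<le> e / 3"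
        using weak_topology_approximation[OF f] by metis
      have "\<nu>' \<in> k" if "\<nu>' \<in> config_prob G" "\<bar>(\<integral>x. f' x \<partial>\<nu>') - (\<integral>x. f' x \<partial>\<nu>)\<bar> < e / 3" for \<nu>'
      proof -
        have "\<bar>(\<integral>x. f x \<partial>\<nu>') - (\<integral>x. f x \<partial>\<nu>)\<bar> < e"
          using M(4)[OF that(1)] M(4)[OF \<nu>(2)] that(2) by linarith
        then show ?thesis using e(2) that(1) unfolding k by blast
      qed
      then have "nbhd k {f'} (e / 3)"
        unfolding nbhd_def using M(1-3) e(1) by auto
      then show "\<exists>\<F> e. nbhd k \<F> e" by blast
    qed
  qed
  with \<nu>(1) obtain \<F> e where "nbhd \<O> \<F> e" by blast
  then show ?thesis
    unfolding nbhd_def by (intro that[of \<F> e]) simp_all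
qed

section \<open>Simultaneous resampling\<close>

text \<open>
  Since the coins at \<open>F\<close> are down around an updated site, no site of its pattern is itself updated.
\<close>

definition updates ::
    "('g \<Rightarrow> 'p \<Rightarrow> 'p) \<Rightarrow> 'g set \<Rightarrow> ('g \<Rightarrow> 'a) \<Rightarrow> ('p \<Rightarrow> bool) \<Rightarrow> ('p \<Rightarrow> 'a) \<Rightarrow> 'p \<Rightarrow> bool" where
  "updates act F y b x p \<longleftrightarrow> b p \<and> (\<forall>\<kappa>\<in>F. \<not> b (act \<kappa> p) \<and> x (act \<kappa> p) = y \<kappa>)"

text \<open>One rule serves both worlds: \<open>act\<close> is left multiplication on the group and
  \<open>\<sigma>\<close> on a model, and pulling back along an orbit intertwines the two. A label
  carries a coin and a fresh letter; the letter is discarded unless the site is updated.\<close>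

definition resample ::
    "('g \<Rightarrow> 'p \<Rightarrow> 'p) \<Rightarrow> 'p set \<Rightarrow> 'g set \<Rightarrow> ('g \<Rightarrow> 'a) \<Rightarrow> ('p \<Rightarrow> bool \<times> 'a) \<Rightarrow> ('p \<Rightarrow> 'a) \<Rightarrow> 'p \<Rightarrow> 'a" where
  "resample act P F y l x = (\<lambda>p\<in>P. if updates act F y (\<lambda>p. fst (l p)) x p then snd (l p) else x p)"

text \<open>The fair coin is a convenient choice; what matters is that isolated selection has
  positive probability.\<close>

definition label_pmf :: "'a pmf \<Rightarrow> (bool \<times> 'a) pmf" where
  "label_pmf q = pair_pmf (bernoulli_pmf (1 / 2)) q"

definition group_labels :: "('g, 'm) monoid_scheme \<Rightarrow> 'a pmf \<Rightarrow> ('g \<Rightarrow> bool \<times> 'a::finite) measure" where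
  "group_labels G q = PiM (carrier G) (\<lambda>_. measure_pmf (label_pmf q))"

definition resampled_measure ::
    "('g, 'm) monoid_scheme \<Rightarrow> 'g set \<Rightarrow> ('g \<Rightarrow> 'a) \<Rightarrow> 'a pmf \<Rightarrow> ('g \<Rightarrow> 'a::finite) measure \<Rightarrow> ('g \<Rightarrow> 'a) measure" where
  "resampled_measure G F y q \<mu> = distr (\<mu> \<Otimes>\<^sub>M group_labels G q) (config_space G)
    (\<lambda>(x, l). resample (\<lambda>\<kappa> \<gamma>. \<kappa> \<otimes>\<^bsub>G\<^esub> \<gamma>) (carrier G) F y l x)"

text \<open>The operator on functions dual to \<open>resampled_measure\<close>. It maps local
  functions to local functions, so closeness to the resampled measure is tested by local integrals
  before resampling.\<close>

definition resampled_mean ::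
    "('g, 'm) monoid_scheme \<Rightarrow> 'g set \<Rightarrow> ('g \<Rightarrow> 'a) \<Rightarrow> 'a pmf \<Rightarrow> (('g \<Rightarrow> 'a::finite) \<Rightarrow> real) \<Rightarrow> ('g \<Rightarrow> 'a) \<Rightarrow> real" where
  "resampled_mean G F y q f x =
    (\<integral>l. f (resample (\<lambda>\<kappa> \<gamma>. \<kappa> \<otimes>\<^bsub>G\<^esub> \<gamma>) (carrier G) F y l x) \<partial>group_labels G q)"

section \<open>Independent labels on the group and on a model\<close>

lemma prob_space_group_labels: "prob_space (group_labels G q)"
  unfolding group_labels_def by (intro prob_space_PiM measure_pmf.prob_space_axioms)

lemma measurable_group_labels:
  assumes "\<gamma> \<in> carrier G"
  shows "(\<lambda>l. l \<gamma>) \<in> measurable (group_labels G q) (count_space UNIV)"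
  using measurable_component_singleton[OF assms, of "\<lambda>_. measure_pmf (label_pmf q)"]
  unfolding group_labels_def by (simp cong: measurable_cong_sets)

text \<open>Injectivity of \<open>h\<close> makes the labels read along it independent. The sum on
  the right recurs in \<open>integral_PiM_local\<close>; through it the labels of a model are
  exchanged for those of the group.\<close>

lemma expectation_Pi_pmf_local:
  fixes f :: "('g \<Rightarrow> 'c::finite) \<Rightarrow> real"
  assumes V: "finite V" and M: "finite M" "local_on M f" and h: "inj_on h M" "h ` M \<subseteq> V"
  shows "measure_pmf.expectation (Pi_pmf V d (\<lambda>_. p)) (\<lambda>c. f (\<lambda>\<gamma>. c (h \<gamma>))) =
    (\<Sum>w\<in>M \<rightarrow>\<^sub>E UNIV. f w * (\<Prod>\<gamma>\<in>M. pmf p (w \<gamma>)))"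
proof -
  let ?P = "Pi_pmf V d (\<lambda>_. p)"
  have prob: "measure_pmf.expectation ?P (\<lambda>c. of_bool (\<forall>\<gamma>\<in>M. c (h \<gamma>) = w \<gamma>)) = (\<Prod>\<gamma>\<in>M. pmf p (w \<gamma>))"
    for w :: "'g \<Rightarrow> 'c"
  proof -
    \<comment> \<open>The cylinder condition as a box over all of \<open>V\<close>, with the
      prescribed letters carried to \<open>V\<close> by \<open>h\<close> and no constraint
      elsewhere.\<close>
    define B where "B u = (if u \<in> h ` M then {w (the_inv_into M h u)} else UNIV)" for u
    have "(\<forall>\<gamma>\<in>M. c (h \<gamma>) = w \<gamma>) \<longleftrightarrow> c \<in> Pi V B" for c
      using h by (auto simp: B_def Pi_iff the_inv_into_f_f)
    then have "measure_pmf.expectation ?P (\<lambda>c. of_bool (\<forall>\<gamma>\<in>M. c (h \<gamma>) = w \<gamma>)) =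
        measure_pmf.expectation ?P (indicator (Pi V B))"
      by (intro Bochner_Integration.integral_cong refl) (simp add: indicator_def)
    also have "\<dots> = measure_pmf.prob ?P (Pi V B)"
      by simp
    also have "\<dots> = (\<Prod>u\<in>V. measure_pmf.prob p (B u))"
      by (rule measure_Pi_pmf_Pi[OF V])
    also have "\<dots> = (\<Prod>u\<in>h ` M. measure_pmf.prob p (B u))"
      using V h(2) by (intro prod.mono_neutral_right) (auto simp: B_def)
    also have "\<dots> = (\<Prod>\<gamma>\<in>M. measure_pmf.prob p (B (h \<gamma>)))"
      by (subst prod.reindex[OF h(1)]) simp
    also have "\<dots> = (\<Prod>\<gamma>\<in>M. pmf p (w \<gamma>))"
      using h(1) by (intro prod.cong refl) (simp add: B_def the_inv_into_f_f pmf.rep_eq)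
    finally show ?thesis .
  qed
  have "measure_pmf.expectation ?P (\<lambda>c. f (\<lambda>\<gamma>. c (h \<gamma>))) = measure_pmf.expectation ?P
      (\<lambda>c. \<Sum>w\<in>M \<rightarrow>\<^sub>E UNIV. f w * of_bool (\<forall>\<gamma>\<in>M. c (h \<gamma>) = w \<gamma>))"
    by (subst local_on_expand[OF M]) simp
  also have "\<dots> = (\<Sum>w\<in>M \<rightarrow>\<^sub>E UNIV. f w * measure_pmf.expectation ?P (\<lambda>c. of_bool (\<forall>\<gamma>\<in>M. c (h \<gamma>) = w \<gamma>)))"
    by (subst Bochner_Integration.integral_sum)
      (auto intro!: integrable_mult_right measure_pmf.integrable_const_bound[of _ 1])
  finally show ?thesis by (simp add: prob)
qed

lemma integral_PiM_local:
  fixes f :: "('g \<Rightarrow> 'c::finite) \<Rightarrow> real"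
  assumes M: "finite M" "local_on M f" "M \<subseteq> I"
  shows "(\<integral>c. f c \<partial>PiM I (\<lambda>_. measure_pmf p)) = (\<Sum>w\<in>M \<rightarrow>\<^sub>E UNIV. f w * (\<Prod>\<gamma>\<in>M. pmf p (w \<gamma>)))"
proof -
  let ?P = "PiM I (\<lambda>_. measure_pmf p)"
  interpret P: product_prob_space "\<lambda>_. measure_pmf p" I
    by unfold_locales
  let ?E = "\<lambda>w. prod_emb I (\<lambda>_. measure_pmf p) M (Pi\<^sub>E M (\<lambda>\<gamma>. {w \<gamma>}))"
  have E: "?E w \<in> sets ?P" for w
    using M by (intro sets_PiM_I) auto
  have ind: "of_bool (\<forall>\<gamma>\<in>M. c \<gamma> = w \<gamma>) = (indicator (?E w) c :: real)" if "c \<in> space ?P" for c w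
    using that M(3) by (auto simp: prod_emb_def space_PiM indicator_def PiE_iff)
  have int: "integrable ?P (\<lambda>c. f w * indicator (?E w) c)" for w
    using E by (intro integrable_mult_right P.integrable_const_bound[of _ 1]) (auto simp: indicator_def)
  have "(\<integral>c. f c \<partial>?P) = (\<integral>c. (\<Sum>w\<in>M \<rightarrow>\<^sub>E UNIV. f w * indicator (?E w) c) \<partial>?P)"
    by (intro Bochner_Integration.integral_cong refl, subst local_on_expand[OF M(1,2)]) (simp add: ind)
  also have "\<dots> = (\<Sum>w\<in>M \<rightarrow>\<^sub>E UNIV. f w * measure ?P (?E w))"
    using E int by (subst Bochner_Integration.integral_sum) (auto simp: P.emeasure_eq_measure)
  also have "\<dots> = (\<Sum>w\<in>M \<rightarrow>\<^sub>E UNIV. f w * (\<Prod>\<gamma>\<in>M. pmf p (w \<gamma>)))"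
    using M by (subst P.measure_PiM_emb) (auto simp: pmf.rep_eq)
  finally show ?thesis .
qed

lemma local_on_resample_labels:
  fixes act :: "'g \<Rightarrow> 'p \<Rightarrow> 'p" and f :: "('p \<Rightarrow> 'a) \<Rightarrow> 'b"
  assumes f: "local_on M f" and M: "M \<subseteq> P"
  shows "local_on (M \<union> (\<Union>\<kappa>\<in>F. act \<kappa> ` M)) (\<lambda>l. f (resample act P F y l x))"
proof (intro local_onI local_onD[OF f])
  fix l l' :: "'p \<Rightarrow> bool \<times> 'a" and \<gamma>
  assume l: "\<And>\<gamma>. \<gamma> \<in> M \<union> (\<Union>\<kappa>\<in>F. act \<kappa> ` M) \<Longrightarrow> l \<gamma> = l' \<gamma>" and \<gamma>: "\<gamma> \<in> M"
  have "l \<gamma> = l' \<gamma>" "\<And>\<kappa>. \<kappa> \<in> F \<Longrightarrow> l (act \<kappa> \<gamma>) = l' (act \<kappa> \<gamma>)"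
    using \<gamma> by (auto intro!: l)
  then have "updates act F y (\<lambda>p. fst (l p)) x \<gamma> \<longleftrightarrow> updates act F y (\<lambda>p. fst (l' p)) x \<gamma>"
    unfolding updates_def by simp
  with \<open>l \<gamma> = l' \<gamma>\<close> show "resample act P F y l x \<gamma> = resample act P F y l' x \<gamma>"
    using \<gamma> M by (auto simp: resample_def)
qed

lemma local_on_resample_config:
  fixes act :: "'g \<Rightarrow> 'p \<Rightarrow> 'p" and f :: "('p \<Rightarrow> 'a) \<Rightarrow> 'b"
  assumes f: "local_on M f" and M: "M \<subseteq> P"
  shows "local_on (M \<union> (\<Union>\<kappa>\<in>F. act \<kappa> ` M)) (\<lambda>x. f (resample act P F y l x))"
proof (intro local_onI local_onD[OF f])
  fix x x' :: "'p \<Rightarrow> 'a" and \<gamma>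
  assume x: "\<And>\<gamma>. \<gamma> \<in> M \<union> (\<Union>\<kappa>\<in>F. act \<kappa> ` M) \<Longrightarrow> x \<gamma> = x' \<gamma>" and \<gamma>: "\<gamma> \<in> M"
  have "x \<gamma> = x' \<gamma>" "\<And>\<kappa>. \<kappa> \<in> F \<Longrightarrow> x (act \<kappa> \<gamma>) = x' (act \<kappa> \<gamma>)"
    using \<gamma> by (auto intro!: x)
  then have "updates act F y (\<lambda>p. fst (l p)) x \<gamma> \<longleftrightarrow> updates act F y (\<lambda>p. fst (l p)) x' \<gamma>"
    unfolding updates_def by simp
  with \<open>x \<gamma> = x' \<gamma>\<close> show "resample act P F y l x \<gamma> = resample act P F y l x' \<gamma>"
    using \<gamma> M by (auto simp: resample_def)
qed

text \<open>All sites consulted in deciding the new letters on \<open>M\<close>.\<close>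

abbreviation window :: "('g, 'm) monoid_scheme \<Rightarrow> 'g set \<Rightarrow> 'g set \<Rightarrow> 'g set" where
  "window G F M \<equiv> M \<union> (\<Union>\<kappa>\<in>F. (\<lambda>\<gamma>. \<kappa> \<otimes>\<^bsub>G\<^esub> \<gamma>) ` M)"

lemma local_on_resampled_mean:
  assumes f: "local_on M f" and M: "M \<subseteq> carrier G"
  shows "local_on (window G F M) (resampled_mean G F y q f)"
proof (rule local_onI)
  fix x x' :: "'a \<Rightarrow> 'b"
  assume x: "\<And>\<gamma>. \<gamma> \<in> window G F M \<Longrightarrow> x \<gamma> = x' \<gamma>"
  show "resampled_mean G F y q f x = resampled_mean G F y q f x'"
    unfolding resampled_mean_def
    by (intro Bochner_Integration.integral_cong refl local_onD[OF local_on_resample_config[OF f M]] x)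
qed

lemma measurable_resample:
  fixes \<mu> :: "('g \<Rightarrow> 'a::finite) measure"
  assumes G: "group G" and F: "finite F" "F \<subseteq> carrier G" and \<mu>: "\<mu> \<in> config_prob G"
  shows "(\<lambda>(x, l). resample (\<lambda>\<kappa> \<gamma>. \<kappa> \<otimes>\<^bsub>G\<^esub> \<gamma>) (carrier G) F y l x)
    \<in> measurable (\<mu> \<Otimes>\<^sub>M group_labels G q) (config_space G)"
proof -
  interpret group G by (rule G)
  let ?N = "\<mu> \<Otimes>\<^sub>M group_labels G q"
  have x: "(\<lambda>\<omega>. fst \<omega> \<gamma>) \<in> measurable ?N (count_space UNIV)" if "\<gamma> \<in> carrier G" for \<gamma>
  proof -
    have "(\<lambda>x. x \<gamma>) \<in> measurable \<mu> (count_space UNIV)"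
      unfolding config_prob_measurable[OF \<mu>] by (rule measurable_coordinate[OF that])
    then show ?thesis by (rule measurable_compose[OF measurable_fst])
  qed
  have l: "(\<lambda>\<omega>. snd \<omega> \<gamma>) \<in> measurable ?N (count_space UNIV)" if "\<gamma> \<in> carrier G" for \<gamma>
    by (rule measurable_compose[OF measurable_snd measurable_group_labels[OF that]])
  have "(\<lambda>\<omega>. if updates (\<lambda>\<kappa> \<gamma>. \<kappa> \<otimes>\<^bsub>G\<^esub> \<gamma>) F y (\<lambda>p. fst (snd \<omega> p)) (fst \<omega>) \<gamma> then snd (snd \<omega> \<gamma>) else fst \<omega> \<gamma>)
      \<in> measurable ?N (count_space UNIV)" if \<gamma>: "\<gamma> \<in> carrier G" for \<gamma>
  proof (rule measurable_If)
    show "(\<lambda>\<omega>. snd (snd \<omega> \<gamma>)) \<in> measurable ?N (count_space UNIV)"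
      by (rule measurable_compose[OF l[OF \<gamma>]]) simp
    show "(\<lambda>\<omega>. fst \<omega> \<gamma>) \<in> measurable ?N (count_space UNIV)" by (rule x[OF \<gamma>])
    have c: "Measurable.pred ?N (\<lambda>\<omega>. fst (snd \<omega> \<beta>))" "Measurable.pred ?N (\<lambda>\<omega>. fst \<omega> \<beta> = a)"
      if "\<beta> \<in> carrier G" for \<beta> a
      using measurable_compose[OF l[OF that], of fst "count_space UNIV"]
        measurable_compose[OF x[OF that], of "\<lambda>c. c = a" "count_space UNIV"] by simp_all
    have "Measurable.pred ?N (\<lambda>\<omega>. updates (\<lambda>\<kappa> \<gamma>. \<kappa> \<otimes>\<^bsub>G\<^esub> \<gamma>) F y (\<lambda>p. fst (snd \<omega> p)) (fst \<omega>) \<gamma>)"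
      unfolding updates_def
      using F \<gamma> by (intro pred_intros_logic pred_intros_finite c) auto
    then show "{\<omega> \<in> space ?N. updates (\<lambda>\<kappa> \<gamma>. \<kappa> \<otimes>\<^bsub>G\<^esub> \<gamma>) F y (\<lambda>p. fst (snd \<omega> p)) (fst \<omega>) \<gamma>} \<in> sets ?N"
      by (simp only: pred_def)
  qed
  then show ?thesis
    unfolding config_space_def resample_def case_prod_beta by (rule measurable_restrict)
qed

lemma resampled_measure_config_prob:
  assumes "group G" "finite F" "F \<subseteq> carrier G" "\<mu> \<in> config_prob G"
  shows "resampled_measure G F y q \<mu> \<in> config_prob G"
proof -
  interpret \<mu>: prob_space \<mu> by (rule config_prob_prob_space[OF assms(4)])
  interpret L: prob_space "group_labels G q" by (rule prob_space_group_labels)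
  interpret P: pair_prob_space \<mu> "group_labels G q" ..
  show ?thesis
    using P.prob_space_distr[OF measurable_resample[OF assms]]
    by (simp add: config_prob_def resampled_measure_def)
qed

lemma integral_resampled_measure:
  fixes f :: "('g \<Rightarrow> 'a::finite) \<Rightarrow> real"
  assumes G: "group G" and F: "finite F" "F \<subseteq> carrier G" and \<mu>: "\<mu> \<in> config_prob G"
    and f: "finite M" "M \<subseteq> carrier G" "local_on M f"
  shows "(\<integral>x. f x \<partial>resampled_measure G F y q \<mu>) = (\<integral>x. resampled_mean G F y q f x \<partial>\<mu>)"
proof -
  interpret \<mu>: prob_space \<mu> by (rule config_prob_prob_space[OF \<mu>])
  interpret L: prob_space "group_labels G q" by (rule prob_space_group_labels)
  interpret P: pair_prob_space \<mu> "group_labels G q" ..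
  let ?r = "\<lambda>x l. resample (\<lambda>\<kappa> \<gamma>. \<kappa> \<otimes>\<^bsub>G\<^esub> \<gamma>) (carrier G) F y l x"
  note meas = measurable_resample[OF G F \<mu>, of y q]
  obtain B where B: "\<And>x. \<bar>f x\<bar> \<le> B" using local_on_bounded[OF f(1,3)] by metis
  have "(\<lambda>\<omega>. f (case \<omega> of (x, l) \<Rightarrow> ?r x l)) \<in> borel_measurable (\<mu> \<Otimes>\<^sub>M group_labels G q)"
    by (rule measurable_compose[OF meas borel_measurable_local[OF f]])
  then have int: "integrable (\<mu> \<Otimes>\<^sub>M group_labels G q) (\<lambda>(x, l). f (?r x l))"
    using B by (intro P.integrable_const_bound[of _ B]) (auto simp: case_prod_beta)
  have "(\<integral>x. f x \<partial>resampled_measure G F y q \<mu>) =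
      (\<integral>\<omega>. f (case \<omega> of (x, l) \<Rightarrow> ?r x l) \<partial>(\<mu> \<Otimes>\<^sub>M group_labels G q))"
    unfolding resampled_measure_def by (rule integral_distr[OF meas borel_measurable_local[OF f]])
  also have "\<dots> = (\<integral>(x, l). f (?r x l) \<partial>(\<mu> \<Otimes>\<^sub>M group_labels G q))"
    by (simp add: case_prod_unfold)
  also have "\<dots> = (\<integral>x. (\<integral>l. f (?r x l) \<partial>group_labels G q) \<partial>\<mu>)"
    by (rule P.integral_fst'[OF int, symmetric, unfolded split_conv])
  finally show ?thesis by (simp add: resampled_mean_def)
qed

section \<open>A finite-pattern criterion for Gibbs measures\<close>

text \<open>The energy of a letter at a site, given its surroundings, moved to the identity. The
  value \<open>y \<one>\<close> is overwritten, so only the values of \<open>y\<close> around the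
  identity count.\<close>

definition pattern_energy ::
    "('g, 'm) monoid_scheme \<Rightarrow> nat \<Rightarrow> (nat \<Rightarrow> 'g) \<Rightarrow> ('a \<Rightarrow> real) \<Rightarrow> ('a \<Rightarrow> 'a \<Rightarrow> real) \<Rightarrow> ('g \<Rightarrow> 'a) \<Rightarrow> 'a \<Rightarrow> real" where
  "pattern_energy G r s h J y a = local_energy G r s h J \<one>\<^bsub>G\<^esub> (y(\<one>\<^bsub>G\<^esub> := a))"

definition pattern_rate ::
    "('g, 'm) monoid_scheme \<Rightarrow> nat \<Rightarrow> (nat \<Rightarrow> 'g) \<Rightarrow> ('a::finite \<Rightarrow> real) \<Rightarrow> ('a \<Rightarrow> 'a \<Rightarrow> real) \<Rightarrow> ('g \<Rightarrow> 'a) \<Rightarrow> 'a \<Rightarrow> real" where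
  "pattern_rate G r s h J y a = exp (- pattern_energy G r s h J y a) / (\<Sum>b\<in>UNIV. exp (- pattern_energy G r s h J y b))"

text \<open>The identity is removed because a trivial generator rereads the letter at the site
  itself, which is the one to be redrawn.\<close>

definition neighborhood :: "('g, 'm) monoid_scheme \<Rightarrow> nat \<Rightarrow> (nat \<Rightarrow> 'g) \<Rightarrow> 'g set" where
  "neighborhood G r s = (s ` {1..r} \<union> (\<lambda>i. inv\<^bsub>G\<^esub> (s i)) ` {1..r}) - {\<one>\<^bsub>G\<^esub>}"

lemma finite_neighborhood: "finite (neighborhood G r s)"
  by (simp add: neighborhood_def)

section \<open>Translating patterns to the identity\<close>

context group
begin

lemma mult_eq_self_iff: "\<kappa> \<in> carrier G \<Longrightarrow> \<gamma> \<in> carrier G \<Longrightarrow> \<kappa> \<otimes> \<gamma> = \<gamma> \<longleftrightarrow> \<kappa> = \<one>"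
  by (rule r_cancel_one)

lemma neighborhood_closed:
  "s ` {1..r} \<subseteq> carrier G \<Longrightarrow> neighborhood G r s \<subseteq> carrier G"
  by (auto simp: neighborhood_def)

text \<open>Right multiplication by \<open>\<gamma>\<close> carries the surroundings of the identity
  to those of \<open>\<gamma>\<close>, and \<open>\<kappa> \<otimes> \<gamma> = \<gamma>\<close>
  only for trivial \<open>\<kappa>\<close>, so the overwritten sites correspond.\<close>

lemma local_energy_pattern:
  assumes s: "s ` {1..r} \<subseteq> carrier G" and \<gamma>: "\<gamma> \<in> carrier G"
    and x: "\<And>\<kappa>. \<kappa> \<in> neighborhood G r s \<Longrightarrow> x (\<kappa> \<otimes> \<gamma>) = y \<kappa>"
  shows "local_energy G r s h J \<gamma> (x(\<gamma> := a)) = pattern_energy G r s h J y a"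
proof -
  have c: "s i \<in> carrier G" if "i \<in> {1..r}" for i using s that by auto
  have 1: "(x(\<gamma> := a)) (s i \<otimes> \<gamma>) = (y(\<one> := a)) (s i \<otimes> \<one>)" if "i \<in> {1..r}" for i
    using x[of "s i"] that c[OF that] \<gamma> by (auto simp: mult_eq_self_iff neighborhood_def)
  have 2: "(x(\<gamma> := a)) (inv (s i) \<otimes> \<gamma>) = (y(\<one> := a)) (inv (s i) \<otimes> \<one>)"
    if "i \<in> {1..r}" "s i \<noteq> \<one>" for i
    using x[of "inv (s i)"] that c[OF that(1)] \<gamma> by (auto simp: mult_eq_self_iff neighborhood_def)
  show ?thesis
    unfolding local_energy_def pattern_energy_def
    by (intro arg_cong2[of _ _ _ _ "(+)"] sum.cong refl) (auto simp only: 1 mem_Collect_eq fun_upd_same intro!: arg_cong2[of _ _ _ _ J] 2)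
qed

lemma glauber_rate_pattern:
  assumes "s ` {1..r} \<subseteq> carrier G" "\<gamma> \<in> carrier G"
    and "\<And>\<kappa>. \<kappa> \<in> neighborhood G r s \<Longrightarrow> x (\<kappa> \<otimes> \<gamma>) = y \<kappa>"
  shows "glauber_rate G r s h J \<gamma> x a = pattern_rate G r s h J y a"
  unfolding glauber_rate_def pattern_rate_def
  by (simp only: local_energy_pattern[where x = x and y = y and h = h and J = J, OF assms])

lemma local_on_glauber_rate:
  assumes s: "s ` {1..r} \<subseteq> carrier G" and \<gamma>: "\<gamma> \<in> carrier G"
  shows "local_on ((\<lambda>\<kappa>. \<kappa> \<otimes> \<gamma>) ` neighborhood G r s) (\<lambda>x. glauber_rate G r s h J \<gamma> x a)"
proof (rule local_onI)
  fix x x' :: "'a \<Rightarrow> 'c"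
  assume eq: "\<And>\<beta>. \<beta> \<in> (\<lambda>\<kappa>. \<kappa> \<otimes> \<gamma>) ` neighborhood G r s \<Longrightarrow> x \<beta> = x' \<beta>"
  let ?y = "\<lambda>\<kappa>. x' (\<kappa> \<otimes> \<gamma>)"
  have "glauber_rate G r s h J \<gamma> x a = pattern_rate G r s h J ?y a"
    by (rule glauber_rate_pattern[OF s \<gamma>]) (rule eq, simp)
  also have "\<dots> = glauber_rate G r s h J \<gamma> x' a"
    by (rule glauber_rate_pattern[OF s \<gamma>, symmetric]) simp
  finally show "glauber_rate G r s h J \<gamma> x a = glauber_rate G r s h J \<gamma> x' a" .
qed

end

text \<open>Cylinder events over \<open>I\<close>. For \<open>I = carrier G - {\<gamma>}\<close>
  they are an intersection-stable generator of \<open>other_coords\<close>, fit for a Dynkin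
  argument.\<close>

definition local_sets :: "('g, 'm) monoid_scheme \<Rightarrow> 'g set \<Rightarrow> ('g \<Rightarrow> 'a::finite) set set" where
  "local_sets G I = {{x \<in> space (config_space G). Q x} | Q M. finite M \<and> M \<subseteq> I \<and> local_on M Q}"

lemma local_setsI:
  "finite M \<Longrightarrow> M \<subseteq> I \<Longrightarrow> local_on M Q \<Longrightarrow> {x \<in> space (config_space G). Q x} \<in> local_sets G I"
  unfolding local_sets_def by (rule CollectI, rule exI[of _ Q], rule exI[of _ M]) simp

lemma local_setsE:
  assumes "A \<in> local_sets G I"
  obtains Q M where "A = {x \<in> space (config_space G). Q x}" "finite M" "M \<subseteq> I" "local_on M Q"
  using assms unfolding local_sets_def by (elim CollectE exE conjE)

lemma sets_other_coords:
  "sets (other_coords G \<gamma>) = sigma_sets (space (config_space G)) (local_sets G (carrier G - {\<gamma>}))"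
  (is "_ = sigma_sets ?\<Omega> ?L")
proof -
  let ?C = "\<Union>\<beta>\<in>carrier G - {\<gamma>}. {{x \<in> ?\<Omega>. x \<beta> \<in> B} | B. True}"
  have C: "?C \<subseteq> Pow ?\<Omega>" by auto
  have meas: "(\<lambda>x. x \<beta>) \<in> measurable (sigma ?\<Omega> ?C) (count_space UNIV)" if "\<beta> \<in> carrier G - {\<gamma>}" for \<beta>
  proof (rule measurableI)
    fix B
    have "(\<lambda>x. x \<beta>) -` B \<inter> space (sigma ?\<Omega> ?C) = {x \<in> ?\<Omega>. x \<beta> \<in> B}"
      using C by (auto simp: space_measure_of)
    also have "\<dots> \<in> sets (sigma ?\<Omega> ?C)"
      using C that by (subst sets_measure_of) (auto intro!: sigma_sets.Basic)
    finally show "(\<lambda>x. x \<beta>) -` B \<inter> space (sigma ?\<Omega> ?C) \<in> sets (sigma ?\<Omega> ?C)" .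
  qed simp
  have "sets (sigma ?\<Omega> ?C) = sigma_sets ?\<Omega> ?L"
  proof (intro equalityI)
    have "?C \<subseteq> sigma_sets ?\<Omega> ?L"
    proof
      fix X assume "X \<in> ?C"
      then obtain \<beta> B where \<beta>: "\<beta> \<in> carrier G - {\<gamma>}" and X: "X = {x \<in> ?\<Omega>. x \<beta> \<in> B}" by blast
      have "local_on {\<beta>} (\<lambda>x. x \<beta> \<in> B)" by (rule local_onI) simp
      with \<beta> have "{x \<in> ?\<Omega>. x \<beta> \<in> B} \<in> ?L" by (intro local_setsI[of "{\<beta>}"]) simp_all
      then show "X \<in> sigma_sets ?\<Omega> ?L" unfolding X by (rule sigma_sets.Basic)
    qed
    then show "sets (sigma ?\<Omega> ?C) \<subseteq> sigma_sets ?\<Omega> ?L"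
      unfolding sets_measure_of[OF C] by (intro sigma_sets_mono)
    have "?L \<subseteq> sets (sigma ?\<Omega> ?C)"
    proof
      fix X assume "X \<in> ?L"
      then obtain Q M where M: "finite M" "M \<subseteq> carrier G - {\<gamma>}" "local_on M Q" and X: "X = {x \<in> ?\<Omega>. Q x}"
        by (elim local_setsE)
      have "Q \<in> measurable (sigma ?\<Omega> ?C) (count_space UNIV)"
        using M meas by (intro measurable_count_space_local[OF M(1,3)]) blast
      then have "{x \<in> space (sigma ?\<Omega> ?C). Q x} \<in> sets (sigma ?\<Omega> ?C)" by measurable
      then show "X \<in> sets (sigma ?\<Omega> ?C)"
        unfolding X using C by (simp add: space_measure_of)
    qed
    then show "sigma_sets ?\<Omega> ?L \<subseteq> sets (sigma ?\<Omega> ?C)"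
      using sets.sigma_sets_subset[of ?L "sigma ?\<Omega> ?C"] C by (simp add: space_measure_of)
  qed
  then show ?thesis by (simp add: other_coords_def)
qed

lemma space_other_coords: "space (other_coords G \<gamma>) = space (config_space G)"
  unfolding other_coords_def by (rule space_measure_of) auto

lemma measurable_other_coords_local:
  fixes f :: "('g \<Rightarrow> 'a::finite) \<Rightarrow> 'b"
  assumes "finite M" "M \<subseteq> carrier G - {\<gamma>}" "local_on M f"
  shows "f \<in> measurable (other_coords G \<gamma>) (count_space UNIV)"
proof (rule measurable_count_space_local[OF assms(1,3)])
  fix \<beta> assume "\<beta> \<in> M"
  show "(\<lambda>x :: 'g \<Rightarrow> 'a. x \<beta>) \<in> measurable (other_coords G \<gamma>) (count_space UNIV)"
  proof (rule measurableI)
    fix B :: "'a set"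
    have "local_on {\<beta>} (\<lambda>x. x \<beta> \<in> B)" by (rule local_onI) simp
    then have "{x \<in> space (config_space G). x \<beta> \<in> B} \<in> sets (other_coords G \<gamma>)"
      unfolding sets_other_coords using \<open>\<beta> \<in> M\<close> assms(2)
      by (intro sigma_sets.Basic local_setsI[of "{\<beta>}"]) auto
    then show "(\<lambda>x :: 'g \<Rightarrow> 'a. x \<beta>) -` B \<inter> space (other_coords G \<gamma>) \<in> sets (other_coords G \<gamma>)"
      by (simp add: space_other_coords vimage_def Int_def conj_commute)
  qed simp
qed

lemma subalgebra_other_coords:
  fixes \<mu> :: "('g \<Rightarrow> 'a::finite) measure"
  assumes "\<mu> \<in> config_prob G"
  shows "subalgebra \<mu> (other_coords G \<gamma>)"
  unfolding subalgebra_def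
proof
  show "space (other_coords G \<gamma>) = space \<mu>"
    using config_prob_space[OF assms] by (simp add: space_other_coords space_config_space)
  have "local_sets G (carrier G - {\<gamma>}) \<subseteq> sets (config_space G :: ('g \<Rightarrow> 'a) measure)"
  proof
    fix X :: "('g \<Rightarrow> 'a) set" assume "X \<in> local_sets G (carrier G - {\<gamma>})"
    then obtain Q M where M: "finite M" "M \<subseteq> carrier G - {\<gamma>}" "local_on M Q"
      and X: "X = {x \<in> space (config_space G). Q x}"
      by (elim local_setsE)
    have "Q \<in> measurable (config_space G) (count_space UNIV)"
      using M by (intro measurable_local[of M]) auto
    then show "X \<in> sets (config_space G)" unfolding X by measurable
  qed
  then have "sigma_sets (space (config_space G)) (local_sets G (carrier G - {\<gamma>}))
      \<subseteq> sets (config_space G :: ('g \<Rightarrow> 'a) measure)"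
    by (rule sets.sigma_sets_subset)
  then show "sets (other_coords G \<gamma>) \<subseteq> sets \<mu>"
    by (simp add: sets_other_coords config_prob_sets[OF assms])
qed

text \<open>The events over which \<open>f\<close> integrates to zero are closed under complements
  and countable disjoint unions, and \<open>zero\<close> covers an intersection-stable
  generator.\<close>

lemma integral_zero_other_coords:
  fixes \<mu> :: "('g \<Rightarrow> 'a::finite) measure" and f :: "('g \<Rightarrow> 'a) \<Rightarrow> real"
  assumes \<mu>: "\<mu> \<in> config_prob G" and f: "integrable \<mu> f"
    and zero: "\<And>Q M. finite M \<Longrightarrow> M \<subseteq> carrier G - {\<gamma>} \<Longrightarrow> local_on M Q \<Longrightarrow> (\<integral>x. of_bool (Q x) * f x \<partial>\<mu>) = 0"
    and A: "A \<in> sets (other_coords G \<gamma>)"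
  shows "(\<integral>x. indicator A x * f x \<partial>\<mu>) = 0"
proof -
  let ?\<Omega> = "space (config_space G) :: ('g \<Rightarrow> 'a) set"
  let ?L = "local_sets G (carrier G - {\<gamma>}) :: ('g \<Rightarrow> 'a) set set"
  have \<Omega>: "space \<mu> = ?\<Omega>"
    using config_prob_space[OF \<mu>] by (simp add: space_config_space)
  have sub: "sigma_sets ?\<Omega> ?L \<subseteq> sets \<mu>"
    using subalgebra_other_coords[OF \<mu>, of \<gamma>] by (simp add: subalgebra_def sets_other_coords)
  have int: "integrable \<mu> (\<lambda>x. indicator A x * f x)" if "A \<in> sigma_sets ?\<Omega> ?L" for A
    using integrable_mult_indicator[OF _ f, of A] sub that by (auto simp: mult.commute)
  have loc: "(\<integral>x. indicator {x \<in> ?\<Omega>. Q x} x * f x \<partial>\<mu>) = 0"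
    if "finite M" "M \<subseteq> carrier G - {\<gamma>}" "local_on M Q" for Q M
  proof -
    have "(\<integral>x. indicator {x \<in> ?\<Omega>. Q x} x * f x \<partial>\<mu>) = (\<integral>x. of_bool (Q x) * f x \<partial>\<mu>)"
      by (intro Bochner_Integration.integral_cong refl) (simp add: \<Omega>)
    with zero[OF that] show ?thesis by simp
  qed
  have top: "(\<integral>x. indicator ?\<Omega> x * f x \<partial>\<mu>) = 0"
    using loc[of "{}" "\<lambda>_. True"] by (simp add: local_on_def)
  show ?thesis
  proof (rule sigma_sets_induct_disjoint[of ?L ?\<Omega> A])
    show "Int_stable ?L"
    proof (rule Int_stableI)
      fix a b assume "a \<in> ?L" "b \<in> ?L"
      then obtain Q M Q' M' where a: "a = {x \<in> ?\<Omega>. Q x}" "finite M" "M \<subseteq> carrier G - {\<gamma>}" "local_on M Q"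
        and b: "b = {x \<in> ?\<Omega>. Q' x}" "finite M'" "M' \<subseteq> carrier G - {\<gamma>}" "local_on M' Q'"
        by (elim local_setsE)
      have "local_on (M \<union> M') (\<lambda>x. Q x \<and> Q' x)"
        using local_onD[OF a(4)] local_onD[OF b(4)] by (intro local_onI arg_cong2[of _ _ _ _ "(\<and>)"]) blast+
      moreover have "a \<inter> b = {x \<in> ?\<Omega>. Q x \<and> Q' x}" using a b by auto
      ultimately show "a \<inter> b \<in> ?L" using a(2,3) b(2,3) by (auto intro: local_setsI[of "M \<union> M'"])
    qed
    show "?L \<subseteq> Pow ?\<Omega>" by (auto elim: local_setsE)
    show "A \<in> sigma_sets ?\<Omega> ?L" using A by (simp add: sets_other_coords)
    show "(\<integral>x. indicator A x * f x \<partial>\<mu>) = 0" if "A \<in> ?L" for A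
      using that by (elim local_setsE) (simp only: loc)
    show "(\<integral>x. indicator {} x * f x \<partial>\<mu>) = 0" by simp
  next
    fix A assume A: "A \<in> sigma_sets ?\<Omega> ?L" "(\<integral>x. indicator A x * f x \<partial>\<mu>) = 0"
    have "(\<integral>x. indicator (?\<Omega> - A) x * f x \<partial>\<mu>) = (\<integral>x. indicator ?\<Omega> x * f x - indicator A x * f x \<partial>\<mu>)"
      by (intro Bochner_Integration.integral_cong refl) (auto simp: \<Omega> indicator_def)
    also have "\<dots> = 0"
      using A top int[OF A(1)] int[OF sigma_sets_top] by simp
    finally show "(\<integral>x. indicator (?\<Omega> - A) x * f x \<partial>\<mu>) = 0" .
  next
    fix A :: "nat \<Rightarrow> ('g \<Rightarrow> 'a) set"
    assume A: "disjoint_family A" "range A \<subseteq> sigma_sets ?\<Omega> ?L"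
      "\<And>i. (\<integral>x. indicator (A i) x * f x \<partial>\<mu>) = 0"
    have m: "A i \<in> sets \<mu>" for i using A(2) sub by blast
    have "(\<integral>x\<in>(\<Union>i. A i). f x \<partial>\<mu>) = (\<Sum>i. (\<integral>x\<in>(A i). f x \<partial>\<mu>))"
    proof (rule lebesgue_integral_countable_add[OF m])
      show "A i \<inter> A j = {}" if "i \<noteq> j" for i j
        using A(1) that by (simp add: disjoint_family_on_def)
      have "(\<Union>i. A i) \<in> sets \<mu>" using m by blast
      then show "set_integrable \<mu> (\<Union>i. A i) f"
        unfolding set_integrable_def by (rule integrable_mult_indicator[OF _ f])
    qed
    then show "(\<integral>x. indicator (\<Union>(range A)) x * f x \<partial>\<mu>) = 0"
      using A(3) by (simp add: set_lebesgue_integral_def)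
  qed
qed

text \<open>It suffices to test cylinder events off \<open>\<gamma>\<close>, and each splits into
  finitely many patterns large enough to contain the neighborhood of \<open>\<gamma>\<close>; on one
  pattern the Glauber rate is the constant \<open>pattern_rate\<close>. Read contrapositively, a
  measure that is not Gibbs yields the pattern to be resampled.\<close>

lemma (in group) gibbs_measureI:
  fixes \<mu> :: "('a \<Rightarrow> 'c::finite) measure"
  assumes s: "s ` {1..r} \<subseteq> carrier G" and \<mu>: "\<mu> \<in> config_prob G"
    and pattern: "\<And>\<gamma> F y a. \<gamma> \<in> carrier G \<Longrightarrow> finite F \<Longrightarrow> F \<subseteq> carrier G \<Longrightarrow> \<one> \<notin> F \<Longrightarrow>
      neighborhood G r s \<subseteq> F \<Longrightarrow>
      (\<integral>x. of_bool (\<forall>\<kappa>\<in>F. x (\<kappa> \<otimes> \<gamma>) = y \<kappa>) * (of_bool (x \<gamma> = a) - pattern_rate G r s h J y a) \<partial>\<mu>) = 0"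
  shows "gibbs_measure G r s h J \<mu>"
  unfolding gibbs_measure_def
proof (intro conjI ballI allI)
  fix \<gamma> :: 'a and a :: 'c assume \<gamma>: "\<gamma> \<in> carrier G"
  interpret \<mu>: prob_space \<mu> by (rule config_prob_prob_space[OF \<mu>])
  let ?N = "(\<lambda>\<kappa>. \<kappa> \<otimes> \<gamma>) ` neighborhood G r s"
  let ?c = "\<lambda>x. glauber_rate G r s h J \<gamma> x a"
  let ?I = "indicator {x \<in> space \<mu>. x \<gamma> = a} :: _ \<Rightarrow> real"
  note N = neighborhood_closed[OF s]
  have fin: "finite ?N" by (simp add: finite_neighborhood)
  have N\<gamma>: "?N \<subseteq> carrier G - {\<gamma>}"
  proof
    fix \<beta> assume "\<beta> \<in> ?N"
    then obtain \<kappa> where "\<beta> = \<kappa> \<otimes> \<gamma>" "\<kappa> \<in> carrier G" "\<kappa> \<noteq> \<one>"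
      using N by (auto simp: neighborhood_def)
    then show "\<beta> \<in> carrier G - {\<gamma>}" using \<gamma> by simp
  qed
  note locc = local_on_glauber_rate[OF s \<gamma>, of h J a]
  show meas: "?c \<in> borel_measurable (other_coords G \<gamma>)"
    using measurable_compose[OF measurable_other_coords_local[OF fin N\<gamma> locc], of "\<lambda>x. x"] by simp
  have sub: "subalgebra \<mu> (other_coords G \<gamma>)" by (rule subalgebra_other_coords[OF \<mu>])
  interpret finite_measure_subalgebra \<mu> "other_coords G \<gamma>"
    by unfold_locales (rule sub)
  have int_c: "integrable \<mu> ?c"
    using N\<gamma> by (intro integrable_local[OF \<mu> fin _ locc]) blast
  have "local_on {\<gamma>} (\<lambda>x. of_bool (x \<gamma> = a) :: real)" by (rule local_onI) simp
  then have "integrable \<mu> (\<lambda>x. of_bool (x \<gamma> = a) :: real)"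
    using \<gamma> by (intro integrable_local[OF \<mu>, of "{\<gamma>}"]) auto
  moreover have I: "?I x = of_bool (x \<gamma> = a)" if "x \<in> space \<mu>" for x
    using that by simp
  ultimately have int_I: "integrable \<mu> ?I"
    by (simp cong: Bochner_Integration.integrable_cong)
  have int_d: "integrable \<mu> (\<lambda>x. ?I x - ?c x)" using int_I int_c by simp
  have zero: "(\<integral>x. of_bool (Q x) * (?I x - ?c x) \<partial>\<mu>) = 0"
    if M: "finite M" "M \<subseteq> carrier G - {\<gamma>}" "local_on M Q" for Q M
  proof -
    \<comment> \<open>The support of \<open>Q\<close> moved to the identity, enlarged by the
      neighborhood so that the pattern determines the rate.\<close>
    define F where "F = (\<lambda>\<beta>. \<beta> \<otimes> inv \<gamma>) ` M \<union> neighborhood G r s"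
    have F: "finite F" "F \<subseteq> carrier G" "neighborhood G r s \<subseteq> F"
      using M N \<gamma> by (auto simp: F_def finite_neighborhood)
    have "\<beta> \<otimes> inv \<gamma> \<noteq> \<one>" if "\<beta> \<in> M" for \<beta>
      using M(2) that \<gamma> by (metis DiffE inv_equality inv_inv inv_closed singletonI subsetD)
    then have "\<one> \<notin> (\<lambda>\<beta>. \<beta> \<otimes> inv \<gamma>) ` M"
      by (metis imageE)
    then have F1: "\<one> \<notin> F"
      by (auto simp: F_def neighborhood_def)
    let ?m = "\<lambda>y x. \<forall>\<kappa>\<in>F. x (\<kappa> \<otimes> \<gamma>) = y \<kappa>"
    let ?Y = "F \<rightarrow>\<^sub>E (UNIV :: 'c set)"
    have Y: "finite ?Y" using F(1) by (intro finite_PiE) auto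
    define T where "T y x = of_bool (?m y x) * (of_bool (x \<gamma> = a) - pattern_rate G r s h J y a)" for y x
    have M_F: "\<beta> \<otimes> inv \<gamma> \<in> F" "(\<beta> \<otimes> inv \<gamma>) \<otimes> \<gamma> = \<beta>" if "\<beta> \<in> M" for \<beta>
      using that M(2) \<gamma> by (auto simp: F_def m_assoc subset_iff)
    \<comment> \<open>Reads a pattern based at the identity as a configuration around
      \<open>\<gamma>\<close>, where \<open>Q\<close> can be evaluated.\<close>
    define lift where "lift y \<beta> = y (\<beta> \<otimes> inv \<gamma>)" for y :: "'a \<Rightarrow> 'c" and \<beta>
    have expand: "of_bool (Q x) * (?I x - ?c x) = (\<Sum>y\<in>?Y. of_bool (Q (lift y)) * T y x)"
      if x: "x \<in> space \<mu>" for x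
    proof -
      let ?y = "\<lambda>\<kappa>\<in>F. x (\<kappa> \<otimes> \<gamma>)"
      have m: "?m y x \<longleftrightarrow> y = ?y" if "y \<in> ?Y" for y
        using that by (auto simp: PiE_iff extensional_def fun_eq_iff)
      have "(\<Sum>y\<in>?Y. of_bool (Q (lift y)) * T y x) =
          (\<Sum>y\<in>?Y. if y = ?y then of_bool (Q (lift y)) * (of_bool (x \<gamma> = a) - pattern_rate G r s h J y a) else 0)"
        by (intro sum.cong refl) (simp add: T_def m del: restrict_apply)
      also have "\<dots> = of_bool (Q (lift ?y)) * (of_bool (x \<gamma> = a) - pattern_rate G r s h J ?y a)"
        using Y by (subst sum.delta) auto
      also have "pattern_rate G r s h J ?y a = ?c x"
        using F(3) by (intro glauber_rate_pattern[OF s \<gamma>, symmetric]) auto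
      also have "Q (lift ?y) = Q x"
        by (rule local_onD[OF M(3)]) (simp add: lift_def M_F)
      finally show ?thesis by (simp add: I x)
    qed
    have intT: "integrable \<mu> (T y)" for y
    proof (rule integrable_local[OF \<mu>])
      show "finite (insert \<gamma> ((\<lambda>\<kappa>. \<kappa> \<otimes> \<gamma>) ` F))" "insert \<gamma> ((\<lambda>\<kappa>. \<kappa> \<otimes> \<gamma>) ` F) \<subseteq> carrier G"
        using F \<gamma> by auto
      show "local_on (insert \<gamma> ((\<lambda>\<kappa>. \<kappa> \<otimes> \<gamma>) ` F)) (T y)"
        by (rule local_onI) (simp add: T_def)
    qed
    have "(\<integral>x. of_bool (Q x) * (?I x - ?c x) \<partial>\<mu>) = (\<integral>x. (\<Sum>y\<in>?Y. of_bool (Q (lift y)) * T y x) \<partial>\<mu>)"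
      by (intro Bochner_Integration.integral_cong refl expand)
    also have "\<dots> = (\<Sum>y\<in>?Y. of_bool (Q (lift y)) * (\<integral>x. T y x \<partial>\<mu>))"
      using intT by (subst Bochner_Integration.integral_sum) auto
    also have "\<dots> = 0"
      using pattern[OF \<gamma> F(1,2) F1 F(3)] unfolding T_def by simp
    finally show ?thesis .
  qed
  show "AE x in \<mu>. real_cond_exp \<mu> (other_coords G \<gamma>) ?I x = ?c x"
  proof (rule real_cond_exp_charact[OF _ int_I int_c meas])
    fix A :: "('a \<Rightarrow> 'c) set" assume A: "A \<in> sets (other_coords G \<gamma>)"
    then have A': "A \<in> sets \<mu>" using sub by (auto simp: subalgebra_def)
    have "(\<integral>x. indicator A x * (?I x - ?c x) \<partial>\<mu>) = 0"
      by (rule integral_zero_other_coords[OF \<mu> int_d zero A])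
    moreover have "integrable \<mu> (\<lambda>x. indicator A x * ?I x)" "integrable \<mu> (\<lambda>x. indicator A x * ?c x)"
      using integrable_mult_indicator[OF A' int_I] integrable_mult_indicator[OF A' int_c] by simp_all
    ultimately show "(\<integral>x\<in>A. ?I x \<partial>\<mu>) = (\<integral>x\<in>A. ?c x \<partial>\<mu>)"
      by (simp add: set_lebesgue_integral_def right_diff_distrib)
  qed
qed (rule \<mu>)

section \<open>Resampling on a finite model\<close>

text \<open>The integral of \<open>f\<close> against the empirical distribution of \<open>x\<close>,
  as a plain finite average.\<close>

definition site_mean ::
    "('g, 'm) monoid_scheme \<Rightarrow> 'v set \<Rightarrow> ('g \<Rightarrow> 'v \<Rightarrow> 'v) \<Rightarrow> (('g \<Rightarrow> 'a) \<Rightarrow> real) \<Rightarrow> ('v \<Rightarrow> 'a) \<Rightarrow> real" where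
  "site_mean G V \<sigma> f x = (\<Sum>v\<in>V. f (pullback_name G \<sigma> x v)) / real (card V)"

definition model_labels :: "'v set \<Rightarrow> 'a pmf \<Rightarrow> ('v \<Rightarrow> bool \<times> 'a::finite) pmf" where
  "model_labels V q = Pi_pmf V undefined (\<lambda>_. label_pmf q)"

definition resampled_pmf ::
    "('g \<Rightarrow> 'v \<Rightarrow> 'v) \<Rightarrow> 'v set \<Rightarrow> 'g set \<Rightarrow> ('g \<Rightarrow> 'a) \<Rightarrow> 'a pmf \<Rightarrow> ('v \<Rightarrow> 'a::finite) pmf \<Rightarrow> ('v \<Rightarrow> 'a) pmf" where
  "resampled_pmf \<sigma> V F y q \<zeta> = \<zeta> \<bind> (\<lambda>x. map_pmf (\<lambda>l. resample \<sigma> V F y l x) (model_labels V q))"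

section \<open>Empirical distributions before and after resampling\<close>

lemma finite_set_Pi_pmf:
  fixes p :: "'v \<Rightarrow> 'c::finite pmf"
  assumes "finite V"
  shows "finite (set_pmf (Pi_pmf V d p))"
  using assms by (subst set_Pi_pmf) auto

lemma empirical_properties:
  fixes x :: "'v \<Rightarrow> 'a::finite"
  assumes "finite V" "V \<noteq> {}"
  shows "prob_space (empirical G V \<sigma> x)" "sets (empirical G V \<sigma> x) = sets (config_space G)"
    "\<And>f :: _ \<Rightarrow> real. f \<in> borel_measurable (config_space G) \<Longrightarrow> (\<integral>z. f z \<partial>empirical G V \<sigma> x) = site_mean G V \<sigma> f x"
proof -
  have meas: "pullback_name G \<sigma> x \<in> measurable (uniform_count_measure V) (config_space G)"
    by (simp add: uniform_count_measure_def space_config_space pullback_name_def)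
  interpret prob_space "uniform_count_measure V"
    by (rule prob_space_uniform_count_measure[OF assms])
  show "prob_space (empirical G V \<sigma> x)"
    unfolding empirical_def by (rule prob_space_distr[OF meas])
  show "sets (empirical G V \<sigma> x) = sets (config_space G)"
    by (simp add: empirical_def)
  show "(\<integral>z. f z \<partial>empirical G V \<sigma> x) = site_mean G V \<sigma> f x"
    if "f \<in> borel_measurable (config_space G)" for f :: "_ \<Rightarrow> real"
    unfolding empirical_def using that assms(1)
    by (subst integral_distr[OF meas]) (auto simp: site_mean_def integral_uniform_count_measure)
qed

lemma measurable_empirical:
  assumes "finite V" "V \<noteq> {}"
  shows "empirical G V \<sigma> \<in> measurable (measure_pmf \<zeta>) (subprob_algebra (config_space G))"
  by (simp add: space_subprob_algebra empirical_properties(2)[OF assms]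
      prob_space_imp_subprob_space[OF empirical_properties(1)[OF assms]])

lemma mean_empirical_config_prob:
  assumes "finite V" "V \<noteq> {}"
  shows "mean_empirical G V \<sigma> \<zeta> \<in> config_prob G"
proof -
  have "prob_space (mean_empirical G V \<sigma> \<zeta>)"
    unfolding mean_empirical_def
    by (rule measure_pmf.prob_space_bind[OF _ measurable_empirical[OF assms]])
      (simp add: empirical_properties[OF assms])
  moreover have "sets (mean_empirical G V \<sigma> \<zeta>) = sets (config_space G)"
    unfolding mean_empirical_def
    by (rule sets_bind) (simp_all add: empirical_properties[OF assms])
  ultimately show ?thesis by (simp add: config_prob_def)
qed

lemma integral_mean_empirical:
  fixes f :: "('g \<Rightarrow> 'a::finite) \<Rightarrow> real"
  assumes "finite V" "V \<noteq> {}" and f: "finite M" "M \<subseteq> carrier G" "local_on M f"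
  shows "(\<integral>z. f z \<partial>mean_empirical G V \<sigma> \<zeta>) = measure_pmf.expectation \<zeta> (site_mean G V \<sigma> f)"
proof -
  obtain B where B: "\<And>x. \<bar>f x\<bar> \<le> B" using local_on_bounded[OF f(1,3)] by metis
  have "(\<integral>z. f z \<partial>mean_empirical G V \<sigma> \<zeta>) = (\<integral>x. (\<integral>z. f z \<partial>empirical G V \<sigma> x) \<partial>measure_pmf \<zeta>)"
    unfolding mean_empirical_def
  proof (rule integral_bind[where B = B and B' = 1])
    show "f \<in> borel_measurable (config_space G)" by (rule borel_measurable_local[OF f])
    show "empirical G V \<sigma> \<in> measurable (measure_pmf \<zeta>) (subprob_algebra (config_space G))"
      by (rule measurable_empirical[OF assms(1,2)])
    show "AE x in measure_pmf \<zeta>. emeasure (empirical G V \<sigma> x) (space (empirical G V \<sigma> x)) \<le> ennreal 1"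
      by (simp add: prob_space.emeasure_space_1[OF empirical_properties(1)[OF assms(1,2)]])
  qed (use B in \<open>auto intro: measure_pmf.finite_measure_axioms\<close>)
  then show ?thesis
    using empirical_properties(3)[OF assms(1,2) borel_measurable_local[OF f]] by simp
qed

text \<open>An update at \<open>\<sigma> \<gamma> v\<close> consults \<open>\<sigma> \<kappa>
  (\<sigma> \<gamma> v) = \<sigma> (\<kappa> \<otimes> \<gamma>) v\<close>, the site that the
  pulled-back rule consults at \<open>\<gamma>\<close>. The identity is exact at every vertex; a
  collision spoils only the independence of the pulled-back labels.\<close>

lemma (in finite_action) pullback_resample:
  assumes F: "F \<subseteq> carrier G" and v: "v \<in> V"
  shows "pullback_name G \<sigma> (resample \<sigma> V F y l x) v =
    resample (\<lambda>\<kappa> \<gamma>. \<kappa> \<otimes> \<gamma>) (carrier G) F y (pullback_name G \<sigma> l v) (pullback_name G \<sigma> x v)"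
proof
  fix \<gamma>
  show "pullback_name G \<sigma> (resample \<sigma> V F y l x) v \<gamma> =
    resample (\<lambda>\<kappa> \<gamma>. \<kappa> \<otimes> \<gamma>) (carrier G) F y (pullback_name G \<sigma> l v) (pullback_name G \<sigma> x v) \<gamma>"
  proof (cases "\<gamma> \<in> carrier G")
    case True
    have c: "\<kappa> \<in> carrier G" if "\<kappa> \<in> F" for \<kappa> using F that by blast
    have "updates \<sigma> F y (\<lambda>p. fst (l p)) x (\<sigma> \<gamma> v) \<longleftrightarrow>
      updates (\<lambda>\<kappa> \<gamma>. \<kappa> \<otimes> \<gamma>) F y (\<lambda>p. fst (pullback_name G \<sigma> l v p)) (pullback_name G \<sigma> x v) \<gamma>"
      unfolding updates_def pullback_name_def
      using True c v by (simp add: action_mult cong: ball_cong)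
    then show ?thesis
      using True v by (simp add: resample_def pullback_name_def action_closed)
  qed (simp add: resample_def pullback_name_def)
qed

text \<open>At a vertex without collision in the window, the pulled-back labels have the law of the
  group labels there, and the two means agree. At any other vertex both are bounded by
  \<open>B\<close>, whence the error \<open>2 * B\<close>.\<close>

lemma (in finite_action) expectation_site_mean_resampled_pmf:
  fixes f :: "('g \<Rightarrow> 'a::finite) \<Rightarrow> real"
  assumes F: "finite F" "F \<subseteq> carrier G" and f: "finite M" "M \<subseteq> carrier G" "local_on M f"
    and B: "\<And>x. \<bar>f x\<bar> \<le> B" and \<zeta>: "\<zeta> \<in> finite_config_prob V"
  shows "\<bar>measure_pmf.expectation (resampled_pmf \<sigma> V F y q \<zeta>) (site_mean G V \<sigma> f)
      - measure_pmf.expectation \<zeta> (site_mean G V \<sigma> (resampled_mean G F y q f))\<bar>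
    \<le> 2 * B * (real (card (collisions (window G F M))) / real (card V))"
proof -
  let ?W = "window G F M" and ?T = "resampled_mean G F y q f"
  let ?L = "model_labels V q"
  let ?r = "\<lambda>x l. resample (\<lambda>\<kappa> \<gamma>. \<kappa> \<otimes> \<gamma>) (carrier G) F y l x"
  have W: "finite ?W" "?W \<subseteq> carrier G"
    using F f(1,2) by auto
  have finL: "finite (set_pmf ?L)"
    unfolding model_labels_def by (rule finite_set_Pi_pmf[OF finite_V])
  have fin\<zeta>: "finite (set_pmf \<zeta>)"
    by (rule finite_support_finite_config_prob[OF \<zeta> finite_V])
  interpret L: prob_space "group_labels G q" by (rule prob_space_group_labels)
  have bound_E: "\<bar>measure_pmf.expectation ?L (\<lambda>l. f (k l))\<bar> \<le> B" for k :: "_ \<Rightarrow> 'g \<Rightarrow> 'a"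
  proof -
    have "\<bar>measure_pmf.expectation ?L (\<lambda>l. f (k l))\<bar> \<le> measure_pmf.expectation ?L (\<lambda>l. \<bar>f (k l)\<bar>)"
      by (rule integral_abs_bound)
    also have "\<dots> \<le> measure_pmf.expectation ?L (\<lambda>l. B)"
      using finL B by (intro integral_mono integrable_measure_pmf_finite) auto
    finally show ?thesis by simp
  qed
  have loc: "local_on ?W (\<lambda>l. f (?r z l))" for z
    by (rule local_on_resample_labels[OF f(3,2)])
  have bound_T: "\<bar>?T z\<bar> \<le> B" for z
  proof -
    have "?T z = (\<Sum>w\<in>?W \<rightarrow>\<^sub>E UNIV. f (?r z w) * (\<Prod>\<gamma>\<in>?W. pmf (label_pmf q) (w \<gamma>)))"
      unfolding resampled_mean_def group_labels_def by (rule integral_PiM_local[OF W(1) loc W(2)])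
    also have "\<bar>\<dots>\<bar> \<le> (\<Sum>w\<in>?W \<rightarrow>\<^sub>E UNIV. B * (\<Prod>\<gamma>\<in>?W. pmf (label_pmf q) (w \<gamma>)))"
      using B by (intro order_trans[OF sum_abs] sum_mono) (simp add: abs_mult abs_of_nonneg prod_nonneg mult_right_mono)
    \<comment> \<open>The weights sum to one, being the label law tested on a constant.\<close>
    also have "\<dots> = (\<integral>l. B \<partial>PiM (carrier G) (\<lambda>_. measure_pmf (label_pmf q)))"
      by (rule integral_PiM_local[OF W(1) _ W(2), symmetric]) (simp add: local_on_def)
    also have "\<dots> = B"
      using L.prob_space by (simp add: group_labels_def)
    finally show ?thesis .
  qed
  have site: "\<bar>measure_pmf.expectation ?L (\<lambda>l. f (pullback_name G \<sigma> (resample \<sigma> V F y l x) v)) - ?T (pullback_name G \<sigma> x v)\<bar>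
      \<le> (if v \<in> collisions ?W then 2 * B else 0)" if v: "v \<in> V" for x v
  proof (cases "v \<in> collisions ?W")
    case True
    then show ?thesis
      using bound_E[of "\<lambda>l. pullback_name G \<sigma> (resample \<sigma> V F y l x) v"] bound_T[of "pullback_name G \<sigma> x v"]
      by (simp only: if_True)
  next
    case False
    let ?z = "pullback_name G \<sigma> x v"
    have "f (pullback_name G \<sigma> (resample \<sigma> V F y l x) v) = f (?r ?z (\<lambda>\<gamma>. l (\<sigma> \<gamma> v)))" for l
      unfolding pullback_resample[OF F(2) v]
      using W(2) by (intro local_onD[OF loc]) (auto simp: pullback_name_def)
    then have "measure_pmf.expectation ?L (\<lambda>l. f (pullback_name G \<sigma> (resample \<sigma> V F y l x) v)) =
        measure_pmf.expectation ?L (\<lambda>l. f (?r ?z (\<lambda>\<gamma>. l (\<sigma> \<gamma> v))))"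
      by simp
    also have "\<dots> = (\<Sum>w\<in>?W \<rightarrow>\<^sub>E UNIV. f (?r ?z w) * (\<Prod>\<gamma>\<in>?W. pmf (label_pmf q) (w \<gamma>)))"
      unfolding model_labels_def
    proof (rule expectation_Pi_pmf_local[OF finite_V W(1) loc])
      show "inj_on (\<lambda>\<gamma>. \<sigma> \<gamma> v) ?W" using False v by (simp add: collisions_def)
      show "(\<lambda>\<gamma>. \<sigma> \<gamma> v) ` ?W \<subseteq> V" using W(2) v action_closed by blast
    qed
    also have "\<dots> = ?T ?z"
      unfolding resampled_mean_def group_labels_def by (rule integral_PiM_local[OF W(1) loc W(2), symmetric])
    finally show ?thesis using False by simp
  qed
  let ?S = "\<lambda>x. measure_pmf.expectation ?L (\<lambda>l. site_mean G V \<sigma> f (resample \<sigma> V F y l x))"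
  have S: "?S x = (\<Sum>v\<in>V. measure_pmf.expectation ?L (\<lambda>l. f (pullback_name G \<sigma> (resample \<sigma> V F y l x) v))) / real (card V)"
    for x
    unfolding site_mean_def integral_divide_zero
    by (intro arg_cong2[of _ _ _ _ "(/)"] refl Bochner_Integration.integral_sum integrable_measure_pmf_finite finL)
  have diff: "\<bar>?S x - site_mean G V \<sigma> ?T x\<bar> \<le> 2 * B * (real (card (collisions ?W)) / real (card V))" for x
  proof -
    have "?S x - site_mean G V \<sigma> ?T x =
        (\<Sum>v\<in>V. measure_pmf.expectation ?L (\<lambda>l. f (pullback_name G \<sigma> (resample \<sigma> V F y l x) v)) - ?T (pullback_name G \<sigma> x v)) / real (card V)"
      unfolding S unfolding site_mean_def by (simp add: sum_subtractf diff_divide_distrib)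
    also have "\<bar>\<dots>\<bar> \<le> (\<Sum>v\<in>V. if v \<in> collisions ?W then 2 * B else 0) / real (card V)"
      using site by (simp add: abs_divide) (intro divide_right_mono order_trans[OF sum_abs] sum_mono; simp)
    also have "(\<Sum>v\<in>V. if v \<in> collisions ?W then 2 * B else 0) = 2 * B * real (card (collisions ?W))"
      using finite_V collisions_subset[of ?W] by (simp add: sum.If_cases Int_absorb1)
    finally show ?thesis by simp
  qed
  have "measure_pmf.expectation (resampled_pmf \<sigma> V F y q \<zeta>) (site_mean G V \<sigma> f) = measure_pmf.expectation \<zeta> ?S"
    unfolding resampled_pmf_def using fin\<zeta> finL by (subst expectation_bind_pmf) auto
  then have "\<bar>measure_pmf.expectation (resampled_pmf \<sigma> V F y q \<zeta>) (site_mean G V \<sigma> f)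
      - measure_pmf.expectation \<zeta> (site_mean G V \<sigma> ?T)\<bar> = \<bar>measure_pmf.expectation \<zeta> (\<lambda>x. ?S x - site_mean G V \<sigma> ?T x)\<bar>"
    using fin\<zeta> by (simp add: integrable_measure_pmf_finite)
  also have "\<dots> \<le> measure_pmf.expectation \<zeta> (\<lambda>x. \<bar>?S x - site_mean G V \<sigma> ?T x\<bar>)"
    by (rule integral_abs_bound)
  also have "\<dots> \<le> measure_pmf.expectation \<zeta> (\<lambda>x. 2 * B * (real (card (collisions ?W)) / real (card V)))"
    using fin\<zeta> diff by (intro integral_mono integrable_measure_pmf_finite) auto
  finally show ?thesis by simp
qed

section \<open>Free energy drop on a finite model\<close>

text \<open>Draws the coins first and the letters afterwards, so that the free energy estimate can
  be made for fixed coins.\<close>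

lemma model_labels_eq_bind:
  assumes "finite V"
  shows "model_labels V q = Pi_pmf V False (\<lambda>_. bernoulli_pmf (1 / 2)) \<bind>
    (\<lambda>b. Pi_pmf V undefined (\<lambda>v. map_pmf (Pair (b v)) q))"
proof -
  have "label_pmf q = bernoulli_pmf (1 / 2) \<bind> (\<lambda>b. map_pmf (Pair b) q)"
    by (simp add: label_pmf_def pair_pmf_def map_pmf_def)
  then show ?thesis
    unfolding model_labels_def using Pi_pmf_bind[OF assms] by simp
qed

context finite_action
begin

definition updated :: "'g set \<Rightarrow> ('g \<Rightarrow> 'a) \<Rightarrow> ('v \<Rightarrow> bool) \<Rightarrow> ('v \<Rightarrow> 'a) \<Rightarrow> 'v set" where
  "updated F y b x = {v \<in> V. updates \<sigma> F y b x v}"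

text \<open>A consulted coin that is up forbids the update whatever the letters are; a consulted
  site with coin down is never redrawn. Hence changing letters on updated sites changes no
  decision.\<close>

lemma block_resampling_updated:
  fixes y :: "'g \<Rightarrow> 'a::finite"
  assumes F: "F \<subseteq> carrier G"
  shows "block_resampling V (updated F y b)"
proof
  show "finite V" by (rule finite_V)
  show "updated F y b x \<subseteq> V" for x by (auto simp: updated_def)
  fix x z :: "'v \<Rightarrow> 'a"
  assume eq: "\<And>v. v \<in> V - updated F y b x \<Longrightarrow> z v = x v"
  have "updates \<sigma> F y b z v \<longleftrightarrow> updates \<sigma> F y b x v" if v: "v \<in> V" for v
  proof -
    have "z (\<sigma> \<kappa> v) = x (\<sigma> \<kappa> v)" if "\<kappa> \<in> F" "\<not> b (\<sigma> \<kappa> v)" for \<kappa>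
      using that F v by (intro eq) (auto simp: updated_def updates_def action_closed subset_iff)
    then show ?thesis unfolding updates_def by auto
  qed
  then show "updated F y b z = updated F y b x" by (auto simp: updated_def)
qed

text \<open>For fixed coins, discarding the letters at sites that are not updated leaves exactly the
  product law of \<open>kernel\<close>. The coins are independent of the configuration, so the two
  draws may be exchanged.\<close>

lemma resampled_pmf_eq_bind:
  assumes F: "F \<subseteq> carrier G"
  shows "resampled_pmf \<sigma> V F y q \<zeta> = Pi_pmf V False (\<lambda>_. bernoulli_pmf (1 / 2)) \<bind>
    (\<lambda>b. \<zeta> \<bind> block_resampling.kernel V (updated F y b) q)"
proof -
  have c: "\<sigma> \<kappa> v \<in> V" if "\<kappa> \<in> F" "v \<in> V" for \<kappa> v
    using F that action_closed by blast
  have "map_pmf (\<lambda>l. resample \<sigma> V F y l x) (Pi_pmf V undefined (\<lambda>v. map_pmf (Pair (b v)) q)) =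
      block_resampling.kernel V (updated F y b) q x" (is "?L = ?R") for x b
  proof -
    let ?upd = "\<lambda>v. updates \<sigma> F y b x v"
    have "?L = Pi_pmf V undefined (\<lambda>v. map_pmf (Pair (b v)) q) \<bind>
        (\<lambda>l. return_pmf (\<lambda>v. if v \<in> V then if ?upd v then snd (l v) else x v else undefined))"
      unfolding map_pmf_def[of "\<lambda>l. resample \<sigma> V F y l x"]
    proof (intro bind_pmf_cong refl arg_cong[of _ _ return_pmf])
      fix l assume "l \<in> set_pmf (Pi_pmf V undefined (\<lambda>v. map_pmf (Pair (b v)) q))"
      then have "l v \<in> (set_pmf \<circ> (\<lambda>v. map_pmf (Pair (b v)) q)) v" if "v \<in> V" for v
        using that unfolding set_Pi_pmf[OF finite_V] PiE_dflt_def by blast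
      then have "fst (l v) = b v" if "v \<in> V" for v
        using that by fastforce
      then have "updates \<sigma> F y (\<lambda>p. fst (l p)) x v \<longleftrightarrow> ?upd v" if "v \<in> V" for v
        using that c unfolding updates_def by simp
      then show "resample \<sigma> V F y l x = (\<lambda>v. if v \<in> V then if ?upd v then snd (l v) else x v else undefined)"
        by (auto simp: resample_def fun_eq_iff)
    qed
    also have "\<dots> = Pi_pmf V undefined (\<lambda>v. map_pmf (Pair (b v)) q \<bind> (\<lambda>c. return_pmf (if ?upd v then snd c else x v)))"
      using finite_V by (subst Pi_pmf_bind[where d' = undefined]) simp_all
    also have "(\<lambda>v. map_pmf (Pair (b v)) q \<bind> (\<lambda>c. return_pmf (if ?upd v then snd c else x v))) =
        (\<lambda>v. if ?upd v then q else return_pmf (x v))"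
      by (auto simp: fun_eq_iff bind_map_pmf bind_return_pmf')
    also have "Pi_pmf V undefined \<dots> = ?R"
      unfolding block_resampling.kernel_def[OF block_resampling_updated[OF F]]
      by (intro Pi_pmf_cong finite_V refl) (simp add: updated_def)
    finally show ?thesis .
  qed
  then have "resampled_pmf \<sigma> V F y q \<zeta> = \<zeta> \<bind> (\<lambda>x. Pi_pmf V False (\<lambda>_. bernoulli_pmf (1 / 2)) \<bind>
      (\<lambda>b. block_resampling.kernel V (updated F y b) q x))"
    unfolding resampled_pmf_def model_labels_eq_bind[OF finite_V] by (simp add: map_bind_pmf)
  then show ?thesis
    by (subst bind_commute_pmf) simp
qed

text \<open>Every edge at an updated site is either the loop of a trivial generator or leads to a
  site carrying a prescribed letter of \<open>y\<close>, and no other edge is affected by redrawing.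
  Symmetry of \<open>J\<close> lets incoming edges be counted like outgoing ones.\<close>

lemma energy_updated:
  fixes y :: "'g \<Rightarrow> 'a::finite"
  assumes F: "F \<subseteq> carrier G" "neighborhood G r s \<subseteq> F" and J: "\<And>a c. J a c = J c a"
    and block: "z \<in> V \<rightarrow>\<^sub>E UNIV" "\<And>v. v \<in> V - updated F y b x \<Longrightarrow> z v = x v"
    and eq: "updated F y b z = updated F y b x"
  shows "energy r s h J V \<sigma> z - (\<Sum>v\<in>updated F y b z. pattern_energy G r s h J y (z v)) =
    energy r s h J V \<sigma> x - (\<Sum>v\<in>updated F y b x. pattern_energy G r s h J y (x v))"
proof -
  \<comment> \<open>Share of generator \<open>i\<close> in the pattern energy: the outgoing and the
    incoming edge, or the loop counted once.\<close>
  define E where "E i a = (if s i = \<one> then J a a else J a (y (s i)) + J a (y (inv (s i))))" for i a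
  define N where "N = updated F y b x"
  \<comment> \<open>Sources of the \<open>i\<close>-labeled edges that end in
    \<open>N\<close>.\<close>
  define T where "T i = \<sigma> (inv (s i)) ` N" for i
  have N: "N \<subseteq> V" "finite N"
    using finite_V by (auto simp: N_def updated_def)
  have s: "s i \<in> carrier G" if "i \<in> {1..r}" for i using s_closed that .
  have nb: "s i \<in> F" "inv (s i) \<in> F" if "i \<in> {1..r}" "s i \<noteq> \<one>" for i
    using that F(2) s[OF that(1)] by (auto simp: neighborhood_def)
  have pe: "pattern_energy G r s h J y a = h a + (\<Sum>i\<in>{1..r}. E i a)" for a
  proof -
    have 1: "(y(\<one> := a)) (s i \<otimes> \<one>) = (if s i = \<one> then a else y (s i))" if "i \<in> {1..r}" for i
      using s[OF that] by simp
    have 2: "(y(\<one> := a)) (inv (s i) \<otimes> \<one>) = y (inv (s i))" if "i \<in> {1..r}" "s i \<noteq> \<one>" for i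
      using s[OF that(1)] that(2) by simp
    have "pattern_energy G r s h J y a = h a + (\<Sum>i\<in>{1..r}. J a (if s i = \<one> then a else y (s i)))
        + (\<Sum>i\<in>{i\<in>{1..r}. s i \<noteq> \<one>}. J a (y (inv (s i))))"
      unfolding pattern_energy_def local_energy_def fun_upd_same
      by (intro arg_cong2[of _ _ _ _ "(+)"] sum.cong refl arg_cong2[of _ _ _ _ J] 1 2) auto
    also have "(\<Sum>i\<in>{i\<in>{1..r}. s i \<noteq> \<one>}. J a (y (inv (s i)))) =
        (\<Sum>i\<in>{1..r}. if s i \<noteq> \<one> then J a (y (inv (s i))) else 0)"
      by (rule sum.inter_filter) simp
    finally show ?thesis
      unfolding add.assoc sum.distrib[symmetric]
      by (simp add: E_def if_distrib cong: if_cong sum.cong) (intro sum.cong refl; simp)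
  qed
  \<comment> \<open>Contribution of the \<open>i\<close>-labeled edges with no endpoint in
    \<open>N\<close>.\<close>
  define R where "R i x = (if s i = \<one> then \<Sum>v\<in>V - N. J (x v) (x v)
      else \<Sum>v\<in>V - N - T i. J (x v) (x (\<sigma> (s i) v)))" for i and x :: "'v \<Rightarrow> 'a"
  have edges: "(\<Sum>v\<in>V. J (x v) (x (\<sigma> (s i) v))) = (\<Sum>v\<in>N. E i (x v)) + R i x"
    if x: "updated F y b x = N" and i: "i \<in> {1..r}" for x i
  proof (cases "s i = \<one>")
    case True
    have "(\<Sum>v\<in>V. J (x v) (x (\<sigma> (s i) v))) = (\<Sum>v\<in>V. J (x v) (x v))"
      by (intro sum.cong refl) (simp add: True action_one)
    also have "\<dots> = (\<Sum>v\<in>V - N. J (x v) (x v)) + (\<Sum>v\<in>N. J (x v) (x v))"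
      by (rule sum.subset_diff[OF N(1) finite_V])
    finally show ?thesis using True by (simp add: E_def R_def)
  next
    case False
    note si = s[OF i] and sF = nb[OF i False]
    have up: "b v" "\<kappa> \<in> F \<Longrightarrow> \<not> b (\<sigma> \<kappa> v)" "\<kappa> \<in> F \<Longrightarrow> x (\<sigma> \<kappa> v) = y \<kappa>" if "v \<in> N" for v \<kappa>
      using that unfolding x[symmetric] by (auto simp: updated_def updates_def)
    have T: "T i \<subseteq> V" using N(1) si by (auto simp: T_def action_closed)
    have canc: "\<sigma> (s i) (\<sigma> (inv (s i)) w) = w" if "w \<in> N" for w
      using that N(1) si by (intro action_cancel_inv) auto
    \<comment> \<open>An edge with both ends in \<open>N\<close> would end at a site whose coin is
      up, while updating its source requires that coin to be down. This relies on the coins alone,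
      so it holds at collisions too and the energy identity has no error term.\<close>
    have disj: "T i \<subseteq> V - N"
    proof
      fix v assume "v \<in> T i"
      then obtain w where w: "w \<in> N" "v = \<sigma> (inv (s i)) w" by (auto simp: T_def)
      then have "b (\<sigma> (s i) v)" using canc up(1) by simp
      then have "v \<notin> N" using up(2)[OF _ sF(1)] by blast
      with \<open>v \<in> T i\<close> T show "v \<in> V - N" by blast
    qed
    have inj: "inj_on (\<sigma> (inv (s i))) N"
      using canc by (rule inj_on_inverseI)
    have "(\<Sum>v\<in>V. J (x v) (x (\<sigma> (s i) v))) =
        (\<Sum>v\<in>V - N. J (x v) (x (\<sigma> (s i) v))) + (\<Sum>v\<in>N. J (x v) (x (\<sigma> (s i) v)))"
      by (rule sum.subset_diff[OF N(1) finite_V])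
    also have "(\<Sum>v\<in>V - N. J (x v) (x (\<sigma> (s i) v))) =
        (\<Sum>v\<in>V - N - T i. J (x v) (x (\<sigma> (s i) v))) + (\<Sum>v\<in>T i. J (x v) (x (\<sigma> (s i) v)))"
      using finite_V by (intro sum.subset_diff[OF disj]) simp
    also have "(\<Sum>v\<in>T i. J (x v) (x (\<sigma> (s i) v))) = (\<Sum>w\<in>N. J (x w) (y (inv (s i))))"
      unfolding T_def sum.reindex[OF inj] using canc up(3) sF(2)
      by (intro sum.cong refl) (simp add: J[of "y (inv (s i))"])
    also have "(\<Sum>v\<in>N. J (x v) (x (\<sigma> (s i) v))) = (\<Sum>v\<in>N. J (x v) (y (s i)))"
      using up(3) sF(1) by (intro sum.cong refl) simp
    finally show ?thesis using False by (simp add: E_def R_def sum.distrib)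
  qed
  have split: "energy r s h J V \<sigma> x - (\<Sum>v\<in>N. pattern_energy G r s h J y (x v)) =
      (\<Sum>v\<in>V - N. h (x v)) + (\<Sum>i\<in>{1..r}. R i x)" if x: "updated F y b x = N" for x
  proof -
    have "energy r s h J V \<sigma> x = (\<Sum>v\<in>V. h (x v)) + (\<Sum>i\<in>{1..r}. \<Sum>v\<in>V. J (x v) (x (\<sigma> (s i) v)))"
      unfolding energy_def by (subst sum.swap) simp
    also have "\<dots> = ((\<Sum>v\<in>V - N. h (x v)) + (\<Sum>v\<in>N. h (x v))) + (\<Sum>i\<in>{1..r}. (\<Sum>v\<in>N. E i (x v)) + R i x)"
      using edges[OF x] sum.subset_diff[OF N(1) finite_V] by simp
    also have "\<dots> = (\<Sum>v\<in>V - N. h (x v)) + (\<Sum>i\<in>{1..r}. R i x)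
        + ((\<Sum>v\<in>N. h (x v)) + (\<Sum>v\<in>N. \<Sum>i\<in>{1..r}. E i (x v)))"
      using sum.swap[of "\<lambda>v i. E i (x v)" "{1..r}" N] by (simp add: sum.distrib)
    finally show ?thesis by (simp add: pe sum.distrib)
  qed
  have R_cong: "R i z = R i x" if i: "i \<in> {1..r}" for i
  proof (cases "s i = \<one>")
    case True
    then show ?thesis using block(2) by (simp add: R_def N_def)
  next
    case False
    have "\<sigma> (s i) v \<in> V - N" if v: "v \<in> V - N - T i" for v
    proof
      show "\<sigma> (s i) v \<in> V" using v s[OF i] action_closed by blast
      show "\<sigma> (s i) v \<notin> N"
      proof
        assume "\<sigma> (s i) v \<in> N"
        then have "\<sigma> (inv (s i)) (\<sigma> (s i) v) \<in> T i" by (simp add: T_def)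
        with v s[OF i] show False by (simp add: action_inv_cancel)
      qed
    qed
    then show ?thesis
      using False block(2) unfolding R_def N_def[symmetric]
      by (auto intro!: sum.cong arg_cong2[of _ _ _ _ J])
  qed
  have "(\<Sum>v\<in>V - N. h (z v)) = (\<Sum>v\<in>V - N. h (x v))"
    using block(2) by (simp add: N_def)
  then show ?thesis
    using split[of x] split[of z] eq R_cong by (simp add: N_def)
qed

definition free_energy :: "('a::finite \<Rightarrow> real) \<Rightarrow> ('a \<Rightarrow> 'a \<Rightarrow> real) \<Rightarrow> ('v \<Rightarrow> 'a) pmf \<Rightarrow> real" where
  "free_energy h J \<zeta> = measure_pmf.expectation \<zeta> (energy r s h J V \<sigma>) - shannon_entropy V \<zeta>"

text \<open>Each choice of coins is an instance of \<open>free_energy_bind_kernel\<close>, with the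
  block-invariant remainder provided by \<open>energy_updated\<close>. The gain is left as a mean
  over coins, to be estimated in \<open>expectation_updated_ge\<close>.\<close>

lemma free_energy_resampled_pmf:
  fixes y :: "'g \<Rightarrow> 'a::finite"
  assumes F: "F \<subseteq> carrier G" "neighborhood G r s \<subseteq> F" and J: "\<And>a c. J a c = J c a"
    and q: "\<And>a. pmf q a = pattern_rate G r s h J y a" and q': "\<And>a. 0 < pmf q' a"
    and \<zeta>: "\<zeta> \<in> finite_config_prob V"
  shows "resampled_pmf \<sigma> V F y q \<zeta> \<in> finite_config_prob V"
    and "free_energy h J (resampled_pmf \<sigma> V F y q \<zeta>) +
      measure_pmf.expectation (Pi_pmf V False (\<lambda>_. bernoulli_pmf (1 / 2))) (\<lambda>b.
        measure_pmf.expectation \<zeta> (\<lambda>x. \<Sum>v\<in>updated F y b x. ln (pmf q' (x v)) - ln (pmf q (x v))))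
      \<le> free_energy h J \<zeta>"
proof -
  let ?C = "Pi_pmf V False (\<lambda>_. bernoulli_pmf (1 / 2))"
  let ?K = "\<lambda>b. \<zeta> \<bind> block_resampling.kernel V (updated F y b) q"
  let ?D = "\<lambda>b. measure_pmf.expectation \<zeta> (\<lambda>x. \<Sum>v\<in>updated F y b x. ln (pmf q' (x v)) - ln (pmf q (x v)))"
  have finC: "finite (set_pmf ?C)"
    by (rule finite_set_Pi_pmf[OF finite_V])
  have K: "?K b \<in> finite_config_prob V" for b
    by (rule block_resampling.bind_kernel_finite_config_prob[OF block_resampling_updated[OF F(1)] \<zeta>])
  have eq: "resampled_pmf \<sigma> V F y q \<zeta> = ?C \<bind> ?K"
    by (rule resampled_pmf_eq_bind[OF F(1)])
  show "resampled_pmf \<sigma> V F y q \<zeta> \<in> finite_config_prob V"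
    unfolding eq using K by (auto simp: finite_config_prob_def)
  have drop: "free_energy h J (?K b) + ?D b \<le> free_energy h J \<zeta>" for b
    unfolding free_energy_def
  proof -
    interpret block_resampling V "updated F y b" by (rule block_resampling_updated[OF F(1)])
    let ?rest = "\<lambda>x. energy r s h J V \<sigma> x - (\<Sum>v\<in>updated F y b x. pattern_energy G r s h J y (x v))"
    have "measure_pmf.expectation (?K b) (energy r s h J V \<sigma>) - shannon_entropy V (?K b) + ?D b
        \<le> measure_pmf.expectation \<zeta> (energy r s h J V \<sigma>) - shannon_entropy V \<zeta>"
    proof (rule free_energy_bind_kernel[OF \<zeta>, where rest = ?rest and \<Phi> = "pattern_energy G r s h J y"
          and Z = "\<Sum>b\<in>UNIV. exp (- pattern_energy G r s h J y b)"])
      show "?rest z = ?rest x" if "x \<in> V \<rightarrow>\<^sub>E UNIV" "z \<in> block x" for x z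
        using that N_block[OF that] by (intro energy_updated[OF F J]) (auto simp: block_def)
    qed (auto simp: q pattern_rate_def q' intro!: sum_pos)
    then show "measure_pmf.expectation (?K b) (energy r s h J V \<sigma>) - shannon_entropy V (?K b) + ?D b
        \<le> measure_pmf.expectation \<zeta> (energy r s h J V \<sigma>) - shannon_entropy V \<zeta>" .
  qed
  have "free_energy h J (?C \<bind> ?K) \<le> measure_pmf.expectation ?C (\<lambda>b. free_energy h J (?K b))"
  proof -
    have "measure_pmf.expectation (?C \<bind> ?K) (energy r s h J V \<sigma>) =
        measure_pmf.expectation ?C (\<lambda>b. measure_pmf.expectation (?K b) (energy r s h J V \<sigma>))"
      using finC finite_support_finite_config_prob[OF K finite_V] by (rule expectation_bind_pmf)
    moreover have "measure_pmf.expectation ?C (\<lambda>b. shannon_entropy V (?K b)) \<le> shannon_entropy V (?C \<bind> ?K)"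
      by (rule shannon_entropy_bind[OF finC K finite_V])
    ultimately show ?thesis
      using finC by (simp add: free_energy_def integrable_measure_pmf_finite)
  qed
  also have "\<dots> \<le> measure_pmf.expectation ?C (\<lambda>b. free_energy h J \<zeta> - ?D b)"
    using finC drop by (intro integral_mono integrable_measure_pmf_finite) (auto simp: le_diff_eq)
  also have "\<dots> = free_energy h J \<zeta> - measure_pmf.expectation ?C ?D"
    using finC by (simp add: integrable_measure_pmf_finite)
  finally show "free_energy h J (resampled_pmf \<sigma> V F y q \<zeta>) + measure_pmf.expectation ?C ?D \<le> free_energy h J \<zeta>"
    unfolding eq by simp
qed

end

text \<open>The local observable whose mean measures the gain from the trial law; \<open>tr\<close>
  places the pattern around the site \<open>\<gamma>\<close>.\<close>

definition pattern_test :: "'g \<Rightarrow> ('g \<Rightarrow> 'g) \<Rightarrow> 'g set \<Rightarrow> ('g \<Rightarrow> 'a) \<Rightarrow> ('a \<Rightarrow> real) \<Rightarrow> ('g \<Rightarrow> 'a) \<Rightarrow> real" where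
  "pattern_test \<gamma> tr F y g z = of_bool (\<forall>\<kappa>\<in>F. z (tr \<kappa>) = y \<kappa>) * g (z \<gamma>)"

lemma local_on_pattern_test: "local_on (insert \<gamma> (tr ` F)) (pattern_test \<gamma> tr F y g)"
  by (rule local_onI) (simp add: pattern_test_def)

context marked_group
begin

definition isolated_coin :: "'g set \<Rightarrow> ('g \<Rightarrow> bool) \<Rightarrow> real" where
  "isolated_coin F b = of_bool (b \<one> \<and> (\<forall>\<kappa>\<in>F. \<not> b \<kappa>))"

text \<open>For finite \<open>F\<close> without the identity this is
  \<open>(1 / 2) ^ (card F + 1)\<close>. It is kept in the form produced by
  \<open>expectation_Pi_pmf_local\<close>, since only its positivity is used.\<close>

definition selection_prob :: "'g set \<Rightarrow> real" where
  "selection_prob F = (\<Sum>w\<in>insert \<one> F \<rightarrow>\<^sub>E UNIV. isolated_coin F w *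
    (\<Prod>\<gamma>\<in>insert \<one> F. pmf (bernoulli_pmf (1 / 2)) (w \<gamma>)))"

lemma selection_prob_pos:
  assumes "finite F" "\<one> \<notin> F"
  shows "0 < selection_prob F"
proof -
  let ?w = "\<lambda>\<gamma>\<in>insert \<one> F. \<gamma> = \<one>"
  let ?f = "\<lambda>w. isolated_coin F w * (\<Prod>\<gamma>\<in>insert \<one> F. pmf (bernoulli_pmf (1 / 2)) (w \<gamma>))"
  have half: "pmf (bernoulli_pmf (1 / 2)) c = 1 / 2" for c
    by (cases c) simp_all
  have "?f ?w \<le> selection_prob F"
    unfolding selection_prob_def using assms(1)
    by (intro member_le_sum) (auto simp: isolated_coin_def prod_nonneg intro!: finite_PiE)
  moreover have "isolated_coin F ?w = 1"
    using assms(2) by (auto simp: isolated_coin_def)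
  then have "0 < ?f ?w"
    by (simp add: half)
  ultimately show ?thesis by linarith
qed

end

section \<open>Expected gain over the updated sites, and crude bounds on the free energy\<close>

context finite_action
begin

text \<open>\<open>\<sigma> \<gamma>\<close> permutes \<open>V\<close>, so averaging over vertices
  moves a discrepancy found at an arbitrary site \<open>\<gamma>\<close> to the base vertex, where
  the updates act.\<close>

lemma site_mean_pattern_test_shift:
  assumes F: "F \<subseteq> carrier G" and \<gamma>: "\<gamma> \<in> carrier G"
  shows "site_mean G V \<sigma> (pattern_test \<gamma> (\<lambda>\<kappa>. \<kappa> \<otimes> \<gamma>) F y g) x =
    (\<Sum>v\<in>V. of_bool (\<forall>\<kappa>\<in>F. x (\<sigma> \<kappa> v) = y \<kappa>) * g (x v)) / real (card V)"
proof -
  let ?k = "\<lambda>v. of_bool (\<forall>\<kappa>\<in>F. x (\<sigma> \<kappa> v) = y \<kappa>) * g (x v)"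
  have "pattern_test \<gamma> (\<lambda>\<kappa>. \<kappa> \<otimes> \<gamma>) F y g (pullback_name G \<sigma> x v) = ?k (\<sigma> \<gamma> v)" if "v \<in> V" for v
  proof -
    have "(\<forall>\<kappa>\<in>F. pullback_name G \<sigma> x v (\<kappa> \<otimes> \<gamma>) = y \<kappa>) \<longleftrightarrow> (\<forall>\<kappa>\<in>F. x (\<sigma> \<kappa> (\<sigma> \<gamma> v)) = y \<kappa>)"
      using F \<gamma> that by (intro ball_cong refl) (auto simp: pullback_name_def action_mult subset_iff)
    moreover have "pullback_name G \<sigma> x v \<gamma> = x (\<sigma> \<gamma> v)"
      using \<gamma> by (simp add: pullback_name_def)
    ultimately show ?thesis by (simp only: pattern_test_def)
  qed
  then have "(\<Sum>v\<in>V. pattern_test \<gamma> (\<lambda>\<kappa>. \<kappa> \<otimes> \<gamma>) F y g (pullback_name G \<sigma> x v)) = (\<Sum>v\<in>V. ?k (\<sigma> \<gamma> v))"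
    by (rule sum.cong[OF refl])
  also have "\<dots> = (\<Sum>v\<in>V. ?k v)"
    by (rule sum.reindex_bij_betw[OF action_bij[OF \<gamma>]])
  finally show ?thesis by (simp only: site_mean_def)
qed

text \<open>Coins are independent of the configuration, so each vertex contributes its selection
  probability times the \<open>\<zeta>\<close>-mean of the test there. Off collisions the first
  factor is \<open>selection_prob F\<close>; at a collision the replacement costs at most
  \<open>(1 + selection_prob F) * B\<close>.\<close>

lemma expectation_updated_ge:
  fixes y :: "'g \<Rightarrow> 'a::finite" and g :: "'a \<Rightarrow> real"
  assumes F: "finite F" "F \<subseteq> carrier G" and \<gamma>: "\<gamma> \<in> carrier G"
    and B: "\<And>a. \<bar>g a\<bar> \<le> B" and \<zeta>: "\<zeta> \<in> finite_config_prob V" and V: "V \<noteq> {}"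
  shows "selection_prob F * real (card V) * measure_pmf.expectation \<zeta> (site_mean G V \<sigma> (pattern_test \<gamma> (\<lambda>\<kappa>. \<kappa> \<otimes> \<gamma>) F y g))
      - (1 + selection_prob F) * B * real (card (collisions (insert \<one> F)))
    \<le> measure_pmf.expectation (Pi_pmf V False (\<lambda>_. bernoulli_pmf (1 / 2))) (\<lambda>b.
        measure_pmf.expectation \<zeta> (\<lambda>x. \<Sum>v\<in>updated F y b x. g (x v)))"
proof -
  let ?C = "Pi_pmf V False (\<lambda>_. bernoulli_pmf (1 / 2))"
  let ?p = "selection_prob F" and ?M = "insert \<one> F"
  let ?sel = "\<lambda>v b. isolated_coin F (\<lambda>\<gamma>. b (\<sigma> \<gamma> v))"
  let ?k = "\<lambda>v x. of_bool (\<forall>\<kappa>\<in>F. x (\<sigma> \<kappa> v) = y \<kappa>) * g (x v)"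
  let ?P = "\<lambda>v. measure_pmf.expectation ?C (?sel v)" and ?e = "\<lambda>v. measure_pmf.expectation \<zeta> (?k v)"
  have finC: "finite (set_pmf ?C)" by (rule finite_set_Pi_pmf[OF finite_V])
  have fin\<zeta>: "finite (set_pmf \<zeta>)" by (rule finite_support_finite_config_prob[OF \<zeta> finite_V])
  have B0: "0 \<le> B" using B[of undefined] by simp
  have M: "finite ?M" "?M \<subseteq> carrier G" using F by auto
  have loc: "local_on ?M (isolated_coin F)"
    by (rule local_onI) (simp add: isolated_coin_def)
  have P: "?P v = ?p" if "v \<in> V" "v \<notin> collisions ?M" for v
    unfolding selection_prob_def
  proof (rule expectation_Pi_pmf_local[OF finite_V M(1) loc])
    show "inj_on (\<lambda>\<gamma>. \<sigma> \<gamma> v) ?M" using that by (simp add: collisions_def)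
    show "(\<lambda>\<gamma>. \<sigma> \<gamma> v) ` ?M \<subseteq> V" using that M(2) action_closed by blast
  qed
  have p0: "0 \<le> ?p"
    unfolding selection_prob_def by (intro sum_nonneg mult_nonneg_nonneg prod_nonneg) (simp_all add: isolated_coin_def)
  have P01: "0 \<le> ?P v" "?P v \<le> 1" for v
  proof -
    show "0 \<le> ?P v" by (rule Bochner_Integration.integral_nonneg) (simp add: isolated_coin_def)
    have "?P v \<le> measure_pmf.expectation ?C (\<lambda>_. 1)"
      using finC by (intro integral_mono integrable_measure_pmf_finite) (auto simp: isolated_coin_def)
    then show "?P v \<le> 1" by simp
  qed
  have e: "\<bar>?e v\<bar> \<le> B" for v
  proof -
    have "\<bar>?e v\<bar> \<le> measure_pmf.expectation \<zeta> (\<lambda>x. \<bar>?k v x\<bar>)"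
      by (rule integral_abs_bound)
    also have "\<dots> \<le> measure_pmf.expectation \<zeta> (\<lambda>_. B)"
      using fin\<zeta> B B0 by (intro integral_mono integrable_measure_pmf_finite) auto
    finally show ?thesis by simp
  qed
  have upd: "(\<Sum>v\<in>updated F y b x. g (x v)) = (\<Sum>v\<in>V. ?sel v b * ?k v x)" for b x
  proof -
    have "(\<Sum>v\<in>updated F y b x. g (x v)) = (\<Sum>v\<in>V. if updates \<sigma> F y b x v then g (x v) else 0)"
      unfolding updated_def using finite_V by (rule sum.inter_filter)
    also have "\<dots> = (\<Sum>v\<in>V. ?sel v b * ?k v x)"
      by (intro sum.cong refl) (auto simp: updates_def isolated_coin_def action_one)
    finally show ?thesis .
  qed
  have "measure_pmf.expectation ?C (\<lambda>b. measure_pmf.expectation \<zeta> (\<lambda>x. \<Sum>v\<in>updated F y b x. g (x v))) =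
      (\<Sum>v\<in>V. ?P v * ?e v)"
  proof -
    have "measure_pmf.expectation \<zeta> (\<lambda>x. \<Sum>v\<in>V. ?sel v b * ?k v x) = (\<Sum>v\<in>V. ?sel v b * ?e v)" for b
      by (subst Bochner_Integration.integral_sum) (intro integrable_measure_pmf_finite fin\<zeta>, simp)
    moreover have "measure_pmf.expectation ?C (\<lambda>b. \<Sum>v\<in>V. ?sel v b * ?e v) = (\<Sum>v\<in>V. ?P v * ?e v)"
      by (subst Bochner_Integration.integral_sum) (intro integrable_measure_pmf_finite finC, simp)
    ultimately show ?thesis unfolding upd by simp
  qed
  moreover have "(\<Sum>v\<in>V. ?p * ?e v - (if v \<in> collisions ?M then (1 + ?p) * B else 0)) \<le> (\<Sum>v\<in>V. ?P v * ?e v)"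
  proof (rule sum_mono)
    fix v assume v: "v \<in> V"
    show "?p * ?e v - (if v \<in> collisions ?M then (1 + ?p) * B else 0) \<le> ?P v * ?e v"
    proof (cases "v \<in> collisions ?M")
      case True
      have "(?p - ?P v) * ?e v \<le> \<bar>?p - ?P v\<bar> * \<bar>?e v\<bar>"
        unfolding abs_mult[symmetric] by (rule abs_ge_self)
      also have "\<dots> \<le> (1 + ?p) * B"
        using P01[of v] p0 e[of v] by (intro mult_mono) auto
      finally show ?thesis using True by (simp add: left_diff_distrib)
    qed (simp add: P v)
  qed
  moreover have "(\<Sum>v\<in>V. ?p * ?e v - (if v \<in> collisions ?M then (1 + ?p) * B else 0)) =
      ?p * (\<Sum>v\<in>V. ?e v) - (1 + ?p) * B * real (card (collisions ?M))"
    using finite_V collisions_subset[of ?M]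
    by (simp add: sum_subtractf sum_distrib_left sum.If_cases Int_absorb1)
  moreover have "measure_pmf.expectation \<zeta> (site_mean G V \<sigma> (pattern_test \<gamma> (\<lambda>\<kappa>. \<kappa> \<otimes> \<gamma>) F y g)) =
      (\<Sum>v\<in>V. ?e v) / real (card V)"
    unfolding site_mean_pattern_test_shift[OF F(2) \<gamma>] integral_divide_zero
    by (intro arg_cong2[of _ _ _ _ "(/)"] refl Bochner_Integration.integral_sum integrable_measure_pmf_finite fin\<zeta>)
  ultimately show ?thesis
    using V finite_V by simp
qed

text \<open>Each interaction is bounded by the sum of all absolute values, and the entropy by that
  of the uniform law. Only the linear growth in \<open>card V\<close> matters.\<close>

lemma free_energy_ge:
  fixes h :: "'a::finite \<Rightarrow> real"
  assumes \<zeta>: "\<zeta> \<in> finite_config_prob V"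
  shows "- real (card V) * ((\<Sum>a\<in>UNIV. \<bar>h a\<bar>) + real r * (\<Sum>a\<in>UNIV. \<Sum>c\<in>UNIV. \<bar>J a c\<bar>) + ln (real CARD('a)))
    \<le> free_energy h J \<zeta>"
proof -
  let ?H = "\<Sum>a\<in>UNIV. \<bar>h a\<bar>" and ?J = "\<Sum>a\<in>UNIV. \<Sum>c\<in>UNIV. \<bar>J a c\<bar>"
  have h: "- ?H \<le> h a" for a
    using member_le_sum[of a UNIV "\<lambda>a. \<bar>h a\<bar>"] by simp
  have J: "- ?J \<le> J a c" for a c
    using member_le_sum[of a UNIV "\<lambda>a. \<Sum>c\<in>UNIV. \<bar>J a c\<bar>"] member_le_sum[of c UNIV "\<lambda>c. \<bar>J a c\<bar>"]
    by (simp add: sum_nonneg)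
  have U: "- real (card V) * (?H + real r * ?J) \<le> energy r s h J V \<sigma> x" for x
  proof -
    have "(\<Sum>v\<in>V. - ?H) + (\<Sum>v\<in>V. \<Sum>i\<in>{1..r}. - ?J) \<le> energy r s h J V \<sigma> x"
      unfolding energy_def by (intro add_mono sum_mono h J)
    then show ?thesis by (simp add: algebra_simps)
  qed
  have "measure_pmf.expectation \<zeta> (\<lambda>_. - real (card V) * (?H + real r * ?J)) \<le>
      measure_pmf.expectation \<zeta> (energy r s h J V \<sigma>)"
    using U finite_support_finite_config_prob[OF \<zeta> finite_V]
    by (intro integral_mono integrable_measure_pmf_finite)
  then show ?thesis
    using shannon_entropy_le[OF \<zeta> finite_V] by (simp add: free_energy_def algebra_simps)
qed

lemma free_energy_const:
  fixes h :: "'a::finite \<Rightarrow> real"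
  shows "free_energy h J (return_pmf (\<lambda>v\<in>V. a)) \<le> real (card V) * (h a + real r * J a a)"
proof -
  let ?x = "\<lambda>v\<in>V. a"
  have "0 \<le> shannon_entropy V (return_pmf ?x)"
    unfolding shannon_entropy_def by (auto simp: pmf_return indicator_def sum_nonpos)
  moreover have "energy r s h J V \<sigma> ?x = real (card V) * (h a + real r * J a a)"
    unfolding energy_def using s_closed action_closed by (simp add: algebra_simps)
  ultimately show ?thesis by (simp add: free_energy_def)
qed

end

section \<open>Comparison of free energy densities\<close>

lemma ex_pmf_finite:
  fixes f :: "'a::finite \<Rightarrow> real"
  assumes nn: "\<And>a. 0 \<le> f a" and s: "(\<Sum>a\<in>UNIV. f a) = 1"
  obtains q where "\<And>a. pmf q a = f a"
proof
  show "pmf (embed_pmf f) a = f a" for a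
  proof (rule pmf_embed_pmf[OF nn])
    show "(\<integral>\<^sup>+ a. ennreal (f a) \<partial>count_space UNIV) = 1"
      using nn s by (simp add: nn_integral_count_space_finite)
  qed
qed

lemma ln_one_plus_ge:
  fixes u :: real
  assumes "\<bar>u\<bar> \<le> 1 / 2"
  shows "u - 2 * u\<^sup>2 \<le> ln (1 + u)"
  using abs_ln_one_plus_x_minus_x_bound[OF assms] by linarith

lemma integral_return_config_space:
  fixes f :: "('g \<Rightarrow> 'a::finite) \<Rightarrow> real"
  assumes "finite M" "M \<subseteq> carrier G" "local_on M f"
  shows "(\<integral>x. f x \<partial>return (config_space G) (\<lambda>\<gamma>\<in>carrier G. a)) = f (\<lambda>\<gamma>\<in>carrier G. a)"
  using borel_measurable_local[OF assms]
  by (intro integral_return) (auto simp: space_config_space)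

section \<open>Passing to the limit along the sequence of models\<close>

locale action_sequence = marked_group G r s
  for G :: "('g, 'm) monoid_scheme" (structure) and r s +
  fixes V :: "nat \<Rightarrow> 'v set" and \<sigma> :: "nat \<Rightarrow> 'g \<Rightarrow> 'v \<Rightarrow> 'v"
  assumes finite_action: "finite_action G r s (V n) (\<sigma> n)"
    and card_at_top: "filterlim (\<lambda>n. card (V n)) at_top sequentially"
    and total_defect_0: "(\<lambda>n. total_defect G r s (V n) (\<sigma> n)) \<longlonglongrightarrow> 0"
begin

lemma eventually_nonempty: "\<forall>\<^sub>F n in sequentially. V n \<noteq> {}"
proof -
  have "\<forall>\<^sub>F n in sequentially. 1 \<le> card (V n)"
    using card_at_top by (simp add: filterlim_at_top)
  then show ?thesis by (rule eventually_mono) auto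
qed

text \<open>The finitely many elements \<open>inv \<gamma> \<otimes> \<gamma>'\<close> have a common
  bound \<open>R\<close> on their word lengths, and the total defect eventually drops below the
  threshold of \<open>collisions_lt\<close> for this \<open>R\<close>.\<close>

lemma eventually_few_collisions:
  assumes M: "finite M" "M \<subseteq> carrier G" and e: "0 < e"
  shows "\<forall>\<^sub>F n in sequentially. real (card (finite_action.collisions (V n) (\<sigma> n) M)) / real (card (V n)) < e"
proof -
  have "\<exists>k. word_length G r s k (inv \<gamma> \<otimes> \<gamma>')" if "\<gamma> \<in> M" "\<gamma>' \<in> M" for \<gamma> \<gamma>'
    using that M(2) by (intro ex_word_length) auto
  then obtain k where k: "\<And>\<gamma> \<gamma>'. \<gamma> \<in> M \<Longrightarrow> \<gamma>' \<in> M \<Longrightarrow> word_length G r s (k \<gamma> \<gamma>') (inv \<gamma> \<otimes> \<gamma>')"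
    by metis
  \<comment> \<open>Inserting 0 keeps the maximum meaningful for empty \<open>M\<close>.\<close>
  define R where "R = Max (insert 0 ((\<lambda>(\<gamma>, \<gamma>'). k \<gamma> \<gamma>') ` (M \<times> M)))"
  have R: "\<exists>k\<le>R. word_length G r s k (inv \<gamma> \<otimes> \<gamma>')" if "\<gamma> \<in> M" "\<gamma>' \<in> M" for \<gamma> \<gamma>'
  proof (intro exI conjI)
    show "k \<gamma> \<gamma>' \<le> R"
      unfolding R_def using M(1) that by (intro Max_ge) auto
    show "word_length G r s (k \<gamma> \<gamma>') (inv \<gamma> \<otimes> \<gamma>')" by (rule k[OF that])
  qed
  have "0 < min (9 * (2 / 3) ^ R) e" using e by simp
  with total_defect_0 have "\<forall>\<^sub>F n in sequentially. total_defect G r s (V n) (\<sigma> n) < min (9 * (2 / 3) ^ R) e"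
    by (rule order_tendstoD(2))
  then show ?thesis
  proof (rule eventually_mono)
    fix n assume small: "total_defect G r s (V n) (\<sigma> n) < min (9 * (2 / 3) ^ R) e"
    interpret finite_action G r s "V n" "\<sigma> n" by (rule finite_action)
    show "real (card (collisions M)) / real (card (V n)) < e"
      using M(2) R small by (rule collisions_lt)
  qed
qed

abbreviation density :: "('a::finite \<Rightarrow> real) \<Rightarrow> ('a \<Rightarrow> 'a \<Rightarrow> real) \<Rightarrow> nat \<Rightarrow> ('v \<Rightarrow> 'a) pmf \<Rightarrow> real" where
  "density h J n \<zeta> \<equiv> 1 / real (card (V n)) *
    (measure_pmf.expectation \<zeta> (energy r s h J (V n) (\<sigma> n)) - shannon_entropy (V n) \<zeta>)"

lemma density_eq: "density h J n \<zeta> = finite_action.free_energy r s (V n) (\<sigma> n) h J \<zeta> / real (card (V n))"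
  by (simp add: finite_action.free_energy_def[OF finite_action])

text \<open>The whole of \<open>config_prob G\<close> is already an admissible neighborhood. A
  strict drop contradicts minimality only if the minimum is finite.\<close>

lemma free_energy_density_bounded_below:
  fixes \<mu> :: "('g \<Rightarrow> 'a::finite) measure"
  assumes \<mu>: "\<mu> \<in> config_prob G"
  shows "free_energy_density G r s h J V \<sigma> \<mu> \<noteq> -\<infinity>"
proof -
  define c where "c = (\<Sum>a\<in>UNIV. \<bar>h a\<bar>) + real r * (\<Sum>a\<in>UNIV. \<Sum>c\<in>UNIV. \<bar>J a c\<bar>) + ln (real CARD('a))"
  let ?L = "limsup (\<lambda>n. INF \<zeta>\<in>good_models G (V n) (\<sigma> n) (config_prob G). ereal (density h J n \<zeta>))"
  have "limsup (\<lambda>n. ereal (- c)) \<le> ?L"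
  proof (rule Limsup_mono, rule eventually_mono[OF eventually_nonempty])
    fix n assume n: "V n \<noteq> {}"
    interpret finite_action G r s "V n" "\<sigma> n" by (rule finite_action)
    show "ereal (- c) \<le> (INF \<zeta>\<in>good_models G (V n) (\<sigma> n) (config_prob G). ereal (density h J n \<zeta>))"
    proof (rule INF_greatest)
      fix \<zeta> :: "('v \<Rightarrow> 'a) pmf" assume "\<zeta> \<in> good_models G (V n) (\<sigma> n) (config_prob G)"
      then have "\<zeta> \<in> finite_config_prob (V n)" by (simp add: good_models_def)
      from free_energy_ge[OF this, of h J, folded c_def] have "- c * real (card (V n)) \<le> free_energy h J \<zeta>"
        by (simp add: mult.commute)
      moreover have "0 < real (card (V n))" using n finite_V by (simp add: card_gt_0_iff)
      ultimately show "ereal (- c) \<le> ereal (density h J n \<zeta>)"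
        unfolding density_eq by (simp add: pos_le_divide_eq)
    qed
  qed
  also have "?L \<le> free_energy_density G r s h J V \<sigma> \<mu>"
    unfolding free_energy_density_def using \<mu> openin_config_prob by (intro SUP_upper) auto
  finally have "ereal (- c) \<le> free_energy_density G r s h J V \<sigma> \<mu>"
    by (simp add: Limsup_const)
  then show ?thesis by auto
qed

text \<open>The point mass at a constant configuration: constant configurations of the models pull
  back to it exactly, and their free energy is at most linear in the number of vertices.\<close>

lemma ex_free_energy_density_finite:
  fixes h :: "'a::finite \<Rightarrow> real"
  shows "\<exists>\<nu>\<in>config_prob G. free_energy_density G r s h J V \<sigma> \<nu> \<noteq> \<infinity>"
proof -
  fix a :: 'a
  let ?x = "\<lambda>\<gamma>\<in>carrier G. a"
  let ?\<nu> = "return (config_space G) ?x"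
  have \<nu>: "?\<nu> \<in> config_prob G"
    by (auto simp: config_prob_def space_config_space intro!: prob_space_return)
  have "free_energy_density G r s h J V \<sigma> ?\<nu> \<le> ereal (h a + real r * J a a)"
    unfolding free_energy_density_def
  proof (rule SUP_least)
    fix \<O> :: "('g \<Rightarrow> 'a) measure set"
    assume "\<O> \<in> {\<O>. openin (weak_topology G) \<O> \<and> ?\<nu> \<in> \<O>}"
    then obtain \<F> :: "(('g \<Rightarrow> 'a) \<Rightarrow> real) set" and e :: real where \<F>: "0 < e"
      "\<And>f. f \<in> \<F> \<Longrightarrow> \<exists>M. finite M \<and> M \<subseteq> carrier G \<and> local_on M f"
      "\<And>\<nu>'. \<nu>' \<in> config_prob G \<Longrightarrow> (\<And>f. f \<in> \<F> \<Longrightarrow> \<bar>(\<integral>x. f x \<partial>\<nu>') - (\<integral>x. f x \<partial>?\<nu>)\<bar> < e) \<Longrightarrow> \<nu>' \<in> \<O>"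
      using weak_neighborhood[of G \<O> ?\<nu>] \<nu> by (smt (verit) mem_Collect_eq)
    have "limsup (\<lambda>n. INF \<zeta>\<in>good_models G (V n) (\<sigma> n) \<O>. ereal (density h J n \<zeta>))
        \<le> limsup (\<lambda>n. ereal (h a + real r * J a a))"
    proof (rule Limsup_mono, rule eventually_mono[OF eventually_nonempty])
      fix n assume n: "V n \<noteq> {}"
      interpret finite_action G r s "V n" "\<sigma> n" by (rule finite_action)
      let ?\<zeta> = "return_pmf (\<lambda>v\<in>V n. a)"
      have "mean_empirical G (V n) (\<sigma> n) ?\<zeta> \<in> \<O>"
      proof (rule \<F>(3)[OF mean_empirical_config_prob[OF finite_V n]])
        fix f assume "f \<in> \<F>"
        with \<F>(2) obtain M where M: "finite M" "M \<subseteq> carrier G" "local_on M f" by blast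
        have "pullback_name G (\<sigma> n) (\<lambda>v\<in>V n. a) v = ?x" if "v \<in> V n" for v
          using that by (auto simp: pullback_name_def action_closed)
        then have "site_mean G (V n) (\<sigma> n) f (\<lambda>v\<in>V n. a) = f ?x"
          using n finite_V by (simp add: site_mean_def)
        then show "\<bar>(\<integral>x. f x \<partial>mean_empirical G (V n) (\<sigma> n) ?\<zeta>) - (\<integral>x. f x \<partial>?\<nu>)\<bar> < e"
          using \<F>(1) by (simp add: integral_mean_empirical[OF finite_V n M] integral_return_config_space[OF M])
      qed
      then have "?\<zeta> \<in> good_models G (V n) (\<sigma> n) \<O>"
        by (simp add: good_models_def finite_config_prob_def)
      then have "(INF \<zeta>\<in>good_models G (V n) (\<sigma> n) \<O>. ereal (density h J n \<zeta>)) \<le> ereal (density h J n ?\<zeta>)"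
        by (rule INF_lower)
      also have "\<dots> \<le> ereal (h a + real r * J a a)"
        using free_energy_const[of h J a] n finite_V
        unfolding density_eq by (simp add: pos_divide_le_eq card_gt_0_iff mult.commute)
      finally show "(INF \<zeta>\<in>good_models G (V n) (\<sigma> n) \<O>. ereal (density h J n \<zeta>)) \<le> ereal (h a + real r * J a a)" .
    qed
    then show "limsup (\<lambda>n. INF \<zeta>\<in>good_models G (V n) (\<sigma> n) \<O>. ereal (density h J n \<zeta>)) \<le> ereal (h a + real r * J a a)"
      by (simp add: Limsup_const)
  qed
  with \<nu> show ?thesis by force
qed

text \<open>For each neighborhood of the resampled measure there is one of \<open>\<mu>\<close>
  whose good models are resampled into good models of the first, at a gain per vertex that does not
  depend on the neighborhoods.\<close>

lemma density_resampled:
  fixes y :: "'g \<Rightarrow> 'a::finite" and \<mu> :: "('g \<Rightarrow> 'a) measure"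
  assumes F: "finite F" "F \<subseteq> carrier G" "\<one> \<notin> F" "neighborhood G r s \<subseteq> F" and \<gamma>: "\<gamma> \<in> carrier G"
    and J: "\<And>a c. J a c = J c a"
    and q: "\<And>a. pmf q a = pattern_rate G r s h J y a" and q': "\<And>a. 0 < pmf q' a"
    and g: "\<And>a. g a = ln (pmf q' a) - ln (pmf q a)"
    and \<mu>: "\<mu> \<in> config_prob G" and \<eta>: "0 < \<eta>" "(\<integral>x. pattern_test \<gamma> (\<lambda>\<kappa>. \<kappa> \<otimes> \<gamma>) F y g x \<partial>\<mu>) = \<eta>"
  shows "free_energy_density G r s h J V \<sigma> (resampled_measure G F y q \<mu>) + ereal (selection_prob F * \<eta> / 4)
    \<le> free_energy_density G r s h J V \<sigma> \<mu>"
proof -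
  let ?\<nu> = "resampled_measure G F y q \<mu>" and ?t = "pattern_test \<gamma> (\<lambda>\<kappa>. \<kappa> \<otimes> \<gamma>) F y g"
  \<comment> \<open>Per vertex, a test mean above \<open>\<eta> / 2\<close> gains
    \<open>selection_prob F * \<eta> / 2 = 2 * \<epsilon>\<close>; collisions may consume one
    \<open>\<epsilon>\<close>.\<close>
  define \<epsilon> where "\<epsilon> = selection_prob F * \<eta> / 4"
  have p: "0 < selection_prob F" by (rule selection_prob_pos[OF F(1,3)])
  have \<epsilon>: "0 < \<epsilon>" using p \<eta> by (simp add: \<epsilon>_def)
  have \<nu>: "?\<nu> \<in> config_prob G"
    by (rule resampled_measure_config_prob[OF is_group F(1,2) \<mu>])
  define B where "B = (\<Sum>a\<in>UNIV. \<bar>g a\<bar>)"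
  have B: "\<bar>g a\<bar> \<le> B" for a
    unfolding B_def by (intro member_le_sum) auto
  have t: "finite (insert \<gamma> ((\<lambda>\<kappa>. \<kappa> \<otimes> \<gamma>) ` F))" "insert \<gamma> ((\<lambda>\<kappa>. \<kappa> \<otimes> \<gamma>) ` F) \<subseteq> carrier G"
    using F \<gamma> by auto
  have main: "limsup (\<lambda>n. INF \<zeta>\<in>good_models G (V n) (\<sigma> n) \<O>. ereal (density h J n \<zeta>)) + ereal \<epsilon>
      \<le> free_energy_density G r s h J V \<sigma> \<mu>"
    if \<O>: "openin (weak_topology G) \<O>" "?\<nu> \<in> \<O>" for \<O>
  proof -
    obtain \<F> :: "(('g \<Rightarrow> 'a) \<Rightarrow> real) set" and e :: real where \<F>: "finite \<F>" "0 < e"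
      "\<And>f. f \<in> \<F> \<Longrightarrow> \<exists>M. finite M \<and> M \<subseteq> carrier G \<and> local_on M f"
      "\<And>\<nu>'. \<nu>' \<in> config_prob G \<Longrightarrow> (\<And>f. f \<in> \<F> \<Longrightarrow> \<bar>(\<integral>x. f x \<partial>\<nu>') - (\<integral>x. f x \<partial>?\<nu>)\<bar> < e) \<Longrightarrow> \<nu>' \<in> \<O>"
      using weak_neighborhood[OF \<O> \<nu>] by (smt (verit))
    obtain D where D: "\<And>f. f \<in> \<F> \<Longrightarrow> finite (D f)" "\<And>f. f \<in> \<F> \<Longrightarrow> D f \<subseteq> carrier G"
      "\<And>f. f \<in> \<F> \<Longrightarrow> local_on (D f) f"
      using \<F>(3) by metis
    have "\<exists>b\<ge>0. \<forall>x. \<bar>f x\<bar> \<le> b" if "f \<in> \<F>" for f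
      using local_on_bounded[OF D(1,3)[OF that]] by metis
    then obtain b where b: "\<And>f. f \<in> \<F> \<Longrightarrow> 0 \<le> b f" "\<And>f x. f \<in> \<F> \<Longrightarrow> \<bar>f x\<bar> \<le> b f"
      by metis
    let ?T = "resampled_mean G F y q"
    have W: "finite (window G F (D f))" "window G F (D f) \<subseteq> carrier G" "local_on (window G F (D f)) (?T f)"
      if "f \<in> \<F>" for f
      using D(1,2)[OF that] F(1,2) by (auto intro: local_on_resampled_mean[OF D(3,2)[OF that]])
    \<comment> \<open>The first condition secures half of the gain; the others place the resampled
      model in \<open>\<O>\<close> up to the collision error, for which the other
      \<open>e / 2\<close> is reserved.\<close>
    define \<O>' where "\<O>' = {\<mu>' \<in> config_prob G. (\<integral>x. ?t x \<partial>\<mu>') \<in> {\<eta> / 2<..}} \<inter>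
      \<Inter>((\<lambda>f. {\<mu>' \<in> config_prob G. (\<integral>x. ?T f x \<partial>\<mu>') \<in> ball (\<integral>x. ?T f x \<partial>\<mu>) (e / 2)}) ` \<F>)"
    have "openin (weak_topology G) \<O>'"
      unfolding \<O>'_def
    proof (rule openin_Int_Inter)
      show "openin (weak_topology G) {\<mu>' \<in> config_prob G. (\<integral>x. ?t x \<partial>\<mu>') \<in> {\<eta> / 2<..}}"
        by (rule openin_weak_topology_local[OF t local_on_pattern_test]) simp
      show "openin (weak_topology G) X"
        if "X \<in> (\<lambda>f. {\<mu>' \<in> config_prob G. (\<integral>x. ?T f x \<partial>\<mu>') \<in> ball (\<integral>x. ?T f x \<partial>\<mu>) (e / 2)}) ` \<F>" for X
        using that by (elim imageE) (simp only: openin_weak_topology_local[OF W] open_ball)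
    qed (use \<F>(1) in simp)
    moreover have "\<mu> \<in> \<O>'"
      using \<mu> \<eta> \<F>(2) by (simp add: \<O>'_def)
    ultimately have "limsup (\<lambda>n. INF \<zeta>\<in>good_models G (V n) (\<sigma> n) \<O>'. ereal (density h J n \<zeta>))
        \<le> free_energy_density G r s h J V \<sigma> \<mu>"
      unfolding free_energy_density_def by (intro SUP_upper) simp
    moreover have "\<forall>\<^sub>F n in sequentially.
        (INF \<zeta>\<in>good_models G (V n) (\<sigma> n) \<O>. ereal (density h J n \<zeta>)) + ereal \<epsilon>
        \<le> (INF \<zeta>\<in>good_models G (V n) (\<sigma> n) \<O>'. ereal (density h J n \<zeta>))"
    proof -
      \<comment> \<open>Chosen so that the error \<open>2 * b f\<close> times this proportion is at
        most \<open>e / 2\<close>; the added 1 avoids division by zero, here and in the bound with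
        \<open>B + 1\<close>.\<close>
      have "\<forall>\<^sub>F n in sequentially. \<forall>f\<in>\<F>.
          real (card (finite_action.collisions (V n) (\<sigma> n) (window G F (D f)))) / real (card (V n)) < e / (4 * (b f + 1))"
        using \<F>(1,2) W b(1) by (intro eventually_ball_finite ballI eventually_few_collisions) (auto simp: add_nonneg_pos)
      moreover have "\<forall>\<^sub>F n in sequentially.
          real (card (finite_action.collisions (V n) (\<sigma> n) (insert \<one> F))) / real (card (V n))
            < \<epsilon> / ((1 + selection_prob F) * (B + 1))"
        using F(1,2) \<epsilon> p B[of undefined] by (intro eventually_few_collisions) auto
      ultimately show ?thesis
        using eventually_nonempty
      proof eventually_elim
        case (elim n)
        interpret finite_action G r s "V n" "\<sigma> n" by (rule finite_action)
        let ?c = "real (card (V n))"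
        have c: "0 < ?c" using elim(3) finite_V by (simp add: card_gt_0_iff)
        show ?case
        proof (rule INF_greatest)
          fix \<zeta> :: "('v \<Rightarrow> 'a) pmf" assume "\<zeta> \<in> good_models G (V n) (\<sigma> n) \<O>'"
          then have \<zeta>: "\<zeta> \<in> finite_config_prob (V n)" and emp: "mean_empirical G (V n) (\<sigma> n) \<zeta> \<in> \<O>'"
            by (simp_all add: good_models_def)
          let ?\<zeta>' = "resampled_pmf (\<sigma> n) (V n) F y q \<zeta>"
          note \<zeta>' = free_energy_resampled_pmf(1)[OF F(2,4) J q q' \<zeta>]
          have "mean_empirical G (V n) (\<sigma> n) ?\<zeta>' \<in> \<O>"
          proof (rule \<F>(4)[OF mean_empirical_config_prob[OF finite_V elim(3)]])
            fix f assume f: "f \<in> \<F>"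
            have "\<bar>(\<integral>x. ?T f x \<partial>mean_empirical G (V n) (\<sigma> n) \<zeta>) - (\<integral>x. ?T f x \<partial>\<mu>)\<bar> < e / 2"
              using emp f by (auto simp: \<O>'_def dist_real_def abs_minus_commute)
            moreover have "(\<integral>x. f x \<partial>?\<nu>) = (\<integral>x. ?T f x \<partial>\<mu>)"
              by (rule integral_resampled_measure[OF is_group F(1,2) \<mu> D[OF f]])
            moreover have "\<bar>(\<integral>x. f x \<partial>mean_empirical G (V n) (\<sigma> n) ?\<zeta>') -
                (\<integral>x. ?T f x \<partial>mean_empirical G (V n) (\<sigma> n) \<zeta>)\<bar>
              \<le> 2 * b f * (real (card (collisions (window G F (D f)))) / ?c)"
              unfolding integral_mean_empirical[OF finite_V elim(3) D[OF f]]
                integral_mean_empirical[OF finite_V elim(3) W[OF f]]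
              by (rule expectation_site_mean_resampled_pmf[OF F(1,2) D[OF f] b(2)[OF f] \<zeta>])
            moreover have "2 * b f * (real (card (collisions (window G F (D f)))) / ?c) \<le> e / 2"
            proof -
              have "2 * b f * (real (card (collisions (window G F (D f)))) / ?c) \<le> 2 * b f * (e / (4 * (b f + 1)))"
                by (intro mult_left_mono less_imp_le[OF bspec[OF elim(1) f]]) (simp add: b(1)[OF f])
              also have "\<dots> \<le> e / 2"
                using \<F>(2) b(1)[OF f] by (simp add: field_simps)
              finally show ?thesis .
            qed
            ultimately show "\<bar>(\<integral>x. f x \<partial>mean_empirical G (V n) (\<sigma> n) ?\<zeta>') - (\<integral>x. f x \<partial>?\<nu>)\<bar> < e"
              by linarith
          qed
          with \<zeta>' have good: "?\<zeta>' \<in> good_models G (V n) (\<sigma> n) \<O>"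
            by (simp add: good_models_def)
          have test: "\<eta> / 2 < measure_pmf.expectation \<zeta> (site_mean G (V n) (\<sigma> n) ?t)"
          proof -
            have "(\<integral>x. ?t x \<partial>mean_empirical G (V n) (\<sigma> n) \<zeta>) \<in> {\<eta> / 2<..}"
              using emp unfolding \<O>'_def by blast
            then show ?thesis
              unfolding integral_mean_empirical[OF finite_V elim(3) t local_on_pattern_test] by simp
          qed
          let ?k = "real (card (collisions (insert \<one> F)))"
          have "free_energy h J ?\<zeta>' +
              (selection_prob F * ?c * measure_pmf.expectation \<zeta> (site_mean G (V n) (\<sigma> n) ?t) - (1 + selection_prob F) * B * ?k)
            \<le> free_energy h J \<zeta>"
            using free_energy_resampled_pmf(2)[OF F(2,4) J q q' \<zeta>, folded g]
              expectation_updated_ge[OF F(1,2) \<gamma> B \<zeta> elim(3)]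
            by (rule order_trans[OF add_left_mono, rotated])
          moreover have "?c * (2 * \<epsilon>) \<le> selection_prob F * ?c * measure_pmf.expectation \<zeta> (site_mean G (V n) (\<sigma> n) ?t)"
          proof -
            have "selection_prob F * ?c * (\<eta> / 2) \<le> selection_prob F * ?c * measure_pmf.expectation \<zeta> (site_mean G (V n) (\<sigma> n) ?t)"
              using p c test by (intro mult_left_mono) auto
            then show ?thesis by (simp add: \<epsilon>_def mult.commute mult.left_commute)
          qed
          moreover have "(1 + selection_prob F) * B * ?k \<le> ?c * \<epsilon>"
          proof -
            have B0: "0 \<le> B" using B[of undefined] by simp
            have "(1 + selection_prob F) * B * ?k \<le> (1 + selection_prob F) * (B + 1) * ?k"
              using p B0 by (intro mult_right_mono) auto
            also have "\<dots> \<le> ?c * \<epsilon>"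
            proof -
              have "0 < (1 + selection_prob F) * (B + 1)" using p B0 by simp
              with elim(2) c show ?thesis
                by (simp add: divide_less_eq less_divide_eq mult.commute mult.left_commute)
            qed
            finally show ?thesis .
          qed
          ultimately have "free_energy h J ?\<zeta>' + ?c * \<epsilon> \<le> free_energy h J \<zeta>"
            by linarith
          then have "(free_energy h J ?\<zeta>' + ?c * \<epsilon>) / ?c \<le> free_energy h J \<zeta> / ?c"
            using c by (intro divide_right_mono) auto
          then have "density h J n ?\<zeta>' + \<epsilon> \<le> density h J n \<zeta>"
            using c unfolding density_eq by (simp add: add_divide_distrib)
          moreover have "(INF \<zeta>\<in>good_models G (V n) (\<sigma> n) \<O>. ereal (density h J n \<zeta>)) \<le> ereal (density h J n ?\<zeta>')"
            using good by (rule INF_lower)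
          then have "(INF \<zeta>\<in>good_models G (V n) (\<sigma> n) \<O>. ereal (density h J n \<zeta>)) + ereal \<epsilon> \<le> ereal (density h J n ?\<zeta>' + \<epsilon>)"
            unfolding plus_ereal.simps(1)[symmetric] by (rule add_right_mono)
          ultimately show "(INF \<zeta>\<in>good_models G (V n) (\<sigma> n) \<O>. ereal (density h J n \<zeta>)) + ereal \<epsilon> \<le> ereal (density h J n \<zeta>)"
            by (meson ereal_less_eq(3) order_trans)
        qed
      qed
    qed
    then have "limsup (\<lambda>n. (INF \<zeta>\<in>good_models G (V n) (\<sigma> n) \<O>. ereal (density h J n \<zeta>)) + ereal \<epsilon>)
        \<le> limsup (\<lambda>n. INF \<zeta>\<in>good_models G (V n) (\<sigma> n) \<O>'. ereal (density h J n \<zeta>))"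
      by (rule Limsup_mono)
    ultimately show ?thesis
      by (simp add: Limsup_add_ereal_right)
  qed
  \<comment> \<open>The same \<open>\<epsilon>\<close> serves every neighborhood, so the drop
    survives the supremum.\<close>
  have "free_energy_density G r s h J V \<sigma> ?\<nu> \<le> free_energy_density G r s h J V \<sigma> \<mu> - ereal \<epsilon>"
    unfolding free_energy_density_def[of G r s h J V \<sigma> ?\<nu>]
    using main by (intro SUP_least) (simp add: ereal_le_minus)
  then show ?thesis
    by (simp add: ereal_le_minus \<epsilon>_def)
qed

end

theorem theorem1:
  fixes G :: "('g, 'm) monoid_scheme" and r :: nat and s :: "nat \<Rightarrow> 'g"
    and J :: "'a::finite \<Rightarrow> 'a \<Rightarrow> real" and h :: "'a \<Rightarrow> real"
    and V :: "nat \<Rightarrow> 'v set" and \<sigma> :: "nat \<Rightarrow> 'g \<Rightarrow> 'v \<Rightarrow> 'v"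
    and \<mu> :: "('g \<Rightarrow> 'a) measure"
  assumes "group G" and "countable (carrier G)"
    and "s ` {1..r} \<subseteq> carrier G" and "generate G (s ` {1..r}) = carrier G"
    and "\<And>a b. J a b = J b a"
    and "\<And>n. finite (V n)" and "\<And>n. \<sigma> n \<in> hom G (BijGroup (V n))"
    and "filterlim (\<lambda>n. card (V n)) at_top sequentially"
    and "(\<lambda>n. total_defect G r s (V n) (\<sigma> n)) \<longlonglongrightarrow> 0"
    and "\<mu> \<in> config_prob G"
    and "\<And>\<nu>. \<nu> \<in> config_prob G \<Longrightarrow>
           free_energy_density G r s h J V \<sigma> \<mu> \<le> free_energy_density G r s h J V \<sigma> \<nu>"
  shows "gibbs_measure G r s h J \<mu>"
proof -
  interpret group G by fact
  interpret marked_group G r s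
    using assms(3,4) by unfold_locales auto
  interpret action_sequence G r s V \<sigma>
    using assms(6-9) by unfold_locales auto
  interpret \<mu>: prob_space \<mu> by (rule config_prob_prob_space[OF assms(10)])
  \<comment> \<open>Minimality against a measure of density other than \<open>\<infinity>\<close>
    bounds the value from above; with the lower bound it is a real number, which a positive
    increment must change.\<close>
  have finite_density: "\<bar>free_energy_density G r s h J V \<sigma> \<mu>\<bar> \<noteq> \<infinity>"
    using ex_free_energy_density_finite[of h J] assms(11) free_energy_density_bounded_below[OF assms(10), of h J]
    by (auto simp: top_unique)
  show ?thesis
  proof (rule gibbs_measureI[OF assms(3,10)], rule ccontr)
    fix \<gamma> F and y :: "'g \<Rightarrow> 'a" and a :: 'a
    assume \<gamma>: "\<gamma> \<in> carrier G" and F: "finite F" "F \<subseteq> carrier G" "\<one>\<^bsub>G\<^esub> \<notin> F" "neighborhood G r s \<subseteq> F"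
    let ?m = "\<lambda>x. of_bool (\<forall>\<kappa>\<in>F. x (\<kappa> \<otimes>\<^bsub>G\<^esub> \<gamma>) = y \<kappa>) :: real"
    let ?q = "pattern_rate G r s h J y"
    define I where "I = (\<integral>x. ?m x * (of_bool (x \<gamma> = a) - ?q a) \<partial>\<mu>)"
    assume "(\<integral>x. ?m x * (of_bool (x \<gamma> = a) - ?q a) \<partial>\<mu>) \<noteq> 0"
    then have I: "I \<noteq> 0" by (simp add: I_def)
    have Z: "0 < (\<Sum>b\<in>UNIV. exp (- pattern_energy G r s h J y b))"
      by (intro sum_pos) auto
    have q_pos: "0 < ?q b" for b
      using Z by (simp add: pattern_rate_def)
    have q_sum: "(\<Sum>b\<in>UNIV. ?q b) = 1"
      using Z by (simp add: pattern_rate_def flip: sum_divide_distrib)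
    then have q_le: "?q b \<le> 1" for b
      using member_le_sum[of b UNIV ?q] q_pos by (simp add: less_imp_le)
    obtain q where q: "\<And>b. pmf q b = ?q b"
      using ex_pmf_finite[of ?q] q_pos q_sum by (metis less_imp_le)

    \<comment> \<open>The observed discrepancy, with sign chosen so that its integral over the
      pattern is \<open>\<bar>I\<bar>\<close>; centered under \<open>q\<close> so that tilting
      \<open>q\<close> by it preserves total mass.\<close>
    define \<theta> where "\<theta> b = sgn I * (of_bool (b = a) - ?q a)" for b
    \<comment> \<open>The maximizer of \<open>t * \<bar>I\<bar> - 2 * t\<^sup>2\<close>, whose
      maximum is then \<open>2 * t\<^sup>2\<close>.\<close>
    define t where "t = \<bar>I\<bar> / 4"
    have \<theta>: "\<bar>\<theta> b\<bar> \<le> 1" for b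
      using q_pos[of a] q_le[of a] by (auto simp: \<theta>_def abs_mult sgn_if)
    have loc: "integrable \<mu> (\<lambda>x. ?m x * k (x \<gamma>))" for k :: "'a \<Rightarrow> real"
      using F \<gamma> local_on_pattern_test[of \<gamma> "\<lambda>\<kappa>. \<kappa> \<otimes>\<^bsub>G\<^esub> \<gamma>" F y k]
      by (intro integrable_local[OF assms(10), of "insert \<gamma> ((\<lambda>\<kappa>. \<kappa> \<otimes>\<^bsub>G\<^esub> \<gamma>) ` F)"]) (auto simp: pattern_test_def[abs_def])
    have I_abs: "(\<integral>x. ?m x * \<theta> (x \<gamma>) \<partial>\<mu>) = \<bar>I\<bar>"
    proof -
      have "(\<integral>x. ?m x * \<theta> (x \<gamma>) \<partial>\<mu>) = (\<integral>x. sgn I * (?m x * (of_bool (x \<gamma> = a) - ?q a)) \<partial>\<mu>)"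
        by (intro Bochner_Integration.integral_cong refl) (simp add: \<theta>_def)
      also have "\<dots> = sgn I * I" by (simp add: I_def)
      finally show ?thesis by (simp add: abs_sgn mult.commute)
    qed
    have "\<bar>I\<bar> \<le> (\<integral>x. 1 \<partial>\<mu>)"
      unfolding I_abs[symmetric] using \<theta> by (intro integral_mono loc) (auto simp: abs_le_iff)
    then have "\<bar>I\<bar> \<le> 1" by (simp add: \<mu>.prob_space)
    with I have t: "0 < t" "t \<le> 1 / 4" by (simp_all add: t_def)
    \<comment> \<open>This lies within the range of \<open>ln_one_plus_ge\<close> and keeps the
      tilting factor positive, so that \<open>q'\<close> has full support.\<close>
    have t\<theta>: "\<bar>t * \<theta> b\<bar> \<le> 1 / 4" for b
      using t \<theta>[of b] mult_mono[of t "1 / 4" "\<bar>\<theta> b\<bar>" 1] by (simp add: abs_mult)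
    then have t\<theta>_pos: "0 < 1 + t * \<theta> b" for b
      by (smt (verit) abs_le_iff divide_less_eq_1_pos)
    have \<theta>_mean: "(\<Sum>b\<in>UNIV. ?q b * \<theta> b) = 0"
    proof -
      have "(\<Sum>b\<in>UNIV. ?q b * \<theta> b) =
          (\<Sum>b\<in>UNIV. sgn I * (?q b * of_bool (b = a)) - sgn I * ?q a * ?q b)"
        by (intro sum.cong refl) (simp add: \<theta>_def algebra_simps)
      also have "\<dots> = sgn I * (\<Sum>b\<in>UNIV. ?q b * of_bool (b = a)) - sgn I * ?q a * (\<Sum>b\<in>UNIV. ?q b)"
        by (simp only: sum_subtractf sum_distrib_left)
      also have "(\<Sum>b\<in>UNIV. ?q b * of_bool (b = a)) = ?q a"
        by (simp add: of_bool_def if_distrib cong: if_cong)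
      finally show ?thesis by (simp add: q_sum)
    qed
    have "(\<Sum>b\<in>UNIV. ?q b * (1 + t * \<theta> b)) = (\<Sum>b\<in>UNIV. ?q b) + t * (\<Sum>b\<in>UNIV. ?q b * \<theta> b)"
      by (simp add: algebra_simps sum.distrib sum_distrib_left)
    moreover have "0 \<le> ?q b * (1 + t * \<theta> b)" for b
      using q_pos[of b] t\<theta>_pos[of b] by simp
    ultimately obtain q' where q': "\<And>b. pmf q' b = ?q b * (1 + t * \<theta> b)"
      using ex_pmf_finite[of "\<lambda>b. ?q b * (1 + t * \<theta> b)"] by (auto simp: \<theta>_mean q_sum)
    define g where "g b = ln (pmf q' b) - ln (pmf q b)" for b
    have g: "t * \<theta> b - 2 * t\<^sup>2 \<le> g b" for b
    proof -
      have "t * \<theta> b - 2 * (t * \<theta> b)\<^sup>2 \<le> ln (1 + t * \<theta> b)"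
        using t\<theta>[of b] by (intro ln_one_plus_ge) linarith
      moreover have "(t * \<theta> b)\<^sup>2 \<le> t\<^sup>2"
        using \<theta>[of b] by (simp add: power_mult_distrib mult_left_le abs_square_le_1)
      moreover have "g b = ln (1 + t * \<theta> b)"
        using q_pos t\<theta>_pos[of b] by (simp add: g_def q q' ln_mult less_imp_neq[THEN not_sym])
      ultimately show ?thesis by linarith
    qed
    define \<eta> where "\<eta> = (\<integral>x. pattern_test \<gamma> (\<lambda>\<kappa>. \<kappa> \<otimes>\<^bsub>G\<^esub> \<gamma>) F y g x \<partial>\<mu>)"
    have "0 < \<eta>"
    proof -
      have "t * \<bar>I\<bar> - 2 * t\<^sup>2 = (\<integral>x. t * (?m x * \<theta> (x \<gamma>)) - 2 * t\<^sup>2 \<partial>\<mu>)"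
        using loc by (simp add: I_abs \<mu>.prob_space)
      also have "\<dots> \<le> \<eta>"
        unfolding \<eta>_def pattern_test_def
      proof (intro integral_mono loc)
        \<comment> \<open>On the pattern this is the pointwise bound \<open>g\<close>; off it the
          right side is 0 and the left side is not positive.\<close>
        show "t * (?m x * \<theta> (x \<gamma>)) - 2 * t\<^sup>2 \<le> ?m x * g (x \<gamma>)" for x
          using g[of "x \<gamma>"] by (cases "\<forall>\<kappa>\<in>F. x (\<kappa> \<otimes>\<^bsub>G\<^esub> \<gamma>) = y \<kappa>") auto
      qed (use loc in simp)
      finally have "t * \<bar>I\<bar> - 2 * t\<^sup>2 \<le> \<eta>" .
      moreover have "t * \<bar>I\<bar> - 2 * t\<^sup>2 = 2 * t\<^sup>2"
        by (simp add: t_def power2_eq_square)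
      ultimately show ?thesis
        using t by (smt (verit) zero_less_power)
    qed
    have "free_energy_density G r s h J V \<sigma> (resampled_measure G F y q \<mu>) + ereal (selection_prob F * \<eta> / 4)
        \<le> free_energy_density G r s h J V \<sigma> \<mu>"
      using q_pos t\<theta>_pos
      by (intro density_resampled[OF F \<gamma> assms(5) q _ g_def assms(10) \<open>0 < \<eta>\<close> \<eta>_def[symmetric]]) (simp add: q')
    moreover have "free_energy_density G r s h J V \<sigma> \<mu> \<le> free_energy_density G r s h J V \<sigma> (resampled_measure G F y q \<mu>)"
      by (intro assms(11) resampled_measure_config_prob is_group F assms(10))
    moreover have "0 < selection_prob F * \<eta> / 4"
      using selection_prob_pos[OF F(1,3)] \<open>0 < \<eta>\<close> by simp
    ultimately show False
      using finite_density by (cases "free_energy_density G r s h J V \<sigma> \<mu>";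
          cases "free_energy_density G r s h J V \<sigma> (resampled_measure G F y q \<mu>)") auto
  qed
qed

end
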